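(* Let $\tau\in\{\text{ét},\mathrm{fppf}\}$. Suppose that the fibred category $\mathcal A$ over $\mathcal S$ is fibred in sets and that the fibred category $\mathcal X$ over $\mathcal S$ is fibred in setoids. Let $\mathcal G$ be a sheaf of groups on $\mathcal S_\tau$ and let $f:\mathcal Y\to\mathcal X$ be (the fibred category associated to) a $\mathcal G$-torsor over $\mathcal X_\tau$. Then the objects of $\mathcal X(\mathcal A)^f$ are characterized by $$\mathcal X(\mathcal A)^f=\bigcup_{\sigma\in\check H^1_\tau(\mathcal S,\mathcal G)}f^\sigma(\mathcal Y^\sigma(\mathcal A)),$$ where $f^\sigma:\mathcal Y^\sigma\to\mathcal X$ is the twist of $\mathcal Y$ by $\sigma$.
   Context: Fix a scheme $S$; $\mathcal S=\mathrm{Sch}/S$ is the category of $S$-schemes. A fibred category means a category fibred in groupoids; $\mathrm{Fib}/\mathcal S$ is the 2-category of fibred categories over $\mathcal S$ (1-morphisms: functors over $\mathcal S$; 2-morphisms: natural transformations over $\mathcal S$, all invertible). $\mathcal X(\mathcal T)$ is the groupoid of 1-morphisms $\mathcal T\to\mathcal X$ in $\mathrm{Fib}/\mathcal S$. $q:\mathcal A\to\mathcal S$ is a fixed fibred category. For a 1-morphism $f:\mathcal Y\to\mathcal X$, $f(\mathcal Y(\mathcal A))$ is the essential image of $\mathcal Y(\mathcal A)\to\mathcal X(\mathcal A)$, $y\mapsto f\circ y$. Equalities and unions of full subcategories are understood on objects. A setoid is a groupoid all of whose automorphism groups are trivial. For $\mathcal T\in\mathrm{Fib}/\mathcal S$,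 $\mathcal T_\tau$ is $\mathcal T$ with the topology inherited from the big site $\mathcal S_\tau=(\mathrm{Sch}/S)_\tau$. Pull-back of sheaves along a 1-morphism $u:\mathcal T'\to\mathcal T$ is composition with $u$, denoted $u^*$; a sheaf of groups $\mathcal G$ on $\mathcal S_\tau$ is pulled back to every $\mathcal T_\tau$ along the structure morphism and still denoted $\mathcal G$. $\mathsf H^1_\tau(\mathcal T,\mathcal G)$ is the set of isomorphism classes of right $\mathcal G$-torsors (sheaf torsors over the final object) on $\mathcal T_\tau$; $\mathsf H^1_\tau(\mathcal S,\mathcal G)\cong\check H^1_\tau(\mathcal S,\mathcal G)$ (Čech cohomology of the final object $S$). The fibred category associated to a torsor $\mathscr Y$ on $\mathcal T_\tau$ is $\mathcal Y\to\mathcal T$ with objects the pairs $(t,s)$, $t\in\mathcal T$, $s\in\mathscr Y(t)$, and morphisms $(t',s')\to(t,s)$ the morphisms $\phi:t'\to t$ with $\phi^*s=s'$; it is regarded in $\mathrm{Fib}/\mathcal S$ via $\mathcal T\to\mathcal S$. For a torsor $\mathscr Y$ over $\mathcal X_\tau$ with associated $f:\mathcal Y\to\mathcal X$, $\mathcal X(\mathcal A)^f$ is the full subcategory of $\mathcal X(\mathcal A)$ on those $x$ such that $[x^*\mathscr Y]\in\mathsf H^1_\tau(\mathcal A,\mathcal G)$ lies in the image of $q^*:\mathsf H^1_\tau(\mathcal S,\mathcal G)\to\mathsf H^1_\tau(\mathcal A,\mathcal G)$. Twist: let $a:\mathcal X\to\mathcal S$ be the structure morphism and let $\mathscr Z$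 be a $\mathcal G$-torsor on $\mathcal S_\tau$ representing $\sigma$, with $\mathrm{ad}(\mathscr Z)=\mathrm{Aut}_{\mathcal G}(\mathscr Z)$. The inverse torsor $(a^*\mathscr Z)^\circ$ is the same sheaf with left $\mathcal G$-action and right $a^*\mathrm{ad}(\mathscr Z)$-action given by $(g,z,h)\mapsto h^{-1}zg^{-1}$. The twist $\mathscr Y^\sigma$ is the contracted product $\mathscr Y\times^{\mathcal G}(a^*\mathscr Z)^\circ$ (quotient of the product by $(y,z)\cdot g=(yg,g^{-1}z)$), a right torsor under $\mathcal G^\sigma=a^*\mathrm{ad}(\mathscr Z)$; $f^\sigma:\mathcal Y^\sigma\to\mathcal X$ is its associated fibred category, determined up to isomorphism over $\mathcal X$ by $\mathscr Y$ and $\sigma$. *)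

theory Defs
  imports "HOL-Algebra.Algebra" "HOL-Analysis.Abstract_Topology"
begin

text \<open>\<open>HOL-Algebra\<close> reserves \<open>X\<close> for the variable of a polynomial ring.\<close>

no_notation var (\<open>X\<index>\<close>)

section \<open>Commutative algebra\<close>

definition local_ring :: "('a, 'm) ring_scheme \<Rightarrow> bool" where
  "local_ring R \<longleftrightarrow> cring R \<and> (\<exists>!M. maximalideal M R)"

definition max_ideal :: "('a, 'm) ring_scheme \<Rightarrow> 'a set" where
  "max_ideal R = (THE M. maximalideal M R)"

subsection \<open>Localisation at a prime\<close>

definition loc_frac :: "('a, 'm) ring_scheme \<Rightarrow> 'a set \<Rightarrow> 'a \<Rightarrow> 'a \<Rightarrow> ('a \<times> 'a) set" where
  "loc_frac R P a s = {(b, t). b \<in> carrier R \<and> t \<in> carrier R - P \<and>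
     (\<exists>u \<in> carrier R - P. u \<otimes>\<^bsub>R\<^esub> (a \<otimes>\<^bsub>R\<^esub> t \<ominus>\<^bsub>R\<^esub> b \<otimes>\<^bsub>R\<^esub> s) = \<zero>\<^bsub>R\<^esub>)}"

definition loc_ring :: "('a, 'm) ring_scheme \<Rightarrow> 'a set \<Rightarrow> ('a \<times> 'a) set ring" where
  "loc_ring R P =
    \<lparr> carrier = {loc_frac R P a s | a s. a \<in> carrier R \<and> s \<in> carrier R - P},
      monoid.mult = (\<lambda>A B. \<Union>(a, s)\<in>A. \<Union>(b, t)\<in>B. loc_frac R P (a \<otimes>\<^bsub>R\<^esub> b) (s \<otimes>\<^bsub>R\<^esub> t)),
      one = loc_frac R P \<one>\<^bsub>R\<^esub> \<one>\<^bsub>R\<^esub>,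
      ring.zero = loc_frac R P \<zero>\<^bsub>R\<^esub> \<one>\<^bsub>R\<^esub>,
      ring.add = (\<lambda>A B. \<Union>(a, s)\<in>A. \<Union>(b, t)\<in>B.
               loc_frac R P (a \<otimes>\<^bsub>R\<^esub> t \<oplus>\<^bsub>R\<^esub> b \<otimes>\<^bsub>R\<^esub> s) (s \<otimes>\<^bsub>R\<^esub> t)) \<rparr>"

subsection \<open>Flatness\<close>

text \<open>The tensor product of the \<open>R\<close>-modules \<open>N\<close> and \<open>M\<close> is the free abelian group on
  \<open>carrier N \<times> carrier M\<close> modulo the subgroup \<open>tensor_rel R N M\<close>.\<close>

definition tensor_rel ::
    "('a, 'm) ring_scheme \<Rightarrow> ('a, 'n, 'k) module_scheme \<Rightarrow> ('a, 'b, 'l) module_scheme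
      \<Rightarrow> ('n \<times> 'b \<Rightarrow>\<^sub>0 int) set" where
  "tensor_rel R N M = generate (free_Abelian_group (carrier N \<times> carrier M))
     ({frag_of (n \<oplus>\<^bsub>N\<^esub> n', x) - frag_of (n, x) - frag_of (n', x) | n n' x.
         n \<in> carrier N \<and> n' \<in> carrier N \<and> x \<in> carrier M} \<union>
      {frag_of (n, x \<oplus>\<^bsub>M\<^esub> x') - frag_of (n, x) - frag_of (n, x') | n x x'.
         n \<in> carrier N \<and> x \<in> carrier M \<and> x' \<in> carrier M} \<union>
      {frag_of (r \<odot>\<^bsub>N\<^esub> n, x) - frag_of (n, r \<odot>\<^bsub>M\<^esub> x) | r n x.
         r \<in> carrier R \<and> n \<in> carrier N \<and> x \<in> carrier M})"

text \<open>\<open>M\<close> is flat if tensoring with \<open>M\<close> preserves injectivity of linear maps.  The test modules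
  have their carriers in the type of \<open>R\<close>; these include all ideals of \<open>R\<close> and \<open>R\<close> itself, so by
  the ideal criterion the restriction to this type loses nothing.\<close>

definition flat_module :: "('a, 'm) ring_scheme \<Rightarrow> ('a, 'b, 'l) module_scheme \<Rightarrow> bool" where
  "flat_module R M \<longleftrightarrow> module R M \<and>
     (\<forall>(N :: ('a, 'a) module) (N' :: ('a, 'a) module) u.
        module R N \<and> module R N' \<and> u \<in> carrier N \<rightarrow> carrier N' \<and> inj_on u (carrier N) \<and>
        (\<forall>n\<in>carrier N. \<forall>n'\<in>carrier N. u (n \<oplus>\<^bsub>N\<^esub> n') = u n \<oplus>\<^bsub>N'\<^esub> u n') \<and>
        (\<forall>r\<in>carrier R. \<forall>n\<in>carrier N. u (r \<odot>\<^bsub>N\<^esub> n) = r \<odot>\<^bsub>N'\<^esub> u n) \<longrightarrow>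
        (\<forall>\<xi> \<in> carrier (free_Abelian_group (carrier N \<times> carrier M)).
           frag_extend (\<lambda>(n, x). frag_of (u n, x)) \<xi> \<in> tensor_rel R N' M \<longrightarrow>
           \<xi> \<in> tensor_rel R N M))"

definition restrict_scalars ::
    "('a \<Rightarrow> 'b) \<Rightarrow> ('b, 'm) ring_scheme \<Rightarrow> ('a, 'b) module" where
  "restrict_scalars \<phi> B =
    \<lparr> carrier = carrier B, monoid.mult = monoid.mult B, one = one B,
      ring.zero = ring.zero B, ring.add = ring.add B,
      smult = (\<lambda>r x. \<phi> r \<otimes>\<^bsub>B\<^esub> x) \<rparr>"

definition flat_hom ::
    "('a, 'm) ring_scheme \<Rightarrow> ('b, 'n) ring_scheme \<Rightarrow> ('a \<Rightarrow> 'b) \<Rightarrow> bool" where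
  "flat_hom R B \<phi> \<longleftrightarrow> \<phi> \<in> ring_hom R B \<and> flat_module R (restrict_scalars \<phi> B)"

subsection \<open>Finite presentation\<close>

text \<open>\<open>R[x\<^sub>0, \<dots>, x\<^sub>n\<^sub>-\<^sub>1]\<close>, a monomial being a multiset of variables.\<close>

definition mpoly_ring :: "('a, 'm) ring_scheme \<Rightarrow> nat \<Rightarrow> (nat multiset \<Rightarrow> 'a) ring" where
  "mpoly_ring R n =
    \<lparr> carrier = ring.indexed_pset R {..<n} (carrier R),
      monoid.mult = (\<lambda>P Q m. \<Oplus>\<^bsub>R\<^esub>k \<in> {k. k \<subseteq># m}. P k \<otimes>\<^bsub>R\<^esub> Q (m - k)),
      one = ring.indexed_const R \<one>\<^bsub>R\<^esub>,
      ring.zero = ring.indexed_const R \<zero>\<^bsub>R\<^esub>,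
      ring.add = ring.indexed_padd R \<rparr>"

definition fin_pres_hom ::
    "('a, 'm) ring_scheme \<Rightarrow> ('b, 'n) ring_scheme \<Rightarrow> ('a \<Rightarrow> 'b) \<Rightarrow> bool" where
  "fin_pres_hom R B \<phi> \<longleftrightarrow> \<phi> \<in> ring_hom R B \<and>
     (\<exists>n \<pi> F. \<pi> \<in> ring_hom (mpoly_ring R n) B \<and>
        \<pi> ` carrier (mpoly_ring R n) = carrier B \<and>
        (\<forall>r\<in>carrier R. \<pi> (ring.indexed_const R r) = \<phi> r) \<and>
        finite F \<and> F \<subseteq> carrier (mpoly_ring R n) \<and>
        a_kernel (mpoly_ring R n) B \<pi> = genideal (mpoly_ring R n) F)"

subsection \<open>Finite separable extensions\<close>

text \<open>An element is separable over \<open>K\<close> if it is a simple root of its minimal polynomial.\<close>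

definition finite_separable :: "'a set \<Rightarrow> ('a, 'm) ring_scheme \<Rightarrow> bool" where
  "finite_separable K L \<longleftrightarrow> field L \<and> subfield K L \<and>
     ring.finite_dimension L K (carrier L) \<and>
     (\<forall>z\<in>carrier L. ring.alg_mult L (ring.Irr L K z) z = 1)"


section \<open>Schemes\<close>

subsection \<open>Ringed spaces\<close>

text \<open>\<open>rs_res X U V\<close> is the restriction map from sections over \<open>U\<close> to sections over \<open>V\<close>.\<close>

record ('p, 'r) ringed_space =
  rs_top :: "'p topology"
  rs_sec :: "'p set \<Rightarrow> 'r ring"
  rs_res :: "'p set \<Rightarrow> 'p set \<Rightarrow> 'r \<Rightarrow> 'r"

definition is_ringed_space :: "('p, 'r) ringed_space \<Rightarrow> bool" where
  "is_ringed_space X \<longleftrightarrow>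
     (\<forall>U. openin (rs_top X) U \<longrightarrow> cring (rs_sec X U)) \<and>
     (\<forall>U V. openin (rs_top X) U \<and> openin (rs_top X) V \<and> V \<subseteq> U \<longrightarrow>
        rs_res X U V \<in> ring_hom (rs_sec X U) (rs_sec X V)) \<and>
     (\<forall>U. openin (rs_top X) U \<longrightarrow> (\<forall>s\<in>carrier (rs_sec X U). rs_res X U U s = s)) \<and>
     (\<forall>U V W. openin (rs_top X) U \<and> openin (rs_top X) V \<and> openin (rs_top X) W \<and>
        V \<subseteq> U \<and> W \<subseteq> V \<longrightarrow>
        (\<forall>s\<in>carrier (rs_sec X U). rs_res X V W (rs_res X U V s) = rs_res X U W s)) \<and>
     (\<forall>\<U> s. (\<forall>U\<in>\<U>. openin (rs_top X) U \<and> s U \<in> carrier (rs_sec X U)) \<and>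
        (\<forall>U\<in>\<U>. \<forall>V\<in>\<U>. rs_res X U (U \<inter> V) (s U) = rs_res X V (U \<inter> V) (s V)) \<longrightarrow>
        (\<exists>!t. t \<in> carrier (rs_sec X (\<Union>\<U>)) \<and> (\<forall>U\<in>\<U>. rs_res X (\<Union>\<U>) U t = s U)))"

definition rs_restrict :: "('p, 'r) ringed_space \<Rightarrow> 'p set \<Rightarrow> ('p, 'r) ringed_space" where
  "rs_restrict X U = X \<lparr> rs_top := subtopology (rs_top X) U \<rparr>"

definition germ :: "('p, 'r) ringed_space \<Rightarrow> 'p \<Rightarrow> 'p set \<Rightarrow> 'r \<Rightarrow> ('p set \<times> 'r) set" where
  "germ X x U s = {(V, t). openin (rs_top X) V \<and> x \<in> V \<and> t \<in> carrier (rs_sec X V) \<and>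
     (\<exists>W. openin (rs_top X) W \<and> x \<in> W \<and> W \<subseteq> U \<inter> V \<and> rs_res X U W s = rs_res X V W t)}"

definition stalk :: "('p, 'r) ringed_space \<Rightarrow> 'p \<Rightarrow> ('p set \<times> 'r) set ring" where
  "stalk X x =
    \<lparr> carrier = {germ X x U s | U s.
        openin (rs_top X) U \<and> x \<in> U \<and> s \<in> carrier (rs_sec X U)},
      monoid.mult = (\<lambda>a b. \<Union>(U, s)\<in>a. \<Union>(V, t)\<in>b. germ X x (U \<inter> V)
        (rs_res X U (U \<inter> V) s \<otimes>\<^bsub>rs_sec X (U \<inter> V)\<^esub> rs_res X V (U \<inter> V) t)),
      one = germ X x (topspace (rs_top X)) \<one>\<^bsub>rs_sec X (topspace (rs_top X))\<^esub>,
      ring.zero = germ X x (topspace (rs_top X)) \<zero>\<^bsub>rs_sec X (topspace (rs_top X))\<^esub>,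
      ring.add = (\<lambda>a b. \<Union>(U, s)\<in>a. \<Union>(V, t)\<in>b. germ X x (U \<inter> V)
        (rs_res X U (U \<inter> V) s \<oplus>\<^bsub>rs_sec X (U \<inter> V)\<^esub> rs_res X V (U \<inter> V) t)) \<rparr>"

definition is_locally_ringed_space :: "('p, 'r) ringed_space \<Rightarrow> bool" where
  "is_locally_ringed_space X \<longleftrightarrow>
     is_ringed_space X \<and> (\<forall>x\<in>topspace (rs_top X). local_ring (stalk X x))"

subsection \<open>Morphisms\<close>

text \<open>\<open>rs_cmp f V\<close> is the comorphism from sections of the target over \<open>V\<close> to sections of the
  source over the preimage of \<open>V\<close>.  Both components are required to be extensional, so that HOL
  equality of these records is equality of morphisms.\<close>

record ('p, 'r, 'q, 's) rs_mor =
  rs_pt :: "'p \<Rightarrow> 'q"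
  rs_cmp :: "'q set \<Rightarrow> 's \<Rightarrow> 'r"

definition rs_pre ::
    "('p, 'r) ringed_space \<Rightarrow> ('p, 'r, 'q, 's) rs_mor \<Rightarrow> 'q set \<Rightarrow> 'p set" where
  "rs_pre X f V = {x \<in> topspace (rs_top X). rs_pt f x \<in> V}"

definition is_rs_mor ::
    "('p, 'r) ringed_space \<Rightarrow> ('q, 's) ringed_space \<Rightarrow> ('p, 'r, 'q, 's) rs_mor \<Rightarrow> bool" where
  "is_rs_mor X Y f \<longleftrightarrow>
     rs_pt f \<in> extensional (topspace (rs_top X)) \<and>
     continuous_map (rs_top X) (rs_top Y) (rs_pt f) \<and>
     (\<forall>V. \<not> openin (rs_top Y) V \<longrightarrow> rs_cmp f V = (\<lambda>_. undefined)) \<and>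
     (\<forall>V. openin (rs_top Y) V \<longrightarrow>
        rs_cmp f V \<in> extensional (carrier (rs_sec Y V)) \<and>
        rs_cmp f V \<in> ring_hom (rs_sec Y V) (rs_sec X (rs_pre X f V))) \<and>
     (\<forall>V W. openin (rs_top Y) V \<and> openin (rs_top Y) W \<and> W \<subseteq> V \<longrightarrow>
        (\<forall>s\<in>carrier (rs_sec Y V).
           rs_res X (rs_pre X f V) (rs_pre X f W) (rs_cmp f V s) = rs_cmp f W (rs_res Y V W s)))"

definition stalk_map ::
    "('p, 'r) ringed_space \<Rightarrow> ('p, 'r, 'q, 's) rs_mor \<Rightarrow> 'p
      \<Rightarrow> ('q set \<times> 's) set \<Rightarrow> ('p set \<times> 'r) set" where
  "stalk_map X f x a = (\<Union>(V, t)\<in>a. germ X x (rs_pre X f V) (rs_cmp f V t))"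

definition is_lrs_mor ::
    "('p, 'r) ringed_space \<Rightarrow> ('q, 's) ringed_space \<Rightarrow> ('p, 'r, 'q, 's) rs_mor \<Rightarrow> bool" where
  "is_lrs_mor X Y f \<longleftrightarrow> is_rs_mor X Y f \<and>
     (\<forall>x\<in>topspace (rs_top X).
        stalk_map X f x ` max_ideal (stalk Y (rs_pt f x)) \<subseteq> max_ideal (stalk X x))"

definition rs_id :: "('p, 'r) ringed_space \<Rightarrow> ('p, 'r, 'p, 'r) rs_mor" where
  "rs_id X =
    \<lparr> rs_pt = restrict (\<lambda>x. x) (topspace (rs_top X)),
      rs_cmp = (\<lambda>V. if openin (rs_top X) V then restrict (\<lambda>s. s) (carrier (rs_sec X V))
                    else (\<lambda>_. undefined)) \<rparr>"

text \<open>\<open>rs_comp X Y Z g f\<close> is \<open>g \<circ> f\<close> for \<open>f\<close> from \<open>X\<close> to \<open>Y\<close> and \<open>g\<close> from \<open>Y\<close> to \<open>Z\<close>.\<close>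

definition rs_comp ::
    "('p, 'r) ringed_space \<Rightarrow> ('q, 's) ringed_space \<Rightarrow> ('u, 't) ringed_space
      \<Rightarrow> ('q, 's, 'u, 't) rs_mor \<Rightarrow> ('p, 'r, 'q, 's) rs_mor \<Rightarrow> ('p, 'r, 'u, 't) rs_mor" where
  "rs_comp X Y Z g f =
    \<lparr> rs_pt = restrict (\<lambda>x. rs_pt g (rs_pt f x)) (topspace (rs_top X)),
      rs_cmp = (\<lambda>W. if openin (rs_top Z) W
                    then restrict (\<lambda>s. rs_cmp f (rs_pre Y g W) (rs_cmp g W s))
                           (carrier (rs_sec Z W))
                    else (\<lambda>_. undefined)) \<rparr>"

definition lrs_isomorphic ::
    "('p, 'r) ringed_space \<Rightarrow> ('q, 's) ringed_space \<Rightarrow> bool" where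
  "lrs_isomorphic X Y \<longleftrightarrow> (\<exists>f g. is_lrs_mor X Y f \<and> is_lrs_mor Y X g \<and>
     rs_comp X Y X g f = rs_id X \<and> rs_comp Y X Y f g = rs_id Y)"

subsection \<open>Spectra and schemes\<close>

definition zariski :: "('a, 'm) ring_scheme \<Rightarrow> 'a set topology" where
  "zariski R = topology (\<lambda>U. \<exists>A \<subseteq> carrier R. U = {P. primeideal P R \<and> \<not> A \<subseteq> P})"

definition Spec ::
    "('a, 'm) ring_scheme \<Rightarrow> ('a set, 'a set \<Rightarrow> ('a \<times> 'a) set) ringed_space" where
  "Spec R =
    \<lparr> rs_top = zariski R,
      rs_sec = (\<lambda>U.
        \<lparr> carrier = {\<sigma> \<in> (\<Pi>\<^sub>E P\<in>U. carrier (loc_ring R P)).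
            \<forall>P\<in>U. \<exists>V. openin (zariski R) V \<and> P \<in> V \<and> V \<subseteq> U \<and>
              (\<exists>a\<in>carrier R. \<exists>s\<in>carrier R. \<forall>Q\<in>V. s \<notin> Q \<and> \<sigma> Q = loc_frac R Q a s)},
          monoid.mult = (\<lambda>\<sigma> \<rho>. \<lambda>P\<in>U. \<sigma> P \<otimes>\<^bsub>loc_ring R P\<^esub> \<rho> P),
          one = (\<lambda>P\<in>U. \<one>\<^bsub>loc_ring R P\<^esub>),
          ring.zero = (\<lambda>P\<in>U. \<zero>\<^bsub>loc_ring R P\<^esub>),
          ring.add = (\<lambda>\<sigma> \<rho>. \<lambda>P\<in>U. \<sigma> P \<oplus>\<^bsub>loc_ring R P\<^esub> \<rho> P) \<rparr>),
      rs_res = (\<lambda>U V \<sigma>. restrict \<sigma> V) \<rparr>"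

text \<open>The ring \<open>R\<close> is isomorphic to the ring of global sections, so nothing is lost by taking it
  in the type of sections of \<open>X\<close>.\<close>

definition is_affine :: "('p, 'r) ringed_space \<Rightarrow> bool" where
  "is_affine X \<longleftrightarrow> is_locally_ringed_space X \<and>
     (\<exists>R :: 'r ring. cring R \<and> lrs_isomorphic X (Spec R))"

definition affine_open :: "('p, 'r) ringed_space \<Rightarrow> 'p set \<Rightarrow> bool" where
  "affine_open X U \<longleftrightarrow> openin (rs_top X) U \<and> is_affine (rs_restrict X U)"

definition is_scheme :: "('p, 'r) ringed_space \<Rightarrow> bool" where
  "is_scheme X \<longleftrightarrow> is_locally_ringed_space X \<and>
     (\<forall>x\<in>topspace (rs_top X). \<exists>U. affine_open X U \<and> x \<in> U)"

subsection \<open>Flat, locally finitely presented and etale morphisms\<close>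

definition flat_mor ::
    "('p, 'r) ringed_space \<Rightarrow> ('q, 's) ringed_space \<Rightarrow> ('p, 'r, 'q, 's) rs_mor \<Rightarrow> bool" where
  "flat_mor X Y f \<longleftrightarrow>
     (\<forall>x\<in>topspace (rs_top X). flat_hom (stalk Y (rs_pt f x)) (stalk X x) (stalk_map X f x))"

definition loc_fin_pres_mor ::
    "('p, 'r) ringed_space \<Rightarrow> ('q, 's) ringed_space \<Rightarrow> ('p, 'r, 'q, 's) rs_mor \<Rightarrow> bool" where
  "loc_fin_pres_mor X Y f \<longleftrightarrow>
     (\<forall>x\<in>topspace (rs_top X). \<exists>U V. affine_open X U \<and> affine_open Y V \<and> x \<in> U \<and>
        rs_pt f ` U \<subseteq> V \<and>
        fin_pres_hom (rs_sec Y V) (rs_sec X U) (\<lambda>s. rs_res X (rs_pre X f V) U (rs_cmp f V s)))"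

definition residue_field :: "('p, 'r) ringed_space \<Rightarrow> 'p \<Rightarrow> ('p set \<times> 'r) set set ring" where
  "residue_field X x = stalk X x Quot max_ideal (stalk X x)"

definition residue_map ::
    "('p, 'r) ringed_space \<Rightarrow> ('p, 'r, 'q, 's) rs_mor \<Rightarrow> 'p
      \<Rightarrow> ('q set \<times> 's) set set \<Rightarrow> ('p set \<times> 'r) set set" where
  "residue_map X f x C = (\<Union>c\<in>C. max_ideal (stalk X x) +>\<^bsub>stalk X x\<^esub> stalk_map X f x c)"

definition unramified_mor ::
    "('p, 'r) ringed_space \<Rightarrow> ('q, 's) ringed_space \<Rightarrow> ('p, 'r, 'q, 's) rs_mor \<Rightarrow> bool" where
  "unramified_mor X Y f \<longleftrightarrow>
     (\<forall>x\<in>topspace (rs_top X).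
        genideal (stalk X x) (stalk_map X f x ` max_ideal (stalk Y (rs_pt f x)))
          = max_ideal (stalk X x) \<and>
        finite_separable (residue_map X f x ` carrier (residue_field Y (rs_pt f x)))
          (residue_field X x))"

text \<open>Etale means flat, locally of finite presentation and unramified.  The \<open>Fppf\<close> condition is
  on single members of a covering family; joint surjectivity is imposed on the family.\<close>

datatype tau = Etale | Fppf

fun tau_mor ::
    "tau \<Rightarrow> ('p, 'r) ringed_space \<Rightarrow> ('q, 's) ringed_space \<Rightarrow> ('p, 'r, 'q, 's) rs_mor \<Rightarrow> bool" where
  "tau_mor Etale X Y f \<longleftrightarrow> flat_mor X Y f \<and> loc_fin_pres_mor X Y f \<and> unramified_mor X Y f"
| "tau_mor Fppf X Y f \<longleftrightarrow> flat_mor X Y f \<and> loc_fin_pres_mor X Y f"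


section \<open>Categories and sites\<close>

record ('o, 'a) cat =
  Ob :: "'o set"
  Arr :: "'a set"
  Dom :: "'a \<Rightarrow> 'o"
  Cod :: "'a \<Rightarrow> 'o"
  Idn :: "'o \<Rightarrow> 'a"
  Cmp :: "'a \<Rightarrow> 'a \<Rightarrow> 'a"

definition is_cat :: "('o, 'a, 'm) cat_scheme \<Rightarrow> bool" where
  "is_cat C \<longleftrightarrow>
     (\<forall>f\<in>Arr C. Dom C f \<in> Ob C \<and> Cod C f \<in> Ob C) \<and>
     (\<forall>x\<in>Ob C. Idn C x \<in> Arr C \<and> Dom C (Idn C x) = x \<and> Cod C (Idn C x) = x) \<and>
     (\<forall>f\<in>Arr C. \<forall>g\<in>Arr C. Cod C f = Dom C g \<longrightarrow>
        Cmp C g f \<in> Arr C \<and> Dom C (Cmp C g f) = Dom C f \<and> Cod C (Cmp C g f) = Cod C g) \<and>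
     (\<forall>f\<in>Arr C. Cmp C f (Idn C (Dom C f)) = f \<and> Cmp C (Idn C (Cod C f)) f = f) \<and>
     (\<forall>f\<in>Arr C. \<forall>g\<in>Arr C. \<forall>h\<in>Arr C. Cod C f = Dom C g \<and> Cod C g = Dom C h \<longrightarrow>
        Cmp C h (Cmp C g f) = Cmp C (Cmp C h g) f)"

definition into :: "('o, 'a, 'm) cat_scheme \<Rightarrow> 'o \<Rightarrow> 'a set" where
  "into C t = {f \<in> Arr C. Cod C f = t}"

definition is_sieve :: "('o, 'a, 'm) cat_scheme \<Rightarrow> 'o \<Rightarrow> 'a set \<Rightarrow> bool" where
  "is_sieve C t R \<longleftrightarrow> R \<subseteq> into C t \<and> (\<forall>f\<in>R. \<forall>g\<in>into C (Dom C f). Cmp C f g \<in> R)"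

definition sieve_gen :: "('o, 'a, 'm) cat_scheme \<Rightarrow> 'a set \<Rightarrow> 'a set" where
  "sieve_gen C F = {Cmp C f g | f g. f \<in> F \<and> g \<in> into C (Dom C f)}"

definition sieve_pull :: "('o, 'a, 'm) cat_scheme \<Rightarrow> 'a \<Rightarrow> 'a set \<Rightarrow> 'a set" where
  "sieve_pull C f R = {g \<in> into C (Dom C f). Cmp C f g \<in> R}"

text \<open>The covering sieves of the Grothendieck topology generated by the covering families
  \<open>Cov U\<close>, which are sets of arrows with codomain \<open>U\<close>.\<close>

inductive gen_covering ::
    "('o, 'a, 'm) cat_scheme \<Rightarrow> ('o \<Rightarrow> 'a set set) \<Rightarrow> 'o \<Rightarrow> 'a set \<Rightarrow> bool"
  for C :: "('o, 'a, 'm) cat_scheme" and Cov :: "'o \<Rightarrow> 'a set set" where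
  base: "U \<in> Ob C \<Longrightarrow> F \<in> Cov U \<Longrightarrow> gen_covering C Cov U (sieve_gen C F)"
| maximal: "U \<in> Ob C \<Longrightarrow> gen_covering C Cov U (into C U)"
| stable: "gen_covering C Cov U R \<Longrightarrow> f \<in> into C U \<Longrightarrow>
    gen_covering C Cov (Dom C f) (sieve_pull C f R)"
| transitive: "gen_covering C Cov U R \<Longrightarrow> is_sieve C U R' \<Longrightarrow>
    (\<And>f. f \<in> R \<Longrightarrow> gen_covering C Cov (Dom C f) (sieve_pull C f R')) \<Longrightarrow>
    gen_covering C Cov U R'"

subsection \<open>The big site of a scheme\<close>

type_synonym ('p, 'r) over_ob = "('p, 'r) ringed_space \<times> ('p, 'r, 'p, 'r) rs_mor"
type_synonym ('p, 'r) over_arr =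
  "('p, 'r) over_ob \<times> ('p, 'r, 'p, 'r) rs_mor \<times> ('p, 'r) over_ob"

text \<open>HOL has no type of all schemes.  \<open>Sch \<UU> S\<close> is the category of those \<open>S\<close>-schemes that
  belong to the set \<open>\<UU>\<close>, which plays the role of the universe implicit in \<open>Sch/S\<close>; points and
  sections live in the type parameters.  Taking for \<open>\<UU>\<close> the schemes of a Grothendieck universe
  gives \<open>Sch/S\<close> in the usual sense.  An arrow is recorded with its source and target.\<close>

definition Sch ::
    "('p, 'r) ringed_space set \<Rightarrow> ('p, 'r) ringed_space
      \<Rightarrow> (('p, 'r) over_ob, ('p, 'r) over_arr) cat" where
  "Sch \<UU> S =
    (let obs = {(X, p). X \<in> \<UU> \<and> is_scheme X \<and> is_lrs_mor X S p} in
    \<lparr> Ob = obs,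
      Arr = {((X, p), m, (Y, q)) | X p m Y q. (X, p) \<in> obs \<and> (Y, q) \<in> obs \<and>
               is_lrs_mor X Y m \<and> rs_comp X Y S q m = p},
      Dom = (\<lambda>(a, m, b). a),
      Cod = (\<lambda>(a, m, b). b),
      Idn = (\<lambda>a. (a, rs_id (fst a), a)),
      Cmp = (\<lambda>(b', n, c) (a, m, b). (a, rs_comp (fst a) (fst b) (fst c) n m, c)) \<rparr>)"

definition tau_families ::
    "tau \<Rightarrow> ('p, 'r) ringed_space set \<Rightarrow> ('p, 'r) ringed_space
      \<Rightarrow> ('p, 'r) over_ob \<Rightarrow> ('p, 'r) over_arr set set" where
  "tau_families \<tau> \<UU> S u = {F. F \<subseteq> into (Sch \<UU> S) u \<and>
     (\<forall>(a, m, b)\<in>F. tau_mor \<tau> (fst a) (fst b) m) \<and>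
     (\<Union>(a, m, b)\<in>F. rs_pt m ` topspace (rs_top (fst a))) = topspace (rs_top (fst u))}"

text \<open>When \<open>\<UU>\<close> is closed under fibre products the families above form a pretopology and these are
  the sieves containing one of them.\<close>

definition Sch_top ::
    "tau \<Rightarrow> ('p, 'r) ringed_space set \<Rightarrow> ('p, 'r) ringed_space
      \<Rightarrow> ('p, 'r) over_ob \<Rightarrow> ('p, 'r) over_arr set set" where
  "Sch_top \<tau> \<UU> S u = {R. gen_covering (Sch \<UU> S) (tau_families \<tau> \<UU> S) u R}"

definition Sch_final :: "('p, 'r) ringed_space \<Rightarrow> ('p, 'r) over_ob" where
  "Sch_final S = (S, rs_id S)"


section \<open>Fibred categories\<close>

record ('o, 'a, 'bo, 'ba) fib = "('o, 'a) cat" +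
  prO :: "'o \<Rightarrow> 'bo"
  prA :: "'a \<Rightarrow> 'ba"

record ('o, 'a, 'o2, 'a2) fctr =
  onO :: "'o \<Rightarrow> 'o2"
  onA :: "'a \<Rightarrow> 'a2"

definition is_fctr ::
    "('o, 'a, 'm) cat_scheme \<Rightarrow> ('o2, 'a2, 'n) cat_scheme \<Rightarrow> ('o, 'a, 'o2, 'a2) fctr \<Rightarrow> bool" where
  "is_fctr C D F \<longleftrightarrow>
     (\<forall>x\<in>Ob C. onO F x \<in> Ob D \<and> onA F (Idn C x) = Idn D (onO F x)) \<and>
     (\<forall>f\<in>Arr C. onA F f \<in> Arr D \<and>
        Dom D (onA F f) = onO F (Dom C f) \<and> Cod D (onA F f) = onO F (Cod C f)) \<and>
     (\<forall>f\<in>Arr C. \<forall>g\<in>Arr C. Cod C f = Dom C g \<longrightarrow>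
        onA F (Cmp C g f) = Cmp D (onA F g) (onA F f))"

definition str :: "('o, 'a, 'bo, 'ba) fib \<Rightarrow> ('o, 'a, 'bo, 'ba) fctr" where
  "str T = \<lparr> onO = prO T, onA = prA T \<rparr>"

definition base_fib :: "('o, 'a) cat \<Rightarrow> ('o, 'a, 'o, 'a) fib" where
  "base_fib C = \<lparr> Ob = Ob C, Arr = Arr C, Dom = Dom C, Cod = Cod C, Idn = Idn C, Cmp = Cmp C,
     prO = (\<lambda>x. x), prA = (\<lambda>f. f) \<rparr>"

definition fibred_in_groupoids :: "('bo, 'ba) cat \<Rightarrow> ('o, 'a, 'bo, 'ba) fib \<Rightarrow> bool" where
  "fibred_in_groupoids C T \<longleftrightarrow> is_cat T \<and> is_fctr T C (str T) \<and>
     (\<forall>t\<in>Ob T. \<forall>f\<in>into C (prO T t). \<exists>\<phi>\<in>into T t. prA T \<phi> = f) \<and>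
     (\<forall>t\<in>Ob T. \<forall>\<phi>\<in>into T t. \<forall>\<psi>\<in>into T t. \<forall>h\<in>Arr C.
        Dom C h = prO T (Dom T \<psi>) \<and> Cod C h = prO T (Dom T \<phi>) \<and>
        Cmp C (prA T \<phi>) h = prA T \<psi> \<longrightarrow>
        (\<exists>!\<chi>. \<chi> \<in> Arr T \<and> Dom T \<chi> = Dom T \<psi> \<and> Cod T \<chi> = Dom T \<phi> \<and>
               Cmp T \<phi> \<chi> = \<psi> \<and> prA T \<chi> = h))"

definition vertical :: "('bo, 'ba) cat \<Rightarrow> ('o, 'a, 'bo, 'ba) fib \<Rightarrow> 'a \<Rightarrow> bool" where
  "vertical C T \<phi> \<longleftrightarrow> \<phi> \<in> Arr T \<and> prA T \<phi> = Idn C (prO T (Dom T \<phi>))"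

definition fibred_in_sets :: "('bo, 'ba) cat \<Rightarrow> ('o, 'a, 'bo, 'ba) fib \<Rightarrow> bool" where
  "fibred_in_sets C T \<longleftrightarrow> fibred_in_groupoids C T \<and>
     (\<forall>\<phi>. vertical C T \<phi> \<longrightarrow> \<phi> = Idn T (Dom T \<phi>))"

definition fibred_in_setoids :: "('bo, 'ba) cat \<Rightarrow> ('o, 'a, 'bo, 'ba) fib \<Rightarrow> bool" where
  "fibred_in_setoids C T \<longleftrightarrow> fibred_in_groupoids C T \<and>
     (\<forall>\<phi>. vertical C T \<phi> \<and> Dom T \<phi> = Cod T \<phi> \<longrightarrow> \<phi> = Idn T (Dom T \<phi>))"

text \<open>Covering sieves of the inherited topology.  In a category fibred in groupoids the image of
  a sieve is a sieve.\<close>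

definition inherit ::
    "('bo \<Rightarrow> 'ba set set) \<Rightarrow> ('o, 'a, 'bo, 'ba) fib \<Rightarrow> 'o \<Rightarrow> 'a set set" where
  "inherit J T t = {R. is_sieve T t R \<and> prA T ` R \<in> J (prO T t)}"

subsection \<open>Groupoids of 1-morphisms\<close>

text \<open>The objects of the groupoid of 1-morphisms from \<open>T\<close> to \<open>X\<close>.  Functors are extensional, so
  that HOL equality is equality of functors.\<close>

definition homs ::
    "('o, 'a, 'bo, 'ba) fib \<Rightarrow> ('o2, 'a2, 'bo, 'ba) fib \<Rightarrow> ('o, 'a, 'o2, 'a2) fctr set" where
  "homs T X = {F. is_fctr T X F \<and> onO F \<in> extensional (Ob T) \<and> onA F \<in> extensional (Arr T) \<and>
     (\<forall>t\<in>Ob T. prO X (onO F t) = prO T t) \<and> (\<forall>\<phi>\<in>Arr T. prA X (onA F \<phi>) = prA T \<phi>)}"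

definition is_2mor ::
    "('bo, 'ba) cat \<Rightarrow> ('o, 'a, 'bo, 'ba) fib \<Rightarrow> ('o2, 'a2, 'bo, 'ba) fib
      \<Rightarrow> ('o, 'a, 'o2, 'a2) fctr \<Rightarrow> ('o, 'a, 'o2, 'a2) fctr \<Rightarrow> ('o \<Rightarrow> 'a2) \<Rightarrow> bool" where
  "is_2mor C T X F F' \<eta> \<longleftrightarrow>
     (\<forall>t\<in>Ob T. vertical C X (\<eta> t) \<and> Dom X (\<eta> t) = onO F t \<and> Cod X (\<eta> t) = onO F' t) \<and>
     (\<forall>\<phi>\<in>Arr T. Cmp X (\<eta> (Cod T \<phi>)) (onA F \<phi>) = Cmp X (onA F' \<phi>) (\<eta> (Dom T \<phi>)))"

definition homs_isomorphic ::
    "('bo, 'ba) cat \<Rightarrow> ('o, 'a, 'bo, 'ba) fib \<Rightarrow> ('o2, 'a2, 'bo, 'ba) fib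
      \<Rightarrow> ('o, 'a, 'o2, 'a2) fctr \<Rightarrow> ('o, 'a, 'o2, 'a2) fctr \<Rightarrow> bool" where
  "homs_isomorphic C T X F F' \<longleftrightarrow>
     (\<exists>\<eta> \<theta>. is_2mor C T X F F' \<eta> \<and> is_2mor C T X F' F \<theta> \<and>
        (\<forall>t\<in>Ob T. Cmp X (\<theta> t) (\<eta> t) = Idn X (onO F t) \<and>
                  Cmp X (\<eta> t) (\<theta> t) = Idn X (onO F' t)))"

definition comp_fctr ::
    "('o, 'a, 'm) cat_scheme \<Rightarrow> ('o2, 'a2, 'o3, 'a3) fctr \<Rightarrow> ('o, 'a, 'o2, 'a2) fctr
      \<Rightarrow> ('o, 'a, 'o3, 'a3) fctr" where
  "comp_fctr T f y = \<lparr> onO = restrict (\<lambda>t. onO f (onO y t)) (Ob T),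
                       onA = restrict (\<lambda>\<phi>. onA f (onA y \<phi>)) (Arr T) \<rparr>"

definition ess_image ::
    "('bo, 'ba) cat \<Rightarrow> ('o, 'a, 'bo, 'ba) fib \<Rightarrow> ('o2, 'a2, 'bo, 'ba) fib
      \<Rightarrow> ('o3, 'a3, 'bo, 'ba) fib \<Rightarrow> ('o2, 'a2, 'o3, 'a3) fctr
      \<Rightarrow> ('o, 'a, 'o3, 'a3) fctr set" where
  "ess_image C A Y X f =
     {x \<in> homs A X. \<exists>y \<in> homs A Y. homs_isomorphic C A X (comp_fctr A f y) x}"


section \<open>Sheaves and torsors\<close>

record ('o, 'a, 'v) psh =
  sec :: "'o \<Rightarrow> 'v set"
  res :: "'a \<Rightarrow> 'v \<Rightarrow> 'v"

text \<open>In the following definitions \<open>J t\<close> is the set of covering sieves of the object \<open>t\<close>.\<close>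

definition is_presheaf :: "('o, 'a, 'm) cat_scheme \<Rightarrow> ('o, 'a, 'v, 'n) psh_scheme \<Rightarrow> bool" where
  "is_presheaf T P \<longleftrightarrow>
     (\<forall>\<phi>\<in>Arr T. res P \<phi> \<in> sec P (Cod T \<phi>) \<rightarrow> sec P (Dom T \<phi>)) \<and>
     (\<forall>t\<in>Ob T. \<forall>s\<in>sec P t. res P (Idn T t) s = s) \<and>
     (\<forall>\<phi>\<in>Arr T. \<forall>\<psi>\<in>into T (Dom T \<phi>). \<forall>s\<in>sec P (Cod T \<phi>).
        res P (Cmp T \<phi> \<psi>) s = res P \<psi> (res P \<phi> s))"

definition is_sheaf ::
    "('o, 'a, 'm) cat_scheme \<Rightarrow> ('o \<Rightarrow> 'a set set) \<Rightarrow> ('o, 'a, 'v, 'n) psh_scheme \<Rightarrow> bool" where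
  "is_sheaf T J P \<longleftrightarrow> is_presheaf T P \<and>
     (\<forall>t\<in>Ob T. \<forall>R\<in>J t. \<forall>s.
        (\<forall>\<phi>\<in>R. s \<phi> \<in> sec P (Dom T \<phi>)) \<and>
        (\<forall>\<phi>\<in>R. \<forall>\<psi>\<in>into T (Dom T \<phi>). res P \<psi> (s \<phi>) = s (Cmp T \<phi> \<psi>)) \<longrightarrow>
        (\<exists>!v. v \<in> sec P t \<and> (\<forall>\<phi>\<in>R. res P \<phi> v = s \<phi>)))"

record ('o, 'a, 'g) gpsh =
  grp :: "'o \<Rightarrow> 'g monoid"
  gres :: "'a \<Rightarrow> 'g \<Rightarrow> 'g"

definition is_group_sheaf ::
    "('o, 'a, 'm) cat_scheme \<Rightarrow> ('o \<Rightarrow> 'a set set) \<Rightarrow> ('o, 'a, 'g) gpsh \<Rightarrow> bool" where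
  "is_group_sheaf T J G \<longleftrightarrow>
     (\<forall>t\<in>Ob T. group (grp G t)) \<and>
     (\<forall>\<phi>\<in>Arr T. gres G \<phi> \<in> hom (grp G (Cod T \<phi>)) (grp G (Dom T \<phi>))) \<and>
     is_sheaf T J \<lparr> sec = (\<lambda>t. carrier (grp G t)), res = gres G \<rparr>"

record ('o, 'a, 'v, 'g) rpsh = "('o, 'a, 'v) psh" +
  ract :: "'o \<Rightarrow> 'v \<Rightarrow> 'g \<Rightarrow> 'v"

definition is_torsor ::
    "('o, 'a, 'm) cat_scheme \<Rightarrow> ('o \<Rightarrow> 'a set set) \<Rightarrow> ('o, 'a, 'g) gpsh
      \<Rightarrow> ('o, 'a, 'v, 'g) rpsh \<Rightarrow> bool" where
  "is_torsor T J G P \<longleftrightarrow> is_sheaf T J P \<and>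
     (\<forall>t\<in>Ob T. \<forall>v\<in>sec P t. ract P t v \<one>\<^bsub>grp G t\<^esub> = v \<and>
        (\<forall>g\<in>carrier (grp G t). ract P t v g \<in> sec P t \<and>
           (\<forall>h\<in>carrier (grp G t). ract P t (ract P t v g) h = ract P t v (g \<otimes>\<^bsub>grp G t\<^esub> h)))) \<and>
     (\<forall>\<phi>\<in>Arr T. \<forall>v\<in>sec P (Cod T \<phi>). \<forall>g\<in>carrier (grp G (Cod T \<phi>)).
        res P \<phi> (ract P (Cod T \<phi>) v g) = ract P (Dom T \<phi>) (res P \<phi> v) (gres G \<phi> g)) \<and>
     (\<forall>t\<in>Ob T. \<forall>v\<in>sec P t. \<forall>w\<in>sec P t. \<exists>!g. g \<in> carrier (grp G t) \<and> ract P t v g = w) \<and>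
     (\<forall>t\<in>Ob T. \<exists>R\<in>J t. \<forall>\<phi>\<in>R. sec P (Dom T \<phi>) \<noteq> {})"

definition torsors_isomorphic ::
    "('o, 'a, 'm) cat_scheme \<Rightarrow> ('o, 'a, 'g) gpsh
      \<Rightarrow> ('o, 'a, 'v, 'g) rpsh \<Rightarrow> ('o, 'a, 'w, 'g) rpsh \<Rightarrow> bool" where
  "torsors_isomorphic T G P Q \<longleftrightarrow> (\<exists>h.
     (\<forall>t\<in>Ob T. bij_betw (h t) (sec P t) (sec Q t)) \<and>
     (\<forall>\<phi>\<in>Arr T. \<forall>v\<in>sec P (Cod T \<phi>). h (Dom T \<phi>) (res P \<phi> v) = res Q \<phi> (h (Cod T \<phi>) v)) \<and>
     (\<forall>t\<in>Ob T. \<forall>v\<in>sec P t. \<forall>g\<in>carrier (grp G t).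
        h t (ract P t v g) = ract Q t (h t v) g))"

definition torsor_class ::
    "('o, 'a, 'm) cat_scheme \<Rightarrow> ('o \<Rightarrow> 'a set set) \<Rightarrow> ('o, 'a, 'g) gpsh
      \<Rightarrow> ('o, 'a, 'v, 'g) rpsh \<Rightarrow> ('o, 'a, 'v, 'g) rpsh set" where
  "torsor_class T J G P = {Q. is_torsor T J G Q \<and> torsors_isomorphic T G P Q}"

subsection \<open>Pull-back\<close>

definition pull_gpsh ::
    "('o, 'a, 'o2, 'a2) fctr \<Rightarrow> ('o2, 'a2, 'g) gpsh \<Rightarrow> ('o, 'a, 'g) gpsh" where
  "pull_gpsh u G = \<lparr> grp = (\<lambda>t. grp G (onO u t)), gres = (\<lambda>\<phi>. gres G (onA u \<phi>)) \<rparr>"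

definition pull_torsor ::
    "('o, 'a, 'o2, 'a2) fctr \<Rightarrow> ('o2, 'a2, 'v, 'g) rpsh \<Rightarrow> ('o, 'a, 'v, 'g) rpsh" where
  "pull_torsor u P = \<lparr> sec = (\<lambda>t. sec P (onO u t)), res = (\<lambda>\<phi>. res P (onA u \<phi>)),
                       ract = (\<lambda>t. ract P (onO u t)) \<rparr>"

subsection \<open>First cohomology sets\<close>

text \<open>The base site is \<open>(C, J)\<close>, the group sheaf \<open>G\<close> lives on it and is pulled back to \<open>T\<close>.\<close>

definition torsor_over ::
    "('bo \<Rightarrow> 'ba set set) \<Rightarrow> ('bo, 'ba, 'g) gpsh \<Rightarrow> ('o, 'a, 'bo, 'ba) fib
      \<Rightarrow> ('o, 'a, 'v, 'g) rpsh \<Rightarrow> bool" where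
  "torsor_over J G T P \<longleftrightarrow> is_torsor T (inherit J T) (pull_gpsh (str T) G) P"

definition torsor_class_over ::
    "('bo \<Rightarrow> 'ba set set) \<Rightarrow> ('bo, 'ba, 'g) gpsh \<Rightarrow> ('o, 'a, 'bo, 'ba) fib
      \<Rightarrow> ('o, 'a, 'v, 'g) rpsh \<Rightarrow> ('o, 'a, 'v, 'g) rpsh set" where
  "torsor_class_over J G T P = torsor_class T (inherit J T) (pull_gpsh (str T) G) P"

definition H1 ::
    "('bo \<Rightarrow> 'ba set set) \<Rightarrow> ('bo, 'ba, 'g) gpsh \<Rightarrow> ('o, 'a, 'bo, 'ba) fib
      \<Rightarrow> ('o, 'a, 'v, 'g) rpsh set set" where
  "H1 J G T = {torsor_class_over J G T P | P. torsor_over J G T P}"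

text \<open>The members of an isomorphism class \<open>c\<close> all contribute the same class to the union.\<close>

definition H1_pull ::
    "('bo \<Rightarrow> 'ba set set) \<Rightarrow> ('bo, 'ba, 'g) gpsh \<Rightarrow> ('o, 'a, 'bo, 'ba) fib
      \<Rightarrow> ('o, 'a, 'o2, 'a2) fctr
      \<Rightarrow> ('o2, 'a2, 'v, 'g) rpsh set \<Rightarrow> ('o, 'a, 'v, 'g) rpsh set" where
  "H1_pull J G T u c = (\<Union>P\<in>c. torsor_class_over J G T (pull_torsor u P))"

text \<open>\<open>X(A)\<^sup>f\<close>, where \<open>f\<close> is associated to the torsor \<open>Y\<close>; as everywhere, a full subcategory is
  given by its set of objects.\<close>

definition homs_f ::
    "('bo, 'ba) cat \<Rightarrow> ('bo \<Rightarrow> 'ba set set) \<Rightarrow> ('bo, 'ba, 'g) gpsh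
      \<Rightarrow> ('o, 'a, 'bo, 'ba) fib \<Rightarrow> ('o2, 'a2, 'bo, 'ba) fib
      \<Rightarrow> ('o2, 'a2, 'v, 'g) rpsh \<Rightarrow> ('o, 'a, 'o2, 'a2) fctr set" where
  "homs_f C J G A X Y = {x \<in> homs A X.
     torsor_class_over J G A (pull_torsor x Y) \<in> H1_pull J G A (str A) ` H1 J G (base_fib C)}"

subsection \<open>Cech cohomology of the final object\<close>

text \<open>A covering family of the final object \<open>e\<close> is a set \<open>\<U>\<close> of objects whose arrows to \<open>e\<close>
  generate a covering sieve.\<close>

definition cech_cover ::
    "('o, 'a, 'm) cat_scheme \<Rightarrow> ('o \<Rightarrow> 'a set set) \<Rightarrow> 'o \<Rightarrow> 'o set \<Rightarrow> bool" where
  "cech_cover C J e \<U> \<longleftrightarrow> \<U> \<subseteq> Ob C \<and> sieve_gen C {f \<in> into C e. Dom C f \<in> \<U>} \<in> J e"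

text \<open>A section of \<open>G\<close> over the product \<open>U \<times> V\<close> is given, by Yoneda, by a natural family of
  sections \<open>g a b\<close> of \<open>G\<close> over \<open>T\<close> indexed by the pairs of arrows \<open>a\<close> from \<open>T\<close> to \<open>U\<close> and \<open>b\<close> from
  \<open>T\<close> to \<open>V\<close>.  Cochains are written in this form, so that the cocycle condition on triple products
  reads \<open>g a b \<cdot> g b c = g a c\<close>.\<close>

definition into_cover :: "('o, 'a, 'm) cat_scheme \<Rightarrow> 'o set \<Rightarrow> 'a set" where
  "into_cover C \<U> = {a \<in> Arr C. Cod C a \<in> \<U>}"

definition cech_cocycle ::
    "('o, 'a, 'm) cat_scheme \<Rightarrow> ('o \<Rightarrow> 'a set set) \<Rightarrow> 'o \<Rightarrow> ('o, 'a, 'g) gpsh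
      \<Rightarrow> 'o set \<times> ('a \<Rightarrow> 'a \<Rightarrow> 'g) \<Rightarrow> bool" where
  "cech_cocycle C J e G = (\<lambda>(\<U>, g). cech_cover C J e \<U> \<and>
     (\<forall>a\<in>into_cover C \<U>. \<forall>b\<in>into_cover C \<U>. Dom C a = Dom C b \<longrightarrow>
        g a b \<in> carrier (grp G (Dom C a)) \<and>
        (\<forall>k\<in>into C (Dom C a). gres G k (g a b) = g (Cmp C a k) (Cmp C b k)) \<and>
        (\<forall>c\<in>into_cover C \<U>. Dom C c = Dom C a \<longrightarrow>
           g a b \<otimes>\<^bsub>grp G (Dom C a)\<^esub> g b c = g a c)))"

definition refinement :: "('o, 'a, 'm) cat_scheme \<Rightarrow> 'o set \<Rightarrow> 'o set \<Rightarrow> ('o \<Rightarrow> 'a) \<Rightarrow> bool" where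
  "refinement C \<W> \<U> r \<longleftrightarrow> (\<forall>W\<in>\<W>. r W \<in> Arr C \<and> Dom C (r W) = W \<and> Cod C (r W) \<in> \<U>)"

text \<open>Two cocycles have the same class in the colimit over all coverings iff they become
  cohomologous on a common refinement.\<close>

definition cech_rel ::
    "('o, 'a, 'm) cat_scheme \<Rightarrow> ('o \<Rightarrow> 'a set set) \<Rightarrow> 'o \<Rightarrow> ('o, 'a, 'g) gpsh
      \<Rightarrow> (('o set \<times> ('a \<Rightarrow> 'a \<Rightarrow> 'g)) \<times> ('o set \<times> ('a \<Rightarrow> 'a \<Rightarrow> 'g))) set" where
  "cech_rel C J e G = {((\<U>, g), (\<V>, h)).
     cech_cocycle C J e G (\<U>, g) \<and> cech_cocycle C J e G (\<V>, h) \<and>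
     (\<exists>\<W> r s c. cech_cover C J e \<W> \<and> refinement C \<W> \<U> r \<and> refinement C \<W> \<V> s \<and>
        (\<forall>W\<in>\<W>. c W \<in> carrier (grp G W)) \<and>
        (\<forall>a\<in>into_cover C \<W>. \<forall>b\<in>into_cover C \<W>. Dom C a = Dom C b \<longrightarrow>
           gres G a (c (Cod C a)) \<otimes>\<^bsub>grp G (Dom C a)\<^esub>
             h (Cmp C (s (Cod C a)) a) (Cmp C (s (Cod C b)) b) =
           g (Cmp C (r (Cod C a)) a) (Cmp C (r (Cod C b)) b) \<otimes>\<^bsub>grp G (Dom C a)\<^esub>
             gres G b (c (Cod C b))))}"

definition cech_H1 ::
    "('o, 'a, 'm) cat_scheme \<Rightarrow> ('o \<Rightarrow> 'a set set) \<Rightarrow> 'o \<Rightarrow> ('o, 'a, 'g) gpsh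
      \<Rightarrow> ('o set \<times> ('a \<Rightarrow> 'a \<Rightarrow> 'g)) set set" where
  "cech_H1 C J e G = Collect (cech_cocycle C J e G) // cech_rel C J e G"

text \<open>The torsor \<open>Z\<close> represents the class \<open>\<sigma>\<close>: it has sections over the members of some covering
  whose comparison cocycle belongs to \<open>\<sigma>\<close>.  Every class is represented by a torsor once the type
  \<open>'v\<close> of sections is large enough, for example \<open>'a \<times> 'a \<Rightarrow> 'g\<close>.\<close>

definition represents ::
    "('o, 'a, 'm) cat_scheme \<Rightarrow> ('o \<Rightarrow> 'a set set) \<Rightarrow> 'o \<Rightarrow> ('o, 'a, 'g) gpsh
      \<Rightarrow> ('o, 'a, 'v, 'g) rpsh \<Rightarrow> ('o set \<times> ('a \<Rightarrow> 'a \<Rightarrow> 'g)) set \<Rightarrow> bool" where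
  "represents C J e G Z \<sigma> \<longleftrightarrow> is_torsor C J G Z \<and>
     (\<exists>(\<U>, g)\<in>\<sigma>. \<exists>z. (\<forall>U\<in>\<U>. z U \<in> sec Z U) \<and>
        (\<forall>a\<in>into_cover C \<U>. \<forall>b\<in>into_cover C \<U>. Dom C a = Dom C b \<longrightarrow>
           ract Z (Dom C a) (res Z a (z (Cod C a))) (g a b) = res Z b (z (Cod C b))))"

subsection \<open>The fibred category associated to a torsor\<close>

text \<open>The arrow \<open>(\<phi>, s)\<close> is \<open>\<phi>\<close> regarded as an arrow from \<open>(Dom \<phi>, \<phi>\<^sup>* s)\<close> to \<open>(Cod \<phi>, s)\<close>.\<close>

definition assoc_fib ::
    "('o, 'a, 'bo, 'ba) fib \<Rightarrow> ('o, 'a, 'v, 'n) psh_scheme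
      \<Rightarrow> ('o \<times> 'v, 'a \<times> 'v, 'bo, 'ba) fib" where
  "assoc_fib T P =
    \<lparr> Ob = {(t, s). t \<in> Ob T \<and> s \<in> sec P t},
      Arr = {(\<phi>, s). \<phi> \<in> Arr T \<and> s \<in> sec P (Cod T \<phi>)},
      Dom = (\<lambda>(\<phi>, s). (Dom T \<phi>, res P \<phi> s)),
      Cod = (\<lambda>(\<phi>, s). (Cod T \<phi>, s)),
      Idn = (\<lambda>(t, s). (Idn T t, s)),
      Cmp = (\<lambda>(\<phi>, s) (\<psi>, r). (Cmp T \<phi> \<psi>, s)),
      prO = (\<lambda>(t, s). prO T t),
      prA = (\<lambda>(\<phi>, s). prA T \<phi>) \<rparr>"

definition assoc_proj ::
    "('o, 'a, 'bo, 'ba) fib \<Rightarrow> ('o, 'a, 'v, 'n) psh_scheme \<Rightarrow> ('o \<times> 'v, 'a \<times> 'v, 'o, 'a) fctr" where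
  "assoc_proj T P = \<lparr> onO = restrict fst (Ob (assoc_fib T P)),
                      onA = restrict fst (Arr (assoc_fib T P)) \<rparr>"


section \<open>Twisting\<close>

text \<open>A section over \<open>t\<close> of the sheaf associated to the presheaf \<open>F\<close> is encoded by the collection,
  for all \<open>\<phi>\<close> into \<open>t\<close>, of the sets \<open>E \<phi>\<close> of those sections of \<open>F\<close> over \<open>Dom \<phi>\<close> whose image in the
  associated sheaf is the restriction along \<open>\<phi>\<close> of the given section.  Families arising in this way
  are the subpresheaves of \<open>F\<close> over \<open>t\<close> that are locally non-empty, any two of whose sections are
  locally equal, and that contain every section which locally belongs to them.\<close>

definition sheafify ::
    "('o, 'a, 'm) cat_scheme \<Rightarrow> ('o \<Rightarrow> 'a set set) \<Rightarrow> ('o, 'a, 'v, 'n) psh_scheme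
      \<Rightarrow> ('o, 'a, 'a \<Rightarrow> 'v set) psh" where
  "sheafify T J F =
    \<lparr> sec = (\<lambda>t. {E.
        (\<forall>\<phi>. \<phi> \<notin> into T t \<longrightarrow> E \<phi> = {}) \<and>
        (\<forall>\<phi>\<in>into T t.
           E \<phi> \<subseteq> sec F (Dom T \<phi>) \<and>
           (\<forall>\<psi>\<in>into T (Dom T \<phi>). res F \<psi> ` E \<phi> \<subseteq> E (Cmp T \<phi> \<psi>)) \<and>
           (\<forall>e\<in>E \<phi>. \<forall>e'\<in>E \<phi>. \<exists>R\<in>J (Dom T \<phi>). \<forall>\<psi>\<in>R. res F \<psi> e = res F \<psi> e') \<and>
           (\<exists>R\<in>J (Dom T \<phi>). \<forall>\<psi>\<in>R. E (Cmp T \<phi> \<psi>) \<noteq> {}) \<and>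
           (\<forall>e\<in>sec F (Dom T \<phi>).
              (\<exists>R\<in>J (Dom T \<phi>). \<forall>\<psi>\<in>R. res F \<psi> e \<in> E (Cmp T \<phi> \<psi>)) \<longrightarrow> e \<in> E \<phi>))}),
      res = (\<lambda>\<chi> E \<phi>. if \<phi> \<in> into T (Dom T \<chi>) then E (Cmp T \<chi> \<phi>) else {}) \<rparr>"

text \<open>The sheaf of \<open>G\<close>-automorphisms of \<open>Z\<close>: a section over \<open>U\<close> is an automorphism \<open>h\<close> of the
  restriction of \<open>Z\<close> to the objects over \<open>U\<close>, with component \<open>h \<phi>\<close> at \<open>\<phi>\<close>.\<close>

definition ad ::
    "('o, 'a, 'm) cat_scheme \<Rightarrow> ('o, 'a, 'g) gpsh \<Rightarrow> ('o, 'a, 'v, 'g) rpsh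
      \<Rightarrow> ('o, 'a, 'a \<Rightarrow> 'v \<Rightarrow> 'v) gpsh" where
  "ad C G Z =
    \<lparr> grp = (\<lambda>U.
        \<lparr> carrier = {h.
            (\<forall>\<phi>. \<phi> \<notin> into C U \<longrightarrow> h \<phi> = (\<lambda>_. undefined)) \<and>
            (\<forall>\<phi>\<in>into C U.
               h \<phi> \<in> extensional (sec Z (Dom C \<phi>)) \<and>
               bij_betw (h \<phi>) (sec Z (Dom C \<phi>)) (sec Z (Dom C \<phi>)) \<and>
               (\<forall>z\<in>sec Z (Dom C \<phi>).
                  (\<forall>g\<in>carrier (grp G (Dom C \<phi>)).
                     h \<phi> (ract Z (Dom C \<phi>) z g) = ract Z (Dom C \<phi>) (h \<phi> z) g) \<and>
                  (\<forall>\<psi>\<in>into C (Dom C \<phi>). res Z \<psi> (h \<phi> z) = h (Cmp C \<phi> \<psi>) (res Z \<psi> z))))},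
          monoid.mult = (\<lambda>h k \<phi>. if \<phi> \<in> into C U then compose (sec Z (Dom C \<phi>)) (h \<phi>) (k \<phi>)
                          else (\<lambda>_. undefined)),
          one = (\<lambda>\<phi>. if \<phi> \<in> into C U then restrict (\<lambda>z. z) (sec Z (Dom C \<phi>))
                     else (\<lambda>_. undefined)) \<rparr>),
      gres = (\<lambda>\<chi> h \<phi>. if \<phi> \<in> into C (Dom C \<chi>) then h (Cmp C \<chi> \<phi>) else (\<lambda>_. undefined)) \<rparr>"

record ('o, 'a, 'v, 'g, 'h) bipsh = "('o, 'a, 'v, 'h) rpsh" +
  lact :: "'o \<Rightarrow> 'g \<Rightarrow> 'v \<Rightarrow> 'v"

text \<open>The inverse torsor of \<open>Z\<close>, with \<open>g\<close> acting on the left by \<open>z \<mapsto> z g\<^sup>-\<^sup>1\<close> and an automorphism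
  \<open>h\<close> acting on the right by \<open>z \<mapsto> h\<^sup>-\<^sup>1 z\<close>.\<close>

definition inverse_torsor ::
    "('o, 'a, 'm) cat_scheme \<Rightarrow> ('o, 'a, 'g) gpsh \<Rightarrow> ('o, 'a, 'v, 'g) rpsh
      \<Rightarrow> ('o, 'a, 'v, 'g, 'a \<Rightarrow> 'v \<Rightarrow> 'v) bipsh" where
  "inverse_torsor C G Z =
    \<lparr> sec = sec Z, res = res Z,
      ract = (\<lambda>U z h. (inv\<^bsub>grp (ad C G Z) U\<^esub> h) (Idn C U) z),
      lact = (\<lambda>U g z. ract Z U z (inv\<^bsub>grp G U\<^esub> g)) \<rparr>"

definition pull_bipsh ::
    "('o, 'a, 'o2, 'a2) fctr \<Rightarrow> ('o2, 'a2, 'v, 'g, 'h) bipsh \<Rightarrow> ('o, 'a, 'v, 'g, 'h) bipsh" where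
  "pull_bipsh u B = \<lparr> sec = (\<lambda>t. sec B (onO u t)), res = (\<lambda>\<phi>. res B (onA u \<phi>)),
                      ract = (\<lambda>t. ract B (onO u t)), lact = (\<lambda>t. lact B (onO u t)) \<rparr>"

definition orbit ::
    "('o, 'a, 'g) gpsh \<Rightarrow> ('o, 'a, 'y, 'g) rpsh \<Rightarrow> ('o, 'a, 'z, 'g, 'h) bipsh
      \<Rightarrow> 'o \<Rightarrow> 'y \<times> 'z \<Rightarrow> ('y \<times> 'z) set" where
  "orbit G Y B t = (\<lambda>(y, z).
     {(ract Y t y g, lact B t (inv\<^bsub>grp G t\<^esub> g) z) | g. g \<in> carrier (grp G t)})"

definition orbit_psh ::
    "('o, 'a, 'm) cat_scheme \<Rightarrow> ('o, 'a, 'g) gpsh \<Rightarrow> ('o, 'a, 'y, 'g) rpsh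
      \<Rightarrow> ('o, 'a, 'z, 'g, 'h) bipsh \<Rightarrow> ('o, 'a, ('y \<times> 'z) set) psh" where
  "orbit_psh T G Y B =
    \<lparr> sec = (\<lambda>t. orbit G Y B t ` (sec Y t \<times> sec B t)),
      res = (\<lambda>\<phi> q. \<Union>(y, z)\<in>q. orbit G Y B (Dom T \<phi>) (res Y \<phi> y, res B \<phi> z)) \<rparr>"

text \<open>The contracted product is the sheaf associated to the presheaf of orbits; the right action of
  the group sheaf \<open>H\<close> comes from the one on the second factor.\<close>

definition contracted_product ::
    "('o, 'a, 'm) cat_scheme \<Rightarrow> ('o \<Rightarrow> 'a set set) \<Rightarrow> ('o, 'a, 'g) gpsh \<Rightarrow> ('o, 'a, 'h) gpsh
      \<Rightarrow> ('o, 'a, 'y, 'g) rpsh \<Rightarrow> ('o, 'a, 'z, 'g, 'h) bipsh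
      \<Rightarrow> ('o, 'a, 'a \<Rightarrow> ('y \<times> 'z) set set, 'h) rpsh" where
  "contracted_product T J G H Y B =
    \<lparr> sec = sec (sheafify T J (orbit_psh T G Y B)),
      res = res (sheafify T J (orbit_psh T G Y B)),
      ract = (\<lambda>t E h \<phi>.
        (\<lambda>q. \<Union>(y, z)\<in>q. orbit G Y B (Dom T \<phi>) (y, ract B (Dom T \<phi>) z (gres H \<phi> h))) ` E \<phi>) \<rparr>"

definition twist ::
    "('bo, 'ba) cat \<Rightarrow> ('bo \<Rightarrow> 'ba set set) \<Rightarrow> ('bo, 'ba, 'g) gpsh \<Rightarrow> ('o, 'a, 'bo, 'ba) fib
      \<Rightarrow> ('o, 'a, 'y, 'g) rpsh \<Rightarrow> ('bo, 'ba, 'z, 'g) rpsh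
      \<Rightarrow> ('o, 'a, 'a \<Rightarrow> ('y \<times> 'z) set set, 'ba \<Rightarrow> 'z \<Rightarrow> 'z) rpsh" where
  "twist C J G X Y Z =
     contracted_product X (inherit J X) (pull_gpsh (str X) G) (pull_gpsh (str X) (ad C G Z))
       Y (pull_bipsh (str X) (inverse_torsor C G Z))"

end

theory Submission
  imports Defs
begin

text \<open>Why the theorem holds.  Let \<open>q\<close> be the structure morphism of \<open>A\<close>, let \<open>a\<close> be that of \<open>X\<close>, and
  let \<open>Z\<close> be a torsor on the base.  A point of the twist of \<open>Y\<close> by \<open>Z\<close> is a point \<open>x\<close> of \<open>X\<close> together
  with a compatible family of sections of the contracted product of \<open>Y\<close> with the inverse of
  \<open>a\<^sup>* Z\<close> over the objects \<open>x t\<close>.  In the orbits that make up the contracted product the inverse in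
  the relation \<open>(y g, g\<^sup>-\<^sup>1 z)\<close> cancels the inverse in the left action on the inverse torsor, so that
  they are orbits of the diagonal action of \<open>G\<close> on pairs \<open>(y, z)\<close>.  As \<open>G\<close> acts simply transitively
  on both sides, such an orbit is the graph of an equivariant bijection, and a section of the
  contracted product over \<open>x t\<close> is an isomorphism from \<open>Y\<close> to \<open>a\<^sup>* Z\<close> over the objects above \<open>x t\<close>
  (\<open>graph_bij\<close>, \<open>graph_section_sheafify\<close>).  A compatible family of these is an isomorphism from
  \<open>x\<^sup>* Y\<close> to \<open>q\<^sup>* Z\<close>.  Hence \<open>x\<close> lies in the essential image of the twist exactly if \<open>x\<^sup>* Y\<close> and
  \<open>q\<^sup>* Z\<close> are isomorphic (\<open>ess_image_twist\<close>).

  On the other side, the class of \<open>x\<^sup>* Y\<close> comes from the base exactly if \<open>x\<^sup>* Y\<close> is isomorphic to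
  \<open>q\<^sup>* P\<close> for some torsor \<open>P\<close> on the base (\<open>homs_f_iff\<close>).  The two conditions agree because every
  \<open>P\<close> has sections over some covering of \<open>S\<close>, hence a Cech cocycle, and is isomorphic to the torsor
  chosen to represent the class of that cocycle (\<open>isomorphic_to_representative\<close>).

  Both the isomorphisms read off from a section of the contracted product and those between torsors
  with the same cocycle are given locally as graphs of equivariant bijections; \<open>graph_glue\<close> turns
  such local graphs into a global one.  That \<open>A\<close> is fibred in sets is used for passing from an
  isomorphism on \<open>A\<close> to sections on \<open>X\<close> (\<open>sections_of_isomorphic\<close>): an arrow of \<open>X\<close> into \<open>x t\<close> is,
  up to a vertical isomorphism, the image of a unique arrow of \<open>A\<close>.  From the theory of schemes the
  argument takes that the schemes over \<open>S\<close> form a category with a morphism from each object to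
  \<open>S\<close>.\<close>

section \<open>Morphisms of locally ringed spaces\<close>

lemma rs_cring: "is_ringed_space X \<Longrightarrow> openin (rs_top X) U \<Longrightarrow> cring (rs_sec X U)"
  by (simp add: is_ringed_space_def)

lemma rs_res_hom:
  "is_ringed_space X \<Longrightarrow> openin (rs_top X) U \<Longrightarrow> openin (rs_top X) V \<Longrightarrow> V \<subseteq> U \<Longrightarrow>
    rs_res X U V \<in> ring_hom (rs_sec X U) (rs_sec X V)"
  by (simp add: is_ringed_space_def)

lemma rs_res_closed:
  "is_ringed_space X \<Longrightarrow> openin (rs_top X) U \<Longrightarrow> openin (rs_top X) V \<Longrightarrow> V \<subseteq> U \<Longrightarrow>
    s \<in> carrier (rs_sec X U) \<Longrightarrow> rs_res X U V s \<in> carrier (rs_sec X V)"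
  by (rule ring_hom_closed[OF rs_res_hom])

lemma rs_res_comp:
  "is_ringed_space X \<Longrightarrow> openin (rs_top X) U \<Longrightarrow> openin (rs_top X) V \<Longrightarrow> openin (rs_top X) W \<Longrightarrow>
    V \<subseteq> U \<Longrightarrow> W \<subseteq> V \<Longrightarrow> s \<in> carrier (rs_sec X U) \<Longrightarrow>
    rs_res X V W (rs_res X U V s) = rs_res X U W s"
  by (simp add: is_ringed_space_def)

lemma germ_self:
  "openin (rs_top X) U \<Longrightarrow> x \<in> U \<Longrightarrow> s \<in> carrier (rs_sec X U) \<Longrightarrow> (U, s) \<in> germ X x U s"
  unfolding germ_def by blast

lemma germ_memI:
  "openin (rs_top X) V \<Longrightarrow> x \<in> V \<Longrightarrow> t \<in> carrier (rs_sec X V) \<Longrightarrow> openin (rs_top X) W \<Longrightarrow> x \<in> W \<Longrightarrow>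
    W \<subseteq> U \<inter> V \<Longrightarrow> rs_res X U W s = rs_res X V W t \<Longrightarrow> (V, t) \<in> germ X x U s"
  unfolding germ_def by blast

text \<open>Agreement near \<open>x\<close> is transitive: restrict to the intersection of the two neighbourhoods.\<close>

lemma germ_subset:
  assumes X: "is_ringed_space X" and U: "openin (rs_top X) U" "s \<in> carrier (rs_sec X U)"
    and V: "openin (rs_top X) V" "t \<in> carrier (rs_sec X V)"
    and W: "openin (rs_top X) W" "x \<in> W" "W \<subseteq> U" "W \<subseteq> V" "rs_res X U W s = rs_res X V W t"
  shows "germ X x V t \<subseteq> germ X x U s"
proof
  fix p assume "p \<in> germ X x V t"
  then obtain V' t' W' where p: "p = (V', t')" "openin (rs_top X) V'" "x \<in> V'"
    "t' \<in> carrier (rs_sec X V')" "openin (rs_top X) W'" "x \<in> W'" "W' \<subseteq> V \<inter> V'"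
    "rs_res X V W' t = rs_res X V' W' t'"
    unfolding germ_def by blast
  let ?W = "W \<inter> W'"
  have o: "openin (rs_top X) ?W" using W p by blast
  have "rs_res X U ?W s = rs_res X W ?W (rs_res X U W s)"
    by (rule rs_res_comp[symmetric, OF X U(1) W(1) o W(3) _ U(2)]) simp
  also have "\<dots> = rs_res X V ?W t"
    unfolding W(5) by (rule rs_res_comp[OF X V(1) W(1) o W(4) _ V(2)]) simp
  also have "\<dots> = rs_res X W' ?W (rs_res X V W' t)"
    by (rule rs_res_comp[symmetric, OF X V(1) p(5) o _ _ V(2)]) (use p in auto)
  also have "\<dots> = rs_res X V' ?W t'"
    unfolding p(8) by (rule rs_res_comp[OF X p(2) p(5) o _ _ p(4)]) (use p in auto)
  finally have e: "rs_res X U ?W s = rs_res X V' ?W t'" .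
  show "p \<in> germ X x U s"
    unfolding p(1) by (rule germ_memI[OF p(2-4) o _ _ e]) (use W p in auto)
qed

text \<open>Germs are equivalence classes, so a stalk map may be computed on any representative.\<close>

lemma germ_eq:
  assumes X: "is_ringed_space X" and U: "openin (rs_top X) U" "s \<in> carrier (rs_sec X U)"
    and m: "(V, t) \<in> germ X x U s"
  shows "germ X x V t = germ X x U s"
proof -
  from m obtain W where "openin (rs_top X) V" "t \<in> carrier (rs_sec X V)"
    "openin (rs_top X) W" "x \<in> W" "W \<subseteq> U" "W \<subseteq> V" "rs_res X U W s = rs_res X V W t"
    unfolding germ_def by blast
  note W = this
  show ?thesis
    using germ_subset[OF X U W(1-6) W(7)]
      germ_subset[OF X W(1,2) U W(3,4) W(6,5) W(7)[symmetric]] by (rule equalityI)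
qed

lemma stalk_carrierE:
  assumes "a \<in> carrier (stalk X x)"
  obtains U s where "a = germ X x U s" "openin (rs_top X) U" "x \<in> U" "s \<in> carrier (rs_sec X U)"
  using assms unfolding stalk_def by auto

lemma rs_mor_pre_open:
  "is_rs_mor X Y f \<Longrightarrow> openin (rs_top Y) V \<Longrightarrow> openin (rs_top X) (rs_pre X f V)"
  by (simp add: is_rs_mor_def rs_pre_def continuous_map_def)

lemma rs_mor_cmp_hom:
  "is_rs_mor X Y f \<Longrightarrow> openin (rs_top Y) V \<Longrightarrow>
    rs_cmp f V \<in> ring_hom (rs_sec Y V) (rs_sec X (rs_pre X f V))"
  by (simp add: is_rs_mor_def)

lemma rs_mor_cmp_closed:
  "is_rs_mor X Y f \<Longrightarrow> openin (rs_top Y) V \<Longrightarrow> s \<in> carrier (rs_sec Y V) \<Longrightarrow>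
    rs_cmp f V s \<in> carrier (rs_sec X (rs_pre X f V))"
  by (rule ring_hom_closed[OF rs_mor_cmp_hom])

lemma rs_mor_natural:
  "is_rs_mor X Y f \<Longrightarrow> openin (rs_top Y) V \<Longrightarrow> openin (rs_top Y) W \<Longrightarrow> W \<subseteq> V \<Longrightarrow>
    s \<in> carrier (rs_sec Y V) \<Longrightarrow>
    rs_res X (rs_pre X f V) (rs_pre X f W) (rs_cmp f V s) = rs_cmp f W (rs_res Y V W s)"
  by (simp add: is_rs_mor_def)

lemma rs_mor_pt:
  "is_rs_mor X Y f \<Longrightarrow> x \<in> topspace (rs_top X) \<Longrightarrow> rs_pt f x \<in> topspace (rs_top Y)"
  by (auto simp: is_rs_mor_def continuous_map_def)

lemma rs_mor_cont: "is_rs_mor X Y f \<Longrightarrow> continuous_map (rs_top X) (rs_top Y) (rs_pt f)"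
  by (simp add: is_rs_mor_def)

lemma rs_mor_pt_ext: "is_rs_mor X Y f \<Longrightarrow> rs_pt f \<in> extensional (topspace (rs_top X))"
  by (simp add: is_rs_mor_def)

lemma rs_mor_cmp_ext:
  "is_rs_mor X Y f \<Longrightarrow> openin (rs_top Y) V \<Longrightarrow> rs_cmp f V \<in> extensional (carrier (rs_sec Y V))"
  by (simp add: is_rs_mor_def)

lemma rs_mor_cmp_undef:
  "is_rs_mor X Y f \<Longrightarrow> \<not> openin (rs_top Y) V \<Longrightarrow> rs_cmp f V = (\<lambda>_. undefined)"
  by (simp add: is_rs_mor_def)

lemma rs_pre_mono: "W \<subseteq> V \<Longrightarrow> rs_pre X f W \<subseteq> rs_pre X f V"
  unfolding rs_pre_def by blast

text \<open>Comorphisms commute with restriction, so all members of a germ have the same image and the union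
  that defines the stalk map is a union of equal sets.\<close>

lemma stalk_map_germ:
  assumes X: "is_ringed_space X" and Y: "is_ringed_space Y" and f: "is_rs_mor X Y f"
    and x: "x \<in> topspace (rs_top X)" and V: "openin (rs_top Y) V" "rs_pt f x \<in> V"
      "t \<in> carrier (rs_sec Y V)"
  shows "stalk_map X f x (germ Y (rs_pt f x) V t) = germ X x (rs_pre X f V) (rs_cmp f V t)"
proof -
  have "germ X x (rs_pre X f V') (rs_cmp f V' t') = germ X x (rs_pre X f V) (rs_cmp f V t)"
    if m: "(V', t') \<in> germ Y (rs_pt f x) V t" for V' t'
  proof -
    from m obtain W where W: "openin (rs_top Y) V'" "rs_pt f x \<in> V'" "t' \<in> carrier (rs_sec Y V')"
      "openin (rs_top Y) W" "rs_pt f x \<in> W" "W \<subseteq> V" "W \<subseteq> V'" "rs_res Y V W t = rs_res Y V' W t'"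
      unfolding germ_def by blast
    have "(rs_pre X f V', rs_cmp f V' t') \<in> germ X x (rs_pre X f V) (rs_cmp f V t)"
    proof (rule germ_memI[of _ _ _ _ "rs_pre X f W"])
      show "rs_res X (rs_pre X f V) (rs_pre X f W) (rs_cmp f V t)
          = rs_res X (rs_pre X f V') (rs_pre X f W) (rs_cmp f V' t')"
        using rs_mor_natural[OF f V(1) W(4,6) V(3)] rs_mor_natural[OF f W(1) W(4,7) W(3)] W(8)
        by simp
      show "openin (rs_top X) (rs_pre X f V')" "openin (rs_top X) (rs_pre X f W)"
        using rs_mor_pre_open[OF f] W by auto
      show "rs_cmp f V' t' \<in> carrier (rs_sec X (rs_pre X f V'))"
        by (rule rs_mor_cmp_closed[OF f W(1,3)])
      show "rs_pre X f W \<subseteq> rs_pre X f V \<inter> rs_pre X f V'"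
        using rs_pre_mono[OF W(6)] rs_pre_mono[OF W(7)] by (rule Int_greatest)
    qed (use x W in \<open>simp_all add: rs_pre_def\<close>)
    then show ?thesis
      by (rule germ_eq[OF X rs_mor_pre_open[OF f V(1)] rs_mor_cmp_closed[OF f V(1,3)]])
  qed
  then have *: "\<forall>(V', t') \<in> germ Y (rs_pt f x) V t.
      germ X x (rs_pre X f V') (rs_cmp f V' t') = germ X x (rs_pre X f V) (rs_cmp f V t)"
    by blast
  have "(V, t) \<in> germ Y (rs_pt f x) V t" by (rule germ_self[OF V])
  then show ?thesis
    unfolding stalk_map_def by (intro SUP_eq_const) (use * in auto)
qed

lemma max_ideal_subset: "local_ring R \<Longrightarrow> max_ideal R \<subseteq> carrier R"
proof -
  assume "local_ring R"
  then have "maximalideal (max_ideal R) R"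
    unfolding local_ring_def max_ideal_def by (metis the_equality)
  then have "ideal (max_ideal R) R" by (rule maximalideal.axioms)
  then show ?thesis by (meson additive_subgroup.a_subset ideal.axioms(1))
qed

lemma rs_pre_comp:
  assumes "is_rs_mor X Y f"
  shows "rs_pre X (rs_comp X Y W g f) V = rs_pre X f (rs_pre Y g V)"
  using rs_mor_pt[OF assms] unfolding rs_pre_def rs_comp_def by auto

lemma rs_mor_comp:
  assumes f: "is_rs_mor X Y f" and g: "is_rs_mor Y W g" and ring: "is_ringed_space W"
  shows "is_rs_mor X W (rs_comp X Y W g f)"
  unfolding is_rs_mor_def
proof (intro conjI allI impI ballI)
  let ?h = "rs_comp X Y W g f"
  show "rs_pt ?h \<in> extensional (topspace (rs_top X))" by (simp add: rs_comp_def)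
  have "continuous_map (rs_top X) (rs_top W) (rs_pt g \<circ> rs_pt f)"
    using rs_mor_cont[OF f] rs_mor_cont[OF g] by (rule continuous_map_compose)
  then show "continuous_map (rs_top X) (rs_top W) (rs_pt ?h)"
    by (rule continuous_map_eq) (simp add: rs_comp_def)
  fix V
  show "rs_cmp ?h V = (\<lambda>_. undefined)" if "\<not> openin (rs_top W) V"
    using that by (simp add: rs_comp_def)
  assume V: "openin (rs_top W) V"
  then have eq: "rs_cmp ?h V
      = restrict (\<lambda>s. rs_cmp f (rs_pre Y g V) (rs_cmp g V s)) (carrier (rs_sec W V))"
    by (simp add: rs_comp_def)
  show "rs_cmp ?h V \<in> extensional (carrier (rs_sec W V))" by (simp add: eq)
  have "rs_cmp f (rs_pre Y g V) \<circ> rs_cmp g V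
      \<in> ring_hom (rs_sec W V) (rs_sec X (rs_pre X f (rs_pre Y g V)))"
    using ring_hom_trans rs_mor_cmp_hom[OF g V] rs_mor_cmp_hom[OF f rs_mor_pre_open[OF g V]] by blast
  then have "rs_cmp ?h V \<in> ring_hom (rs_sec W V) (rs_sec X (rs_pre X f (rs_pre Y g V)))"
    by (rule ring.ring_hom_restrict[OF cring.axioms(1)[OF rs_cring[OF ring V]]]) (simp add: eq)
  then show "rs_cmp ?h V \<in> ring_hom (rs_sec W V) (rs_sec X (rs_pre X ?h V))"
    by (simp add: rs_pre_comp[OF f])
next
  let ?h = "rs_comp X Y W g f"
  fix V V' s
  assume a: "openin (rs_top W) V \<and> openin (rs_top W) V' \<and> V' \<subseteq> V" and s: "s \<in> carrier (rs_sec W V)"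
  then have V: "openin (rs_top W) V" "openin (rs_top W) V'" "V' \<subseteq> V" by auto
  have s': "rs_res W V V' s \<in> carrier (rs_sec W V')" using rs_res_closed[OF ring V s] .
  show "rs_res X (rs_pre X ?h V) (rs_pre X ?h V') (rs_cmp ?h V s) = rs_cmp ?h V' (rs_res W V V' s)"
    using rs_mor_natural[OF f rs_mor_pre_open[OF g V(1)] rs_mor_pre_open[OF g V(2)] rs_pre_mono[OF V(3)]
        rs_mor_cmp_closed[OF g V(1) s]] rs_mor_natural[OF g V s] s s' V
    unfolding rs_pre_comp[OF f] by (simp add: rs_comp_def)
qed

lemma lrs_ringed: "is_locally_ringed_space X \<Longrightarrow> is_ringed_space X"
  unfolding is_locally_ringed_space_def by blast

text \<open>On germs the stalk map of a composite is the composite of the stalk maps; both of these respect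
  the maximal ideals.\<close>

lemma lrs_mor_comp:
  assumes X: "is_locally_ringed_space X" and Y: "is_locally_ringed_space Y"
    and W: "is_locally_ringed_space W"
    and f: "is_lrs_mor X Y f" and g: "is_lrs_mor Y W g"
  shows "is_lrs_mor X W (rs_comp X Y W g f)"
proof -
  let ?h = "rs_comp X Y W g f"
  have f': "is_rs_mor X Y f" and g': "is_rs_mor Y W g"
    using f g unfolding is_lrs_mor_def by auto
  have h': "is_rs_mor X W ?h" by (rule rs_mor_comp[OF f' g' lrs_ringed[OF W]])
  have "stalk_map X ?h x a \<in> max_ideal (stalk X x)"
    if x: "x \<in> topspace (rs_top X)" and a: "a \<in> max_ideal (stalk W (rs_pt ?h x))" for x a
  proof -
    have hx: "rs_pt ?h x = rs_pt g (rs_pt f x)" using x by (simp add: rs_comp_def)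
    have fx: "rs_pt f x \<in> topspace (rs_top Y)" using rs_mor_pt[OF f' x] .
    have gx: "rs_pt ?h x \<in> topspace (rs_top W)" using rs_mor_pt[OF h' x] .
    have "a \<in> carrier (stalk W (rs_pt ?h x))"
      using a gx W max_ideal_subset unfolding is_locally_ringed_space_def by blast
    then obtain V t where V: "a = germ W (rs_pt ?h x) V t" "openin (rs_top W) V" "rs_pt ?h x \<in> V"
      "t \<in> carrier (rs_sec W V)" by (rule stalk_carrierE)
    have "stalk_map X ?h x a = germ X x (rs_pre X ?h V) (rs_cmp ?h V t)"
      unfolding V(1) by (rule stalk_map_germ[OF lrs_ringed[OF X] lrs_ringed[OF W] h' x V(2-4)])
    also have "\<dots> = germ X x (rs_pre X f (rs_pre Y g V)) (rs_cmp f (rs_pre Y g V) (rs_cmp g V t))"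
      unfolding rs_pre_comp[OF f'] using V by (simp add: rs_comp_def)
    also have "\<dots> = stalk_map X f x (germ Y (rs_pt f x) (rs_pre Y g V) (rs_cmp g V t))"
      by (rule stalk_map_germ[OF lrs_ringed[OF X] lrs_ringed[OF Y] f' x, symmetric])
        (use V hx fx rs_mor_pre_open[OF g'] rs_mor_cmp_closed[OF g'] in \<open>auto simp: rs_pre_def\<close>)
    also have "\<dots> = stalk_map X f x (stalk_map Y g (rs_pt f x) a)"
      unfolding V(1) hx
      by (subst stalk_map_germ[OF lrs_ringed[OF Y] lrs_ringed[OF W] g' fx]) (use V hx in auto)
    finally show ?thesis
      using f g x fx a hx unfolding is_lrs_mor_def by fastforce
  qed
  then show ?thesis using h' unfolding is_lrs_mor_def by blast
qed

lemma rs_pre_id: "openin (rs_top X) V \<Longrightarrow> rs_pre X (rs_id X) V = V"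
  unfolding rs_pre_def rs_id_def by (auto dest: openin_subset)

lemma rs_mor_id:
  assumes X: "is_ringed_space X"
  shows "is_rs_mor X X (rs_id X)"
  unfolding is_rs_mor_def
proof (intro conjI allI impI ballI)
  show "rs_pt (rs_id X) \<in> extensional (topspace (rs_top X))" by (simp add: rs_id_def)
  show "continuous_map (rs_top X) (rs_top X) (rs_pt (rs_id X))"
    by (rule continuous_map_eq[OF continuous_map_id]) (simp add: rs_id_def)
  fix V
  show "rs_cmp (rs_id X) V = (\<lambda>_. undefined)" if "\<not> openin (rs_top X) V"
    using that by (simp add: rs_id_def)
  assume V: "openin (rs_top X) V"
  then show "rs_cmp (rs_id X) V \<in> extensional (carrier (rs_sec X V))" by (simp add: rs_id_def)
  show "rs_cmp (rs_id X) V \<in> ring_hom (rs_sec X V) (rs_sec X (rs_pre X (rs_id X) V))"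
    unfolding rs_pre_id[OF V]
    by (rule ring.ring_hom_restrict[OF cring.axioms(1)[OF rs_cring[OF X V]] id_ring_hom])
      (simp add: rs_id_def V)
next
  fix V W s assume a: "openin (rs_top X) V \<and> openin (rs_top X) W \<and> W \<subseteq> V"
    and s: "s \<in> carrier (rs_sec X V)"
  then show "rs_res X (rs_pre X (rs_id X) V) (rs_pre X (rs_id X) W) (rs_cmp (rs_id X) V s)
      = rs_cmp (rs_id X) W (rs_res X V W s)"
    using rs_res_closed[OF X] by (simp add: rs_pre_id) (simp add: rs_id_def)
qed

lemma lrs_mor_id:
  assumes X: "is_locally_ringed_space X"
  shows "is_lrs_mor X X (rs_id X)"
proof -
  note r = lrs_ringed[OF X]
  have "stalk_map X (rs_id X) x a \<in> max_ideal (stalk X x)"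
    if x: "x \<in> topspace (rs_top X)" and a: "a \<in> max_ideal (stalk X (rs_pt (rs_id X) x))" for x a
  proof -
    have ix: "rs_pt (rs_id X) x = x" using x by (simp add: rs_id_def)
    have "a \<in> carrier (stalk X x)"
      using a x X max_ideal_subset unfolding is_locally_ringed_space_def ix by blast
    then obtain V t where V: "a = germ X x V t" "openin (rs_top X) V" "x \<in> V"
      "t \<in> carrier (rs_sec X V)" by (rule stalk_carrierE)
    have "stalk_map X (rs_id X) x a = germ X x (rs_pre X (rs_id X) V) (rs_cmp (rs_id X) V t)"
      using stalk_map_germ[OF r r rs_mor_id[OF r] x V(2) _ V(4)] V(1,3) by (simp add: ix)
    also have "\<dots> = a" using V by (simp add: rs_pre_id) (simp add: rs_id_def)
    finally show ?thesis using a ix by simp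
  qed
  then show ?thesis using rs_mor_id[OF r] unfolding is_lrs_mor_def by blast
qed

lemma rs_comp_id_right:
  assumes f: "is_rs_mor X Y f"
  shows "rs_comp X X Y f (rs_id X) = f"
proof (rule rs_mor.equality)
  show "rs_pt (rs_comp X X Y f (rs_id X)) = rs_pt f"
    using rs_mor_pt_ext[OF f] by (auto simp: rs_comp_def rs_id_def extensional_def)
  show "rs_cmp (rs_comp X X Y f (rs_id X)) = rs_cmp f"
  proof
    fix V
    show "rs_cmp (rs_comp X X Y f (rs_id X)) V = rs_cmp f V"
    proof (cases "openin (rs_top Y) V")
      case V: True
      have "rs_cmp (rs_comp X X Y f (rs_id X)) V s = rs_cmp f V s" for s
      proof (cases "s \<in> carrier (rs_sec Y V)")
        case True
        then have "rs_cmp (rs_id X) (rs_pre X f V) (rs_cmp f V s) = rs_cmp f V s"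
          using rs_mor_pre_open[OF f V] rs_mor_cmp_closed[OF f V] by (simp add: rs_id_def)
        with True V show ?thesis by (simp add: rs_comp_def)
      next
        case False
        then show ?thesis
          using V rs_mor_cmp_ext[OF f V] by (simp add: rs_comp_def extensional_def)
      qed
      then show ?thesis by blast
    qed (simp add: rs_comp_def rs_mor_cmp_undef[OF f])
  qed
qed simp

lemma rs_comp_id_left:
  assumes f: "is_rs_mor X Y f"
  shows "rs_comp X Y Y (rs_id Y) f = f"
proof (rule rs_mor.equality)
  show "rs_pt (rs_comp X Y Y (rs_id Y) f) = rs_pt f"
    using rs_mor_pt_ext[OF f] rs_mor_pt[OF f] by (auto simp: rs_comp_def rs_id_def extensional_def)
  show "rs_cmp (rs_comp X Y Y (rs_id Y) f) = rs_cmp f"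
  proof
    fix V
    show "rs_cmp (rs_comp X Y Y (rs_id Y) f) V = rs_cmp f V"
    proof (cases "openin (rs_top Y) V")
      case V: True
      have "rs_cmp (rs_comp X Y Y (rs_id Y) f) V s = rs_cmp f V s" for s
      proof (cases "s \<in> carrier (rs_sec Y V)")
        case True
        then have "rs_cmp (rs_id Y) V s = s" using V by (simp add: rs_id_def)
        with True V show ?thesis by (simp add: rs_comp_def rs_pre_id)
      next
        case False
        then show ?thesis
          using V rs_mor_cmp_ext[OF f V] by (simp add: rs_comp_def extensional_def)
      qed
      then show ?thesis by blast
    qed (simp add: rs_comp_def rs_mor_cmp_undef[OF f])
  qed
qed simp

lemma rs_comp_assoc:
  assumes f: "is_rs_mor X Y f" and g: "is_rs_mor Y W g" and h: "is_rs_mor W V h"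
  shows "rs_comp X W V h (rs_comp X Y W g f) = rs_comp X Y V (rs_comp Y W V h g) f"
proof (rule rs_mor.equality)
  show "rs_pt (rs_comp X W V h (rs_comp X Y W g f)) = rs_pt (rs_comp X Y V (rs_comp Y W V h g) f)"
    using rs_mor_pt[OF f] by (auto simp: rs_comp_def)
  show "rs_cmp (rs_comp X W V h (rs_comp X Y W g f)) = rs_cmp (rs_comp X Y V (rs_comp Y W V h g) f)"
  proof
    fix U
    show "rs_cmp (rs_comp X W V h (rs_comp X Y W g f)) U
        = rs_cmp (rs_comp X Y V (rs_comp Y W V h g) f) U"
    proof (cases "openin (rs_top V) U")
      case U: True
      have "rs_cmp (rs_comp X W V h (rs_comp X Y W g f)) U s
          = rs_cmp (rs_comp X Y V (rs_comp Y W V h g) f) U s" for s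
      proof (cases "s \<in> carrier (rs_sec V U)")
        case True
        then have "rs_cmp (rs_comp X Y W g f) (rs_pre W h U) (rs_cmp h U s)
          = rs_cmp f (rs_pre Y (rs_comp Y W V h g) U) (rs_cmp (rs_comp Y W V h g) U s)"
          unfolding rs_pre_comp[OF g]
          using U rs_mor_pre_open[OF h U] rs_mor_cmp_closed[OF h U] by (simp add: rs_comp_def)
        with True U show ?thesis
          unfolding rs_comp_def[of X W V] rs_comp_def[of X Y V] by simp
      qed (simp add: U rs_comp_def)
      then show ?thesis by blast
    qed (simp add: rs_comp_def)
  qed
qed simp

section \<open>The category of schemes over a scheme\<close>

lemma Sch_Ob: "Ob (Sch \<UU> S) = {(X, p). X \<in> \<UU> \<and> is_scheme X \<and> is_lrs_mor X S p}"
  by (simp add: Sch_def Let_def)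

lemma Sch_Arr: "((a, m, b) \<in> Arr (Sch \<UU> S)) \<longleftrightarrow> a \<in> Ob (Sch \<UU> S) \<and> b \<in> Ob (Sch \<UU> S) \<and>
    is_lrs_mor (fst a) (fst b) m \<and> rs_comp (fst a) (fst b) S (snd b) m = snd a"
  by (cases a; cases b) (auto simp: Sch_def Let_def)

lemma Sch_sel:
  "Dom (Sch \<UU> S) (a, m, b) = a" "Cod (Sch \<UU> S) (a, m, b) = b"
  "Idn (Sch \<UU> S) a = (a, rs_id (fst a), a)"
  "Cmp (Sch \<UU> S) (b, n, c) (a, m, b) = (a, rs_comp (fst a) (fst b) (fst c) n m, c)"
  by (simp_all add: Sch_def Let_def)

lemma scheme_lrs: "is_scheme X \<Longrightarrow> is_locally_ringed_space X"
  by (simp add: is_scheme_def)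

lemma lrs_rs_mor: "is_lrs_mor X Y f \<Longrightarrow> is_rs_mor X Y f"
  by (simp add: is_lrs_mor_def)

text \<open>The laws are those for morphisms of ringed spaces.  That a composite is again a morphism over \<open>S\<close>
  is associativity.\<close>

theorem Sch_is_cat: "is_cat (Sch \<UU> S)"
proof -
  let ?C = "Sch \<UU> S"
  have lrs: "is_locally_ringed_space (fst a)" if "a \<in> Ob ?C" for a
    using that scheme_lrs by (auto simp: Sch_Ob)
  have str: "is_rs_mor (fst a) S (snd a)" if "a \<in> Ob ?C" for a
    using that lrs_rs_mor by (auto simp: Sch_Ob)
  have id: "(a, rs_id (fst a), a) \<in> Arr ?C" if a: "a \<in> Ob ?C" for a
    unfolding Sch_Arr using a lrs_mor_id[OF lrs[OF a]] rs_comp_id_right[OF str[OF a]] by simp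
  have comp: "(a, rs_comp (fst a) (fst b) (fst c) n m, c) \<in> Arr ?C"
    if m: "(a, m, b) \<in> Arr ?C" and n: "(b, n, c) \<in> Arr ?C" for a m b n c
  proof -
    from m n have m': "a \<in> Ob ?C" "b \<in> Ob ?C" "is_lrs_mor (fst a) (fst b) m"
      "rs_comp (fst a) (fst b) S (snd b) m = snd a"
      and n': "c \<in> Ob ?C" "is_lrs_mor (fst b) (fst c) n"
      "rs_comp (fst b) (fst c) S (snd c) n = snd b" unfolding Sch_Arr by auto
    have "rs_comp (fst a) (fst c) S (snd c) (rs_comp (fst a) (fst b) (fst c) n m) = snd a"
      using rs_comp_assoc[OF lrs_rs_mor[OF m'(3)] lrs_rs_mor[OF n'(2)] str[OF n'(1)]] m' n' by simp
    then show ?thesis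
      unfolding Sch_Arr
      using m' n' lrs_mor_comp[OF lrs[OF m'(1)] lrs[OF m'(2)] lrs[OF n'(1)] m'(3) n'(2)] by simp
  qed
  show ?thesis
    unfolding is_cat_def
  proof (intro conjI ballI impI)
    fix f assume f: "f \<in> Arr ?C"
    obtain a m b where fe: "f = (a, m, b)" by (cases f) auto
    have f': "a \<in> Ob ?C" "b \<in> Ob ?C" "is_rs_mor (fst a) (fst b) m"
      using f lrs_rs_mor unfolding fe Sch_Arr by auto
    show "Dom ?C f \<in> Ob ?C" "Cod ?C f \<in> Ob ?C" using f' by (simp_all add: fe Sch_sel)
    show "Cmp ?C f (Idn ?C (Dom ?C f)) = f" "Cmp ?C (Idn ?C (Cod ?C f)) f = f"
      using rs_comp_id_right[OF f'(3)] rs_comp_id_left[OF f'(3)] by (simp_all add: fe Sch_sel)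
    fix g assume g: "g \<in> Arr ?C" and fg: "Cod ?C f = Dom ?C g"
    obtain n c where ge: "g = (b, n, c)" using fg by (cases g) (auto simp: fe Sch_sel)
    show "Cmp ?C g f \<in> Arr ?C" "Dom ?C (Cmp ?C g f) = Dom ?C f" "Cod ?C (Cmp ?C g f) = Cod ?C g"
      using comp[of a m b n c] f g by (simp_all add: fe ge Sch_sel)
  next
    fix a assume "a \<in> Ob ?C"
    then show "Idn ?C a \<in> Arr ?C" "Dom ?C (Idn ?C a) = a" "Cod ?C (Idn ?C a) = a"
      using id by (simp_all add: Sch_sel)
  next
    fix f g h assume f: "f \<in> Arr ?C" and g: "g \<in> Arr ?C" and h: "h \<in> Arr ?C"
      and c: "Cod ?C f = Dom ?C g \<and> Cod ?C g = Dom ?C h"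
    obtain a m b where fe: "f = (a, m, b)" by (cases f) auto
    obtain n d where ge: "g = (b, n, d)" using c by (cases g) (auto simp: fe Sch_sel)
    obtain k e where he: "h = (d, k, e)" using c by (cases h) (auto simp: ge Sch_sel)
    show "Cmp ?C h (Cmp ?C g f) = Cmp ?C (Cmp ?C h g) f"
      using f g h rs_comp_assoc[of "fst a" "fst b" m "fst d" n "fst e" k] lrs_rs_mor
      unfolding fe ge he Sch_Arr by (auto simp: Sch_sel)
  qed
qed

lemma Sch_final_Ob: "is_scheme S \<Longrightarrow> S \<in> \<UU> \<Longrightarrow> Sch_final S \<in> Ob (Sch \<UU> S)"
  by (simp add: Sch_final_def Sch_Ob lrs_mor_id scheme_lrs)

text \<open>The structure morphism of \<open>t\<close>, read as an arrow of the category.\<close>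

lemma Sch_final_arrow:
  assumes "is_scheme S" "S \<in> \<UU>" and t: "t \<in> Ob (Sch \<UU> S)"
  shows "(t, snd t, Sch_final S) \<in> into (Sch \<UU> S) (Sch_final S)"
    and "Dom (Sch \<UU> S) (t, snd t, Sch_final S) = t"
proof -
  have "is_lrs_mor (fst t) S (snd t)" using t by (auto simp: Sch_Ob)
  then show "(t, snd t, Sch_final S) \<in> into (Sch \<UU> S) (Sch_final S)"
    using t Sch_final_Ob[OF assms(1,2)] rs_comp_id_left[OF lrs_rs_mor]
    by (simp add: into_def Sch_Arr Sch_sel) (simp add: Sch_final_def)
qed (simp add: Sch_sel)

section \<open>Categories, sites and fibred categories\<close>

lemma cat_Dom: "is_cat C \<Longrightarrow> f \<in> Arr C \<Longrightarrow> Dom C f \<in> Ob C"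
  and cat_Cod: "is_cat C \<Longrightarrow> f \<in> Arr C \<Longrightarrow> Cod C f \<in> Ob C"
  by (simp_all add: is_cat_def)

lemma into_Arr: "f \<in> into C t \<Longrightarrow> f \<in> Arr C"
  and into_Cod: "f \<in> into C t \<Longrightarrow> Cod C f = t"
  and into_I: "f \<in> Arr C \<Longrightarrow> f \<in> into C (Cod C f)"
  by (simp_all add: into_def)

lemma into_Dom: "is_cat C \<Longrightarrow> f \<in> into C t \<Longrightarrow> Dom C f \<in> Ob C"
  and into_Ob: "is_cat C \<Longrightarrow> f \<in> into C t \<Longrightarrow> t \<in> Ob C"
  by (auto simp: into_def cat_Dom cat_Cod)

lemma into_Idn: "is_cat C \<Longrightarrow> t \<in> Ob C \<Longrightarrow> Idn C t \<in> into C t"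
  and Dom_Idn: "is_cat C \<Longrightarrow> t \<in> Ob C \<Longrightarrow> Dom C (Idn C t) = t"
  by (simp_all add: is_cat_def into_def)

lemma into_Cmp: "is_cat C \<Longrightarrow> f \<in> into C t \<Longrightarrow> g \<in> into C (Dom C f) \<Longrightarrow> Cmp C f g \<in> into C t"
  and Dom_Cmp: "is_cat C \<Longrightarrow> f \<in> into C t \<Longrightarrow> g \<in> into C (Dom C f) \<Longrightarrow> Dom C (Cmp C f g) = Dom C g"
  by (simp_all add: is_cat_def into_def)

lemma Cmp_Idn_right: "is_cat C \<Longrightarrow> f \<in> into C t \<Longrightarrow> Cmp C f (Idn C (Dom C f)) = f"
  and Cmp_Idn_left: "is_cat C \<Longrightarrow> f \<in> into C t \<Longrightarrow> Cmp C (Idn C t) f = f"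
  by (auto simp: is_cat_def into_def)

lemma Cmp_assoc:
  assumes C: "is_cat C" and "f \<in> into C t" "g \<in> into C (Dom C f)" "h \<in> into C (Dom C g)"
  shows "Cmp C (Cmp C f g) h = Cmp C f (Cmp C g h)"
proof -
  have "\<forall>f\<in>Arr C. \<forall>g\<in>Arr C. \<forall>h\<in>Arr C. Cod C f = Dom C g \<and> Cod C g = Dom C h \<longrightarrow>
      Cmp C h (Cmp C g f) = Cmp C (Cmp C h g) f"
    using C unfolding is_cat_def by (elim conjE)
  from this[rule_format, of h g f] show ?thesis using assms(2-) by (simp add: into_def)
qed

text \<open>A covering sieve is transported to another object by \<open>pull\<close>, and \<open>super\<close> then replaces it by a
  sieve that is easier to describe; for a Grothendieck topology \<open>super\<close> follows from transitivity.\<close>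

locale site =
  fixes C :: "('o, 'a, 'm) cat_scheme" and J :: "'o \<Rightarrow> 'a set set"
  assumes cat: "is_cat C"
    and sieve: "R \<in> J t \<Longrightarrow> is_sieve C t R"
    and pull: "R \<in> J t \<Longrightarrow> f \<in> into C t \<Longrightarrow> sieve_pull C f R \<in> J (Dom C f)"
    and super: "R \<in> J t \<Longrightarrow> R \<subseteq> R' \<Longrightarrow> is_sieve C t R' \<Longrightarrow> R' \<in> J t"

lemma is_sieve_into: "is_cat C \<Longrightarrow> is_sieve C t (into C t)"
  by (simp add: is_sieve_def into_Cmp)

lemma is_sieve_gen:
  assumes C: "is_cat C" and F: "F \<subseteq> into C t"
  shows "is_sieve C t (sieve_gen C F)"
  unfolding is_sieve_def
proof (intro conjI ballI)
  show "sieve_gen C F \<subseteq> into C t"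
    unfolding sieve_gen_def using F into_Cmp[OF C] by blast
  fix f g assume "f \<in> sieve_gen C F" and g: "g \<in> into C (Dom C f)"
  then obtain u k where u: "u \<in> F" "k \<in> into C (Dom C u)" "f = Cmp C u k"
    unfolding sieve_gen_def by blast
  have ut: "u \<in> into C t" using u F by blast
  have g': "g \<in> into C (Dom C k)" using g Dom_Cmp[OF C ut u(2)] u(3) by simp
  have "Cmp C f g = Cmp C u (Cmp C k g)" using Cmp_assoc[OF C ut u(2) g'] u(3) by simp
  then show "Cmp C f g \<in> sieve_gen C F"
    unfolding sieve_gen_def using u into_Cmp[OF C u(2) g'] by blast
qed

lemma is_sieve_pull:
  assumes C: "is_cat C" and R: "is_sieve C t R" and f: "f \<in> into C t"
  shows "is_sieve C (Dom C f) (sieve_pull C f R)"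
  unfolding is_sieve_def
proof (intro conjI ballI)
  show "sieve_pull C f R \<subseteq> into C (Dom C f)" unfolding sieve_pull_def by blast
  fix g h assume "g \<in> sieve_pull C f R" and h: "h \<in> into C (Dom C g)"
  then have g: "g \<in> into C (Dom C f)" "Cmp C f g \<in> R" unfolding sieve_pull_def by auto
  have "Cmp C (Cmp C f g) h \<in> R"
    using R g h Dom_Cmp[OF C f g(1)] unfolding is_sieve_def by simp
  then show "Cmp C g h \<in> sieve_pull C f R"
    unfolding sieve_pull_def using Cmp_assoc[OF C f g(1) h] into_Cmp[OF C g(1) h] by simp
qed

text \<open>A sieve that contains a covering sieve \<open>R\<close> pulls back to the maximal sieve along every member of
  \<open>R\<close>, so it covers by transitivity.\<close>

lemma site_gen_covering:
  assumes C: "is_cat C" and Cov: "\<And>U F. F \<in> Cov U \<Longrightarrow> F \<subseteq> into C U"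
  shows "site C (\<lambda>U. {R. gen_covering C Cov U R})"
proof
  have s: "is_sieve C t R" if "gen_covering C Cov t R" for R t
    using that
  proof induction
    case (base U F) then show ?case using is_sieve_gen[OF C] Cov by blast
  next
    case (maximal U) then show ?case using is_sieve_into[OF C] by blast
  next
    case (stable U R f) then show ?case using is_sieve_pull[OF C] by blast
  qed
  then show "is_sieve C t R" if "R \<in> {R. gen_covering C Cov t R}" for R t using that by blast
  show "sieve_pull C f R \<in> {R. gen_covering C Cov (Dom C f) R}"
    if "R \<in> {R. gen_covering C Cov t R}" "f \<in> into C t" for R f t
    using that gen_covering.stable by auto
  show "R' \<in> {R. gen_covering C Cov t R}"
    if "R \<in> {R. gen_covering C Cov t R}" "R \<subseteq> R'" and R': "is_sieve C t R'" for R R' t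
  proof -
    have "gen_covering C Cov (Dom C f) (sieve_pull C f R')" if "f \<in> R" for f
    proof -
      have f: "f \<in> into C t" using \<open>f \<in> R\<close> \<open>R \<subseteq> R'\<close> R' unfolding is_sieve_def by blast
      have "sieve_pull C f R' = into C (Dom C f)"
        using \<open>f \<in> R\<close> \<open>R \<subseteq> R'\<close> R' unfolding is_sieve_def sieve_pull_def by blast
      then show ?thesis using gen_covering.maximal into_Dom[OF C f] by metis
    qed
    then show ?thesis using that gen_covering.transitive by fast
  qed
qed (rule C)

lemma Sch_site: "site (Sch \<UU> S) (Sch_top \<tau> \<UU> S)"
proof -
  have "Sch_top \<tau> \<UU> S = (\<lambda>U. {R. gen_covering (Sch \<UU> S) (tau_families \<tau> \<UU> S) U R})"
    by (simp add: Sch_top_def fun_eq_iff)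
  moreover have "F \<subseteq> into (Sch \<UU> S) U" if "F \<in> tau_families \<tau> \<UU> S U" for U F
    using that by (simp add: tau_families_def)
  ultimately show ?thesis using site_gen_covering[OF Sch_is_cat] by metis
qed

locale fibred_category =
  fixes C :: "('bo, 'ba) cat" and T :: "('o, 'a, 'bo, 'ba) fib"
  assumes base: "is_cat C" and fibred: "fibred_in_groupoids C T"
begin

lemma cat: "is_cat T"
  using fibred by (simp add: fibred_in_groupoids_def)

lemma str_fctr: "is_fctr T C (str T)"
  using fibred by (simp add: fibred_in_groupoids_def)

lemma pr_Ob: "t \<in> Ob T \<Longrightarrow> prO T t \<in> Ob C"
  and pr_Idn: "t \<in> Ob T \<Longrightarrow> prA T (Idn T t) = Idn C (prO T t)"
  and pr_Arr: "\<phi> \<in> Arr T \<Longrightarrow> prA T \<phi> \<in> Arr C"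
  and pr_Dom: "\<phi> \<in> Arr T \<Longrightarrow> Dom C (prA T \<phi>) = prO T (Dom T \<phi>)"
  and pr_Cod: "\<phi> \<in> Arr T \<Longrightarrow> Cod C (prA T \<phi>) = prO T (Cod T \<phi>)"
  using str_fctr by (simp_all add: is_fctr_def str_def)

lemma pr_into: "\<phi> \<in> into T t \<Longrightarrow> prA T \<phi> \<in> into C (prO T t)"
  by (auto simp: into_def pr_Arr pr_Cod)

lemma pr_Dom_into: "\<phi> \<in> into T t \<Longrightarrow> Dom C (prA T \<phi>) = prO T (Dom T \<phi>)"
  by (auto simp: into_def pr_Dom)

lemma pr_Cmp:
  "\<phi> \<in> into T t \<Longrightarrow> \<psi> \<in> into T (Dom T \<phi>) \<Longrightarrow> prA T (Cmp T \<phi> \<psi>) = Cmp C (prA T \<phi>) (prA T \<psi>)"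
  using str_fctr by (simp add: is_fctr_def str_def into_def)

lemma lift:
  assumes "t \<in> Ob T" "f \<in> into C (prO T t)"
  obtains \<phi> where "\<phi> \<in> into T t" "prA T \<phi> = f"
  using fibred assms unfolding fibred_in_groupoids_def by blast

lemma unique_factor:
  assumes "\<phi> \<in> into T t" "\<psi> \<in> into T t" "h \<in> Arr C" "Dom C h = prO T (Dom T \<psi>)"
    "Cod C h = prO T (Dom T \<phi>)" "Cmp C (prA T \<phi>) h = prA T \<psi>"
  shows "\<exists>!\<chi>. \<chi> \<in> Arr T \<and> Dom T \<chi> = Dom T \<psi> \<and> Cod T \<chi> = Dom T \<phi> \<and>
               Cmp T \<phi> \<chi> = \<psi> \<and> prA T \<chi> = h"
proof -
  have "t \<in> Ob T" using into_Ob[OF cat assms(1)] .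
  then show ?thesis using fibred assms unfolding fibred_in_groupoids_def by blast
qed

lemma factor:
  assumes "\<phi> \<in> into T t" "\<psi> \<in> into T t" "h \<in> Arr C" "Dom C h = prO T (Dom T \<psi>)"
    "Cod C h = prO T (Dom T \<phi>)" "Cmp C (prA T \<phi>) h = prA T \<psi>"
  obtains \<chi> where "\<chi> \<in> into T (Dom T \<phi>)" "Dom T \<chi> = Dom T \<psi>" "Cmp T \<phi> \<chi> = \<psi>" "prA T \<chi> = h"
  using ex1_implies_ex[OF unique_factor[OF assms]] unfolding into_def by blast

text \<open>Uniqueness in the universal property of a cartesian arrow \<open>\<phi>\<close>.\<close>

lemma cancel:
  assumes \<phi>: "\<phi> \<in> into T t" and \<chi>: "\<chi> \<in> into T (Dom T \<phi>)" and \<chi>': "\<chi>' \<in> into T (Dom T \<phi>)"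
    and D: "Dom T \<chi> = Dom T \<chi>'" and pr: "prA T \<chi> = prA T \<chi>'" and eq: "Cmp T \<phi> \<chi> = Cmp T \<phi> \<chi>'"
  shows "\<chi> = \<chi>'"
proof -
  have "\<exists>!\<kappa>. \<kappa> \<in> Arr T \<and> Dom T \<kappa> = Dom T (Cmp T \<phi> \<chi>) \<and> Cod T \<kappa> = Dom T \<phi> \<and>
      Cmp T \<phi> \<kappa> = Cmp T \<phi> \<chi> \<and> prA T \<kappa> = prA T \<chi>"
    by (rule unique_factor[OF \<phi> into_Cmp[OF cat \<phi> \<chi>]])
      (use into_Arr[OF \<chi>] into_Cod[OF \<chi>] in
        \<open>simp_all add: pr_Arr pr_Dom pr_Cod Dom_Cmp[OF cat \<phi> \<chi>] pr_Cmp[OF \<phi> \<chi>]\<close>)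
  moreover have "Dom T (Cmp T \<phi> \<chi>) = Dom T \<chi>" by (rule Dom_Cmp[OF cat \<phi> \<chi>])
  ultimately show ?thesis
    using \<chi> \<chi>' D pr eq unfolding into_def by auto
qed

text \<open>Two arrows into \<open>t\<close> over the same arrow of the base differ by a vertical isomorphism of their
  sources.\<close>

lemma vertical_factor:
  assumes \<phi>: "\<phi> \<in> into T t" and \<psi>: "\<psi> \<in> into T t" and eq: "prA T \<phi> = prA T \<psi>"
  obtains \<chi> where "\<chi> \<in> into T (Dom T \<phi>)" "Dom T \<chi> = Dom T \<psi>" "Cmp T \<phi> \<chi> = \<psi>"
    "prA T \<chi> = Idn C (prO T (Dom T \<phi>))"
proof -
  have D: "prO T (Dom T \<psi>) = prO T (Dom T \<phi>)"
    using eq pr_Dom_into[OF \<phi>] pr_Dom_into[OF \<psi>] by simp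
  have o: "prO T (Dom T \<phi>) \<in> Ob C" using pr_Ob into_Dom[OF cat \<phi>] by blast
  show thesis
    by (rule factor[OF \<phi> \<psi>, of "Idn C (prO T (Dom T \<phi>))"])
      (use into_Idn[OF base o] Dom_Idn[OF base o] D eq Cmp_Idn_right[OF base pr_into[OF \<phi>]]
         pr_Dom_into[OF \<phi>] that in \<open>auto simp: into_def\<close>)
qed

end

section \<open>Torsors\<close>

text \<open>The covering sieves are an arbitrary collection of sieves, so that the same facts serve the base
  and the coverings inherited by a fibred category.\<close>

locale torsor =
  fixes T :: "('o, 'a, 'm) cat_scheme" and J :: "'o \<Rightarrow> 'a set set"
    and G :: "('o, 'a, 'g) gpsh" and P :: "('o, 'a, 'v, 'g) rpsh"
  assumes cat: "is_cat T"
    and sieve: "R \<in> J t \<Longrightarrow> is_sieve T t R"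
    and group_grp: "t \<in> Ob T \<Longrightarrow> group (grp G t)"
    and gres_hom: "\<phi> \<in> Arr T \<Longrightarrow> gres G \<phi> \<in> hom (grp G (Cod T \<phi>)) (grp G (Dom T \<phi>))"
    and is_torsor: "is_torsor T J G P"
begin

lemma is_sheaf: "is_sheaf T J P"
  using is_torsor by (simp add: is_torsor_def)

lemma is_presheaf: "is_presheaf T P"
  using is_sheaf by (simp add: is_sheaf_def)

lemma sieve_into: "R \<in> J t \<Longrightarrow> \<phi> \<in> R \<Longrightarrow> \<phi> \<in> into T t"
  using sieve unfolding is_sieve_def by blast

lemma sieve_Cmp: "R \<in> J t \<Longrightarrow> \<phi> \<in> R \<Longrightarrow> \<psi> \<in> into T (Dom T \<phi>) \<Longrightarrow> Cmp T \<phi> \<psi> \<in> R"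
  using sieve unfolding is_sieve_def by blast

lemma gres_closed:
  "\<phi> \<in> into T t \<Longrightarrow> g \<in> carrier (grp G t) \<Longrightarrow> gres G \<phi> g \<in> carrier (grp G (Dom T \<phi>))"
  using gres_hom by (auto simp: into_def dest: hom_in_carrier)

lemma res_closed: "\<phi> \<in> into T t \<Longrightarrow> v \<in> sec P t \<Longrightarrow> res P \<phi> v \<in> sec P (Dom T \<phi>)"
  using is_presheaf unfolding is_presheaf_def into_def by blast

lemma res_Idn: "t \<in> Ob T \<Longrightarrow> v \<in> sec P t \<Longrightarrow> res P (Idn T t) v = v"
  using is_presheaf unfolding is_presheaf_def by blast

lemma res_Cmp:
  "\<phi> \<in> into T t \<Longrightarrow> \<psi> \<in> into T (Dom T \<phi>) \<Longrightarrow> v \<in> sec P t \<Longrightarrow>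
    res P (Cmp T \<phi> \<psi>) v = res P \<psi> (res P \<phi> v)"
  using is_presheaf unfolding is_presheaf_def into_def by blast

lemma act_one: "t \<in> Ob T \<Longrightarrow> v \<in> sec P t \<Longrightarrow> ract P t v \<one>\<^bsub>grp G t\<^esub> = v"
  using is_torsor by (simp add: is_torsor_def)

lemma act_closed:
  "t \<in> Ob T \<Longrightarrow> v \<in> sec P t \<Longrightarrow> g \<in> carrier (grp G t) \<Longrightarrow> ract P t v g \<in> sec P t"
  using is_torsor by (simp add: is_torsor_def)

lemma act_mult:
  "t \<in> Ob T \<Longrightarrow> v \<in> sec P t \<Longrightarrow> g \<in> carrier (grp G t) \<Longrightarrow> h \<in> carrier (grp G t) \<Longrightarrow>
    ract P t (ract P t v g) h = ract P t v (g \<otimes>\<^bsub>grp G t\<^esub> h)"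
  using is_torsor by (simp add: is_torsor_def)

lemma res_act:
  "\<phi> \<in> into T t \<Longrightarrow> v \<in> sec P t \<Longrightarrow> g \<in> carrier (grp G t) \<Longrightarrow>
    res P \<phi> (ract P t v g) = ract P (Dom T \<phi>) (res P \<phi> v) (gres G \<phi> g)"
  using is_torsor by (auto simp: is_torsor_def into_def)

lemma difference:
  assumes "t \<in> Ob T" "v \<in> sec P t" "w \<in> sec P t"
  shows "\<exists>!g. g \<in> carrier (grp G t) \<and> ract P t v g = w"
  using is_torsor assms by (simp add: is_torsor_def)

lemma transitive:
  assumes "t \<in> Ob T" "v \<in> sec P t" "w \<in> sec P t"
  obtains g where "g \<in> carrier (grp G t)" "w = ract P t v g"
  using difference[OF assms] by blast

lemma free:
  assumes "t \<in> Ob T" "v \<in> sec P t" "g \<in> carrier (grp G t)" "h \<in> carrier (grp G t)"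
    "ract P t v g = ract P t v h"
  shows "g = h"
  using difference[OF assms(1,2) act_closed[OF assms(1,2,4)]] assms(3-5) by blast

lemma locally_nonempty:
  assumes "t \<in> Ob T"
  obtains R where "R \<in> J t" "\<And>\<phi>. \<phi> \<in> R \<Longrightarrow> sec P (Dom T \<phi>) \<noteq> {}"
proof -
  have "\<forall>t\<in>Ob T. \<exists>R\<in>J t. \<forall>\<phi>\<in>R. sec P (Dom T \<phi>) \<noteq> {}"
    using is_torsor unfolding is_torsor_def by (elim conjE)
  then show thesis using assms that by blast
qed

lemma glue:
  assumes "t \<in> Ob T" "R \<in> J t" "\<And>\<phi>. \<phi> \<in> R \<Longrightarrow> s \<phi> \<in> sec P (Dom T \<phi>)"
    "\<And>\<phi> \<psi>. \<phi> \<in> R \<Longrightarrow> \<psi> \<in> into T (Dom T \<phi>) \<Longrightarrow> res P \<psi> (s \<phi>) = s (Cmp T \<phi> \<psi>)"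
  shows "\<exists>!v. v \<in> sec P t \<and> (\<forall>\<phi>\<in>R. res P \<phi> v = s \<phi>)"
proof -
  have "\<forall>t\<in>Ob T. \<forall>R\<in>J t. \<forall>s. (\<forall>\<phi>\<in>R. s \<phi> \<in> sec P (Dom T \<phi>)) \<and>
        (\<forall>\<phi>\<in>R. \<forall>\<psi>\<in>into T (Dom T \<phi>). res P \<psi> (s \<phi>) = s (Cmp T \<phi> \<psi>)) \<longrightarrow>
        (\<exists>!v. v \<in> sec P t \<and> (\<forall>\<phi>\<in>R. res P \<phi> v = s \<phi>))"
    using is_sheaf unfolding is_sheaf_def by (elim conjE)
  from this[rule_format, OF assms(1,2)] assms(3,4) show ?thesis by blast
qed

lemma separated:
  assumes t: "t \<in> Ob T" and R: "R \<in> J t" and v: "v \<in> sec P t" and w: "w \<in> sec P t"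
    and eq: "\<And>\<phi>. \<phi> \<in> R \<Longrightarrow> res P \<phi> v = res P \<phi> w"
  shows "v = w"
proof -
  have "\<exists>!u. u \<in> sec P t \<and> (\<forall>\<phi>\<in>R. res P \<phi> u = res P \<phi> v)"
    by (rule glue[OF t R]) (use sieve_into[OF R] res_closed v res_Cmp[of _ t] in auto)
  with v w eq show ?thesis by metis
qed

end

text \<open>For the base fibred over itself, images of sieves and pulled back groups are the original ones.\<close>

lemma torsor_over_base_fib:
  "torsor_over J G (base_fib C) P \<longleftrightarrow> is_torsor C (\<lambda>t. {R \<in> J t. is_sieve C t R}) G P"
proof -
  have G: "pull_gpsh (str (base_fib C)) G = G"
    by (simp add: pull_gpsh_def str_def base_fib_def)
  have J: "inherit J (base_fib C) = (\<lambda>t. {R \<in> J t. is_sieve C t R})"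
    by (auto simp: inherit_def base_fib_def is_sieve_def into_def fun_eq_iff)
  have "is_torsor (base_fib C) J' G P \<longleftrightarrow> is_torsor C J' G P" for J'
    by (simp add: is_torsor_def is_sheaf_def is_presheaf_def into_def base_fib_def)
  then show ?thesis by (simp add: torsor_over_def G J)
qed

text \<open>Torsors pull back along the structure functor: over a sieve \<open>R\<close> of \<open>t\<close> a matching family of
  sections only depends on the image of \<open>R\<close> in the base, because arrows with the same image differ
  by a vertical arrow and restriction along vertical arrows is the identity.\<close>

lemma (in fibred_category) torsor_pull:
  assumes J: "\<And>R t. R \<in> J t \<Longrightarrow> is_sieve C t R"
    and G: "is_group_sheaf C J G" and P: "is_torsor C J G P"
  shows "torsor T (inherit J T) (pull_gpsh (str T) G) (pull_torsor (str T) P)"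
proof -
  interpret P: torsor C J G P
    using base J G P by (intro torsor.intro) (auto simp: is_group_sheaf_def)
  let ?Q = "pull_torsor (str T) P"
  have sel [simp]: "sec ?Q t = sec P (prO T t)" "res ?Q \<phi> = res P (prA T \<phi>)"
    "ract ?Q t = ract P (prO T t)" "grp (pull_gpsh (str T) G) t = grp G (prO T t)"
    "gres (pull_gpsh (str T) G) \<phi> = gres G (prA T \<phi>)" for t \<phi>
    by (simp_all add: pull_torsor_def pull_gpsh_def str_def)
  have presheaf: "is_presheaf T ?Q"
    unfolding is_presheaf_def
  proof (intro conjI ballI)
    fix \<phi> assume \<phi>: "\<phi> \<in> Arr T"
    show "res ?Q \<phi> \<in> sec ?Q (Cod T \<phi>) \<rightarrow> sec ?Q (Dom T \<phi>)"
      using P.res_closed[OF pr_into[OF into_I[OF \<phi>]]] by (simp add: pr_Dom[OF \<phi>])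
    fix \<psi> s assume "\<psi> \<in> into T (Dom T \<phi>)" "s \<in> sec ?Q (Cod T \<phi>)"
    then show "res ?Q (Cmp T \<phi> \<psi>) s = res ?Q \<psi> (res ?Q \<phi> s)"
      using P.res_Cmp[OF pr_into[OF into_I[OF \<phi>]], of "prA T \<psi>" s] pr_into[of \<psi>]
      by (simp add: pr_Cmp[OF into_I[OF \<phi>]] pr_Dom[OF \<phi>])
  next
    fix t s assume "t \<in> Ob T" "s \<in> sec ?Q t"
    then show "res ?Q (Idn T t) s = s" using P.res_Idn[OF pr_Ob] by (simp add: pr_Idn)
  qed
  have gluing: "\<exists>!v. v \<in> sec ?Q t \<and> (\<forall>\<phi>\<in>R. res ?Q \<phi> v = s \<phi>)"
    if t: "t \<in> Ob T" and R: "R \<in> inherit J T t" and s: "\<And>\<phi>. \<phi> \<in> R \<Longrightarrow> s \<phi> \<in> sec ?Q (Dom T \<phi>)"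
      and comp: "\<And>\<phi> \<psi>. \<phi> \<in> R \<Longrightarrow> \<psi> \<in> into T (Dom T \<phi>) \<Longrightarrow> res ?Q \<psi> (s \<phi>) = s (Cmp T \<phi> \<psi>)"
    for t R s
  proof -
    from R have sv: "is_sieve T t R" and im: "prA T ` R \<in> J (prO T t)" by (auto simp: inherit_def)
    have into: "\<phi> \<in> into T t" if "\<phi> \<in> R" for \<phi> using sv that unfolding is_sieve_def by blast
    have eq: "s \<phi> = s \<psi>" if r: "\<phi> \<in> R" "\<psi> \<in> R" and e: "prA T \<phi> = prA T \<psi>" for \<phi> \<psi>
    proof -
      obtain \<chi> where \<chi>: "\<chi> \<in> into T (Dom T \<phi>)" "Dom T \<chi> = Dom T \<psi>" "Cmp T \<phi> \<chi> = \<psi>"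
        "prA T \<chi> = Idn C (prO T (Dom T \<phi>))"
        by (rule vertical_factor[OF into[OF r(1)] into[OF r(2)] e])
      then show ?thesis
        using comp[OF r(1) \<chi>(1)] P.res_Idn[OF pr_Ob[OF into_Dom[OF cat into[OF r(1)]]]] s[OF r(1)]
        by simp
    qed
    \<comment> \<open>The family on the image of \<open>R\<close>; by the previous fact the chosen preimage is immaterial.\<close>
    define s' where "s' f = s (SOME \<phi>. \<phi> \<in> R \<and> prA T \<phi> = f)" for f
    have s': "s' (prA T \<phi>) = s \<phi>" if "\<phi> \<in> R" for \<phi>
      unfolding s'_def using someI[of "\<lambda>\<psi>. \<psi> \<in> R \<and> prA T \<psi> = prA T \<phi>" \<phi>] that eq by metis
    have "\<exists>!v. v \<in> sec P (prO T t) \<and> (\<forall>f \<in> prA T ` R. res P f v = s' f)"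
    proof (rule P.glue[OF pr_Ob[OF t] im])
      fix f assume "f \<in> prA T ` R"
      then obtain \<phi> where \<phi>: "\<phi> \<in> R" "f = prA T \<phi>" by blast
      show "s' f \<in> sec P (Dom C f)"
        using s[OF \<phi>(1)] by (simp add: \<phi>(2) s'[OF \<phi>(1)] pr_Dom_into[OF into[OF \<phi>(1)]])
      fix k assume k: "k \<in> into C (Dom C f)"
      obtain \<psi> where \<psi>: "\<psi> \<in> into T (Dom T \<phi>)" "prA T \<psi> = k"
        by (rule lift[OF into_Dom[OF cat into[OF \<phi>(1)]], of k])
          (use k \<phi> pr_Dom_into[OF into[OF \<phi>(1)]] in auto)
      have "Cmp T \<phi> \<psi> \<in> R" using sv \<phi>(1) \<psi>(1) unfolding is_sieve_def by blast
      then show "res P k (s' f) = s' (Cmp C f k)"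
        using comp[OF \<phi>(1) \<psi>(1)] s'[OF \<phi>(1)] s'[of "Cmp T \<phi> \<psi>"] pr_Cmp[OF into[OF \<phi>(1)] \<psi>(1)]
        by (simp add: \<phi>(2) \<psi>(2))
    qed
    then show ?thesis using s' by auto
  qed
  have sheaf: "is_sheaf T (inherit J T) ?Q"
    unfolding is_sheaf_def
  proof (intro conjI ballI allI impI presheaf)
    fix t R s assume "t \<in> Ob T" "R \<in> inherit J T t"
      "(\<forall>\<phi>\<in>R. s \<phi> \<in> sec ?Q (Dom T \<phi>)) \<and>
        (\<forall>\<phi>\<in>R. \<forall>\<psi>\<in>into T (Dom T \<phi>). res ?Q \<psi> (s \<phi>) = s (Cmp T \<phi> \<psi>))"
    then show "\<exists>!v. v \<in> sec ?Q t \<and> (\<forall>\<phi>\<in>R. res ?Q \<phi> v = s \<phi>)" using gluing by blast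
  qed
  have "\<exists>R\<in>inherit J T t. \<forall>\<phi>\<in>R. sec ?Q (Dom T \<phi>) \<noteq> {}" if t: "t \<in> Ob T" for t
  proof -
    obtain R where R: "R \<in> J (prO T t)" "\<And>f. f \<in> R \<Longrightarrow> sec P (Dom C f) \<noteq> {}"
      using P.locally_nonempty[OF pr_Ob[OF t]] by blast
    let ?R = "{\<phi> \<in> into T t. prA T \<phi> \<in> R}"
    have "is_sieve T t ?R"
      unfolding is_sieve_def
      using P.sieve_Cmp[OF R(1)] into_Cmp[OF cat] pr_Cmp pr_into pr_Dom_into by auto
    moreover have "prA T ` ?R = R"
      using P.sieve_into[OF R(1)] lift[OF t] by (auto simp: image_iff) metis
    ultimately have "?R \<in> inherit J T t" using R(1) by (simp add: inherit_def)
    moreover have "\<forall>\<phi>\<in>?R. sec ?Q (Dom T \<phi>) \<noteq> {}" using R(2) pr_Dom_into by fastforce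
    ultimately show ?thesis by blast
  qed
  then have "is_torsor T (inherit J T) (pull_gpsh (str T) G) ?Q"
    unfolding is_torsor_def
    using sheaf P.act_one P.act_closed P.act_mult P.res_act[OF pr_into[OF into_I]] P.difference pr_Ob
    by (auto simp: pr_Dom)
  then show ?thesis
    using cat P.group_grp[OF pr_Ob] P.gres_hom[OF pr_Arr]
    by (intro torsor.intro) (auto simp: inherit_def pr_Dom pr_Cod)
qed

section \<open>Gluing isomorphisms between two torsors\<close>

locale torsor_pair = P: torsor T J G P + Q: torsor T J G Q
  for T :: "('o, 'a, 'm) cat_scheme" and J and G :: "('o, 'a, 'g) gpsh"
    and P :: "('o, 'a, 'v, 'g) rpsh" and Q :: "('o, 'a, 'w, 'g) rpsh"
begin

text \<open>The orbit of \<open>(y, z)\<close> under the diagonal action.  As \<open>G\<close> acts simply transitively on either side,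
  it is the graph of the equivariant bijection that maps \<open>y\<close> to \<open>z\<close>.\<close>

definition orb :: "'o \<Rightarrow> 'v \<Rightarrow> 'w \<Rightarrow> ('v \<times> 'w) set" where
  "orb t y z = {(ract P t y g, ract Q t z g) | g. g \<in> carrier (grp G t)}"

lemma orb_self:
  assumes "t \<in> Ob T" "y \<in> sec P t" "z \<in> sec Q t"
  shows "(y, z) \<in> orb t y z"
proof -
  interpret group "grp G t" by (rule P.group_grp[OF assms(1)])
  show ?thesis unfolding orb_def using P.act_one Q.act_one assms one_closed by force
qed

lemma orb_act:
  assumes t: "t \<in> Ob T" and y: "y \<in> sec P t" and z: "z \<in> sec Q t" and g: "g \<in> carrier (grp G t)"
  shows "orb t (ract P t y g) (ract Q t z g) = orb t y z"
proof -
  interpret group "grp G t" by (rule P.group_grp[OF t])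
  have "orb t (ract P t y g) (ract Q t z g)
      = (\<lambda>h. (ract P t y h, ract Q t z h)) ` ((\<lambda>h. g \<otimes>\<^bsub>grp G t\<^esub> h) ` carrier (grp G t))"
    unfolding orb_def using P.act_mult[OF t y g] Q.act_mult[OF t z g] by force
  also have "(\<lambda>h. g \<otimes>\<^bsub>grp G t\<^esub> h) ` carrier (grp G t) = carrier (grp G t)"
    using g surj_const_mult by blast
  finally show ?thesis unfolding orb_def by blast
qed

lemma orb_eqD:
  assumes t: "t \<in> Ob T" and "y' \<in> sec P t" "z' \<in> sec Q t" and "orb t y z = orb t y' z'"
  obtains g where "g \<in> carrier (grp G t)" "y' = ract P t y g" "z' = ract Q t z g"
proof -
  have "(y', z') \<in> orb t y z" using orb_self[OF assms(1-3)] assms(4) by simp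
  then show thesis using that unfolding orb_def by auto
qed

text \<open>The group element that carries \<open>(y, z)\<close> to \<open>(y, z')\<close> fixes \<open>y\<close>, hence is trivial.\<close>

lemma orb_fst_eq:
  assumes t: "t \<in> Ob T" and "y \<in> sec P t" "z \<in> sec Q t" "z' \<in> sec Q t" "orb t y z = orb t y z'"
  shows "z = z'"
proof -
  interpret group "grp G t" by (rule P.group_grp[OF t])
  obtain g where g: "g \<in> carrier (grp G t)" "y = ract P t y g" "z' = ract Q t z g"
    by (rule orb_eqD[OF t assms(2,4,5)])
  have "g = \<one>\<^bsub>grp G t\<^esub>"
    by (rule P.free[OF t assms(2) g(1) one_closed]) (simp add: g(2)[symmetric] P.act_one[OF t assms(2)])
  then show ?thesis using g(3) Q.act_one[OF t assms(3)] by simp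
qed

text \<open>Restriction is equivariant and so maps an orbit into a single orbit; the union on the left, which
  is how restriction of orbits is defined, has equal members.\<close>

lemma orb_res:
  assumes \<phi>: "\<phi> \<in> into T t" and y: "y \<in> sec P t" and z: "z \<in> sec Q t"
  shows "(\<Union>(y', z')\<in>orb t y z. orb (Dom T \<phi>) (res P \<phi> y') (res Q \<phi> z'))
    = orb (Dom T \<phi>) (res P \<phi> y) (res Q \<phi> z)"
proof (rule SUP_eq_const)
  show "orb t y z \<noteq> {}" using orb_self[OF into_Ob[OF P.cat \<phi>] y z] by blast
  fix p assume "p \<in> orb t y z"
  then obtain g where "g \<in> carrier (grp G t)" "p = (ract P t y g, ract Q t z g)"
    unfolding orb_def by blast
  then show "(case p of (y', z') \<Rightarrow> orb (Dom T \<phi>) (res P \<phi> y') (res Q \<phi> z'))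
      = orb (Dom T \<phi>) (res P \<phi> y) (res Q \<phi> z)"
    using orb_act[OF into_Dom[OF P.cat \<phi>] P.res_closed[OF \<phi> y] Q.res_closed[OF \<phi> z] P.gres_closed[OF \<phi>]]
    by (simp add: P.res_act[OF \<phi> y] Q.res_act[OF \<phi> z])
qed

text \<open>\<open>K\<close> is, over each member of a covering sieve, the graph of an isomorphism between the two
  torsors: it is single valued, and total because it is non-empty and stable under the transitive
  action.  So \<open>y\<close> has a unique image locally.  Uniqueness makes these images compatible, and they glue
  in the sheaf \<open>Q\<close>.\<close>

lemma graph_glue:
  assumes t: "t \<in> Ob T" and R: "R \<in> J t"
    and sub: "\<And>\<phi>. \<phi> \<in> R \<Longrightarrow> K \<phi> \<subseteq> sec P (Dom T \<phi>) \<times> sec Q (Dom T \<phi>)"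
    and ne: "\<And>\<phi>. \<phi> \<in> R \<Longrightarrow> K \<phi> \<noteq> {}"
    and act: "\<And>\<phi> y z g. \<phi> \<in> R \<Longrightarrow> (y, z) \<in> K \<phi> \<Longrightarrow> g \<in> carrier (grp G (Dom T \<phi>)) \<Longrightarrow>
      (ract P (Dom T \<phi>) y g, ract Q (Dom T \<phi>) z g) \<in> K \<phi>"
    and func: "\<And>\<phi> y z z'. \<phi> \<in> R \<Longrightarrow> (y, z) \<in> K \<phi> \<Longrightarrow> (y, z') \<in> K \<phi> \<Longrightarrow> z = z'"
    and restr: "\<And>\<phi> \<psi> y z. \<phi> \<in> R \<Longrightarrow> \<psi> \<in> into T (Dom T \<phi>) \<Longrightarrow> (y, z) \<in> K \<phi> \<Longrightarrow>
      (res P \<psi> y, res Q \<psi> z) \<in> K (Cmp T \<phi> \<psi>)"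
    and y: "y \<in> sec P t"
  shows "\<exists>!z. z \<in> sec Q t \<and> (\<forall>\<phi>\<in>R. (res P \<phi> y, res Q \<phi> z) \<in> K \<phi>)"
proof -
  note into = P.sieve_into[OF R]
  define s where "s \<phi> = (THE z. (res P \<phi> y, z) \<in> K \<phi>)" for \<phi>
  have s: "(res P \<phi> y, s \<phi>) \<in> K \<phi>" if \<phi>: "\<phi> \<in> R" for \<phi>
  proof -
    note o = into_Dom[OF P.cat into[OF \<phi>]]
    obtain y' z' where K: "(y', z') \<in> K \<phi>" using ne[OF \<phi>] by auto
    then have m: "y' \<in> sec P (Dom T \<phi>)" "z' \<in> sec Q (Dom T \<phi>)" using sub[OF \<phi>] by auto
    obtain g where "g \<in> carrier (grp G (Dom T \<phi>))" "res P \<phi> y = ract P (Dom T \<phi>) y' g"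
      by (rule P.transitive[OF o m(1) P.res_closed[OF into[OF \<phi>] y]])
    then have "(res P \<phi> y, ract Q (Dom T \<phi>) z' g) \<in> K \<phi>" using act[OF \<phi> K] by simp
    then show ?thesis unfolding s_def using func[OF \<phi>] by (metis theI)
  qed
  have s_unique: "z = s \<phi>" if "\<phi> \<in> R" "(res P \<phi> y, z) \<in> K \<phi>" for \<phi> z
    using func[OF that(1) that(2) s[OF that(1)]] .
  have "\<exists>!z. z \<in> sec Q t \<and> (\<forall>\<phi>\<in>R. res Q \<phi> z = s \<phi>)"
  proof (rule Q.glue[OF t R])
    show "s \<phi> \<in> sec Q (Dom T \<phi>)" if "\<phi> \<in> R" for \<phi> using s[OF that] sub[OF that] by blast
    fix \<phi> \<psi> assume \<phi>: "\<phi> \<in> R" and \<psi>: "\<psi> \<in> into T (Dom T \<phi>)"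
    show "res Q \<psi> (s \<phi>) = s (Cmp T \<phi> \<psi>)"
      using restr[OF \<phi> \<psi> s[OF \<phi>]] s_unique[OF P.sieve_Cmp[OF R \<phi> \<psi>]] P.res_Cmp[OF into[OF \<phi>] \<psi> y]
      by simp
  qed
  moreover have "(res P \<phi> y, res Q \<phi> z) \<in> K \<phi> \<longleftrightarrow> res Q \<phi> z = s \<phi>" if "\<phi> \<in> R" for \<phi> z
    using s[OF that] s_unique[OF that] by metis
  ultimately show ?thesis by (simp cong: conj_cong)
qed

end

section \<open>Sections of the contracted product\<close>

text \<open>\<open>B\<close> is the inverse torsor of \<open>Q\<close>.  The assumption on the left action is the cancellation of two
  inverses which turns orbits of the contracted product into diagonal orbits.\<close>

locale contracted = torsor_pair T J G P Q
  for T :: "('o, 'a, 'm) cat_scheme" and J and G :: "('o, 'a, 'g) gpsh"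
    and P :: "('o, 'a, 'v, 'g) rpsh" and Q :: "('o, 'a, 'w, 'g) rpsh" +
  fixes B :: "('o, 'a, 'w, 'g, 'h) bipsh"
  assumes sec_B: "sec B = sec Q" and res_B: "res B = res Q"
    and lact_B: "t \<in> Ob T \<Longrightarrow> g \<in> carrier (grp G t) \<Longrightarrow> z \<in> sec Q t \<Longrightarrow>
      lact B t (inv\<^bsub>grp G t\<^esub> g) z = ract Q t z g"
begin

abbreviation F :: "('o, 'a, ('v \<times> 'w) set) psh" where
  "F \<equiv> orbit_psh T G P B"

lemma orbit_eq: "t \<in> Ob T \<Longrightarrow> z \<in> sec Q t \<Longrightarrow> orbit G P B t (y, z) = orb t y z"
  unfolding orbit_def orb_def using lact_B by (auto; metis)

lemma sec_F: "t \<in> Ob T \<Longrightarrow> e \<in> sec F t \<longleftrightarrow> (\<exists>y\<in>sec P t. \<exists>z\<in>sec Q t. e = orb t y z)"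
  unfolding orbit_psh_def using orbit_eq by (force simp: sec_B)

lemma res_F:
  assumes \<phi>: "\<phi> \<in> into T t" and y: "y \<in> sec P t" and z: "z \<in> sec Q t"
  shows "res F \<phi> (orb t y z) = orb (Dom T \<phi>) (res P \<phi> y) (res Q \<phi> z)"
proof -
  have "res F \<phi> (orb t y z)
      = (\<Union>(y', z')\<in>orb t y z. orbit G P B (Dom T \<phi>) (res P \<phi> y', res Q \<phi> z'))"
    by (simp add: orbit_psh_def res_B)
  also have "\<dots> = (\<Union>(y', z')\<in>orb t y z. orb (Dom T \<phi>) (res P \<phi> y') (res Q \<phi> z'))"
  proof (intro SUP_cong refl)
    fix p assume "p \<in> orb t y z"
    then obtain g where "g \<in> carrier (grp G t)" "p = (ract P t y g, ract Q t z g)"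
      unfolding orb_def by blast
    then show "(case p of (y', z') \<Rightarrow> orbit G P B (Dom T \<phi>) (res P \<phi> y', res Q \<phi> z'))
        = (case p of (y', z') \<Rightarrow> orb (Dom T \<phi>) (res P \<phi> y') (res Q \<phi> z'))"
      using orbit_eq[OF into_Dom[OF P.cat \<phi>] Q.res_closed[OF \<phi> Q.act_closed[OF into_Ob[OF P.cat \<phi>] z]]]
      by simp
  qed
  finally show ?thesis by (simp add: orb_res[OF assms])
qed

text \<open>The relation between sections of \<open>P\<close> and of \<open>Q\<close> encoded by the set of orbits \<open>E \<phi>\<close>.\<close>

definition graph :: "('a \<Rightarrow> ('v \<times> 'w) set set) \<Rightarrow> 'a \<Rightarrow> ('v \<times> 'w) set" where
  "graph E \<phi> = {(y, z). y \<in> sec P (Dom T \<phi>) \<and> z \<in> sec Q (Dom T \<phi>) \<and> orb (Dom T \<phi>) y z \<in> E \<phi>}"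

lemma sheafify_D:
  assumes "E \<in> sec (sheafify T J F) t"
  shows "\<phi> \<notin> into T t \<Longrightarrow> E \<phi> = {}"
    and "\<phi> \<in> into T t \<Longrightarrow> E \<phi> \<subseteq> sec F (Dom T \<phi>)"
    and "\<phi> \<in> into T t \<Longrightarrow> \<psi> \<in> into T (Dom T \<phi>) \<Longrightarrow> e \<in> E \<phi> \<Longrightarrow> res F \<psi> e \<in> E (Cmp T \<phi> \<psi>)"
    and "\<phi> \<in> into T t \<Longrightarrow> e \<in> E \<phi> \<Longrightarrow> e' \<in> E \<phi> \<Longrightarrow>
      \<exists>R\<in>J (Dom T \<phi>). \<forall>\<psi>\<in>R. res F \<psi> e = res F \<psi> e'"
    and "\<phi> \<in> into T t \<Longrightarrow> \<exists>R\<in>J (Dom T \<phi>). \<forall>\<psi>\<in>R. E (Cmp T \<phi> \<psi>) \<noteq> {}"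
    and "\<phi> \<in> into T t \<Longrightarrow> e \<in> sec F (Dom T \<phi>) \<Longrightarrow> R \<in> J (Dom T \<phi>) \<Longrightarrow>
      (\<And>\<psi>. \<psi> \<in> R \<Longrightarrow> res F \<psi> e \<in> E (Cmp T \<phi> \<psi>)) \<Longrightarrow> e \<in> E \<phi>"
proof -
  have out: "\<forall>\<phi>. \<phi> \<notin> into T t \<longrightarrow> E \<phi> = {}"
    and inn: "\<forall>\<phi>\<in>into T t. E \<phi> \<subseteq> sec F (Dom T \<phi>) \<and>
       (\<forall>\<psi>\<in>into T (Dom T \<phi>). res F \<psi> ` E \<phi> \<subseteq> E (Cmp T \<phi> \<psi>)) \<and>
       (\<forall>e\<in>E \<phi>. \<forall>e'\<in>E \<phi>. \<exists>R\<in>J (Dom T \<phi>). \<forall>\<psi>\<in>R. res F \<psi> e = res F \<psi> e') \<and>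
       (\<exists>R\<in>J (Dom T \<phi>). \<forall>\<psi>\<in>R. E (Cmp T \<phi> \<psi>) \<noteq> {}) \<and>
       (\<forall>e\<in>sec F (Dom T \<phi>).
          (\<exists>R\<in>J (Dom T \<phi>). \<forall>\<psi>\<in>R. res F \<psi> e \<in> E (Cmp T \<phi> \<psi>)) \<longrightarrow> e \<in> E \<phi>)"
    using assms by (simp_all add: sheafify_def)
  show "\<phi> \<notin> into T t \<Longrightarrow> E \<phi> = {}" using out by blast
  assume \<phi>: "\<phi> \<in> into T t"
  note inn = bspec[OF inn \<phi>]
  show "E \<phi> \<subseteq> sec F (Dom T \<phi>)" using inn by (elim conjE)
  show "\<exists>R\<in>J (Dom T \<phi>). \<forall>\<psi>\<in>R. E (Cmp T \<phi> \<psi>) \<noteq> {}" using inn by (elim conjE)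
  have "\<forall>\<psi>\<in>into T (Dom T \<phi>). res F \<psi> ` E \<phi> \<subseteq> E (Cmp T \<phi> \<psi>)" using inn by (elim conjE)
  then show "\<psi> \<in> into T (Dom T \<phi>) \<Longrightarrow> e \<in> E \<phi> \<Longrightarrow> res F \<psi> e \<in> E (Cmp T \<phi> \<psi>)" by blast
  have "\<forall>e\<in>E \<phi>. \<forall>e'\<in>E \<phi>. \<exists>R\<in>J (Dom T \<phi>). \<forall>\<psi>\<in>R. res F \<psi> e = res F \<psi> e'"
    using inn by (elim conjE)
  then show "e \<in> E \<phi> \<Longrightarrow> e' \<in> E \<phi> \<Longrightarrow> \<exists>R\<in>J (Dom T \<phi>). \<forall>\<psi>\<in>R. res F \<psi> e = res F \<psi> e'" by blast
  have "\<forall>e\<in>sec F (Dom T \<phi>).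
      (\<exists>R\<in>J (Dom T \<phi>). \<forall>\<psi>\<in>R. res F \<psi> e \<in> E (Cmp T \<phi> \<psi>)) \<longrightarrow> e \<in> E \<phi>"
    using inn by (elim conjE)
  then show "e \<in> sec F (Dom T \<phi>) \<Longrightarrow> R \<in> J (Dom T \<phi>) \<Longrightarrow>
      (\<And>\<psi>. \<psi> \<in> R \<Longrightarrow> res F \<psi> e \<in> E (Cmp T \<phi> \<psi>)) \<Longrightarrow> e \<in> E \<phi>" by blast
qed

context
  fixes E t assumes t: "t \<in> Ob T" and E: "E \<in> sec (sheafify T J F) t"
begin

lemma graph_act:
  assumes \<phi>: "\<phi> \<in> into T t" and "(y, z) \<in> graph E \<phi>" and g: "g \<in> carrier (grp G (Dom T \<phi>))"
  shows "(ract P (Dom T \<phi>) y g, ract Q (Dom T \<phi>) z g) \<in> graph E \<phi>"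
  using assms(2) orb_act[OF into_Dom[OF P.cat \<phi>] _ _ g] P.act_closed[OF into_Dom[OF P.cat \<phi>] _ g]
    Q.act_closed[OF into_Dom[OF P.cat \<phi>] _ g]
  by (simp add: graph_def)

lemma graph_res:
  assumes \<phi>: "\<phi> \<in> into T t" and \<psi>: "\<psi> \<in> into T (Dom T \<phi>)" and "(y, z) \<in> graph E \<phi>"
  shows "(res P \<psi> y, res Q \<psi> z) \<in> graph E (Cmp T \<phi> \<psi>)"
  using assms(3) sheafify_D(3)[OF E \<phi> \<psi>] res_F[OF \<psi>] P.res_closed[OF \<psi>] Q.res_closed[OF \<psi>]
  by (fastforce simp: graph_def Dom_Cmp[OF P.cat \<phi> \<psi>])

lemma graph_nonempty:
  assumes \<phi>: "\<phi> \<in> into T t" and "E \<phi> \<noteq> {}"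
  shows "graph E \<phi> \<noteq> {}"
proof -
  obtain e where e: "e \<in> E \<phi>" using assms(2) by blast
  then have "e \<in> sec F (Dom T \<phi>)" using sheafify_D(2)[OF E \<phi>] by blast
  then obtain y z where "y \<in> sec P (Dom T \<phi>)" "z \<in> sec Q (Dom T \<phi>)" "e = orb (Dom T \<phi>) y z"
    using sec_F[OF into_Dom[OF P.cat \<phi>]] by blast
  then have "(y, z) \<in> graph E \<phi>" using e by (simp add: graph_def)
  then show ?thesis by blast
qed

text \<open>Two members of \<open>E \<phi>\<close> agree locally, orbits are graphs, and \<open>Q\<close> is separated.\<close>

lemma graph_func:
  assumes \<phi>: "\<phi> \<in> into T t" and "(y, z) \<in> graph E \<phi>" "(y, z') \<in> graph E \<phi>"
  shows "z = z'"
proof -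
  note o = into_Dom[OF P.cat \<phi>]
  have m: "y \<in> sec P (Dom T \<phi>)" "z \<in> sec Q (Dom T \<phi>)" "z' \<in> sec Q (Dom T \<phi>)"
    "orb (Dom T \<phi>) y z \<in> E \<phi>" "orb (Dom T \<phi>) y z' \<in> E \<phi>"
    using assms unfolding graph_def by auto
  obtain R where R: "R \<in> J (Dom T \<phi>)"
    "\<And>\<psi>. \<psi> \<in> R \<Longrightarrow> res F \<psi> (orb (Dom T \<phi>) y z) = res F \<psi> (orb (Dom T \<phi>) y z')"
    using sheafify_D(4)[OF E \<phi> m(4,5)] by blast
  show ?thesis
  proof (rule Q.separated[OF o R(1) m(2,3)])
    fix \<psi> assume "\<psi> \<in> R"
    then have \<psi>: "\<psi> \<in> into T (Dom T \<phi>)" using P.sieve_into R(1) by blast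
    show "res Q \<psi> z = res Q \<psi> z'"
      by (rule orb_fst_eq[OF into_Dom[OF P.cat \<psi>] P.res_closed[OF \<psi> m(1)] Q.res_closed[OF \<psi> m(2)]
            Q.res_closed[OF \<psi> m(3)]])
        (use R(2)[OF \<open>\<psi> \<in> R\<close>] res_F[OF \<psi>] m in simp)
  qed
qed

text \<open>By stability under the action, injectivity is single-valuedness applied at \<open>z\<close>: an element that
  carries \<open>y\<close> to \<open>y'\<close> must fix \<open>z\<close>.\<close>

lemma graph_inj:
  assumes \<phi>: "\<phi> \<in> into T t" and m: "(y, z) \<in> graph E \<phi>" "(y', z) \<in> graph E \<phi>"
  shows "y = y'"
proof -
  note o = into_Dom[OF P.cat \<phi>]
  have s: "y \<in> sec P (Dom T \<phi>)" "y' \<in> sec P (Dom T \<phi>)" "z \<in> sec Q (Dom T \<phi>)"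
    using m unfolding graph_def by auto
  interpret group "grp G (Dom T \<phi>)" by (rule P.group_grp[OF o])
  obtain g where g: "g \<in> carrier (grp G (Dom T \<phi>))" "y' = ract P (Dom T \<phi>) y g"
    by (rule P.transitive[OF o s(1,2)])
  have "ract Q (Dom T \<phi>) z g = z"
    using graph_func[OF \<phi> graph_act[OF \<phi> m(1) g(1)]] m(2) g(2) by simp
  then have "g = \<one>\<^bsub>grp G (Dom T \<phi>)\<^esub>"
    using Q.free[OF o s(3) g(1) one_closed] Q.act_one[OF o s(3)] by simp
  then show ?thesis using g(2) P.act_one[OF o s(1)] by simp
qed

lemma graph_local:
  assumes \<phi>: "\<phi> \<in> into T t" and R: "R \<in> J (Dom T \<phi>)"
    and y: "y \<in> sec P (Dom T \<phi>)" and z: "z \<in> sec Q (Dom T \<phi>)"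
    and "\<And>\<psi>. \<psi> \<in> R \<Longrightarrow> (res P \<psi> y, res Q \<psi> z) \<in> graph E (Cmp T \<phi> \<psi>)"
  shows "(y, z) \<in> graph E \<phi>"
proof -
  have "orb (Dom T \<phi>) y z \<in> E \<phi>"
  proof (rule sheafify_D(6)[OF E \<phi> _ R])
    show "orb (Dom T \<phi>) y z \<in> sec F (Dom T \<phi>)"
      using sec_F[OF into_Dom[OF P.cat \<phi>]] y z by blast
    fix \<psi> assume r: "\<psi> \<in> R"
    then have \<psi>: "\<psi> \<in> into T (Dom T \<phi>)" using P.sieve_into R by blast
    show "res F \<psi> (orb (Dom T \<phi>) y z) \<in> E (Cmp T \<phi> \<psi>)"
      using assms(5)[OF r] by (simp add: res_F[OF \<psi> y z] graph_def Dom_Cmp[OF P.cat \<phi> \<psi>])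
  qed
  then show ?thesis using y z by (simp add: graph_def)
qed

text \<open>Sections of a contracted product are isomorphisms.  As \<open>E\<close> is locally non-empty, the local
  graphs glue, and closure of \<open>E\<close> under local membership brings the glued pair back into the graph.
  The second half is the first with the two torsors exchanged.\<close>

lemma graph_bij:
  assumes \<phi>: "\<phi> \<in> into T t"
  shows "y \<in> sec P (Dom T \<phi>) \<Longrightarrow> \<exists>!z. (y, z) \<in> graph E \<phi>"
    and "z \<in> sec Q (Dom T \<phi>) \<Longrightarrow> \<exists>!y. (y, z) \<in> graph E \<phi>"
proof -
  note o = into_Dom[OF P.cat \<phi>]
  obtain R where R: "R \<in> J (Dom T \<phi>)" and ne: "\<And>\<psi>. \<psi> \<in> R \<Longrightarrow> E (Cmp T \<phi> \<psi>) \<noteq> {}"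
    using sheafify_D(5)[OF E \<phi>] by blast
  note into = P.sieve_into[OF R]
  let ?K = "\<lambda>\<psi>. graph E (Cmp T \<phi> \<psi>)"
  have D: "Dom T (Cmp T \<phi> \<psi>) = Dom T \<psi>" "Cmp T \<phi> \<psi> \<in> into T t" if "\<psi> \<in> R" for \<psi>
    using Dom_Cmp[OF P.cat \<phi> into[OF that]] into_Cmp[OF P.cat \<phi> into[OF that]] .
  have K: "?K \<psi> \<noteq> {}" "?K \<psi> \<subseteq> sec P (Dom T \<psi>) \<times> sec Q (Dom T \<psi>)" if "\<psi> \<in> R" for \<psi>
    using graph_nonempty[OF D(2)[OF that] ne[OF that]] D(1)[OF that] by (auto simp: graph_def)
  have act: "(ract P (Dom T \<psi>) y g, ract Q (Dom T \<psi>) z g) \<in> ?K \<psi>"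
    if "\<psi> \<in> R" "(y, z) \<in> ?K \<psi>" "g \<in> carrier (grp G (Dom T \<psi>))" for \<psi> y z g
    using graph_act[OF D(2)[OF that(1)] that(2)] that(3) D(1)[OF that(1)] by simp
  have restr: "(res P \<chi> y, res Q \<chi> z) \<in> ?K (Cmp T \<psi> \<chi>)"
    if "\<psi> \<in> R" "\<chi> \<in> into T (Dom T \<psi>)" "(y, z) \<in> ?K \<psi>" for \<psi> \<chi> y z
    using graph_res[OF D(2)[OF that(1)] _ that(3), of \<chi>] that(2) D(1)[OF that(1)]
      Cmp_assoc[OF P.cat \<phi> into[OF that(1)] that(2)] by simp
  show "\<exists>!z. (y, z) \<in> graph E \<phi>" if y: "y \<in> sec P (Dom T \<phi>)"
  proof -
    have "\<exists>!z. z \<in> sec Q (Dom T \<phi>) \<and> (\<forall>\<psi>\<in>R. (res P \<psi> y, res Q \<psi> z) \<in> ?K \<psi>)"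
      by (rule graph_glue[OF o R K(2,1) act _ restr y]) (use graph_func D in blast)+
    then obtain z where "z \<in> sec Q (Dom T \<phi>)" "\<And>\<psi>. \<psi> \<in> R \<Longrightarrow> (res P \<psi> y, res Q \<psi> z) \<in> ?K \<psi>"
      by blast
    then have "(y, z) \<in> graph E \<phi>" using graph_local[OF \<phi> R y] by blast
    then show ?thesis using graph_func[OF \<phi>] by blast
  qed
  interpret swap: torsor_pair T J G Q P ..
  show "\<exists>!y. (y, z) \<in> graph E \<phi>" if z: "z \<in> sec Q (Dom T \<phi>)"
  proof -
    have "\<exists>!y. y \<in> sec P (Dom T \<phi>) \<and> (\<forall>\<psi>\<in>R. (res Q \<psi> z, res P \<psi> y) \<in> (?K \<psi>)\<inverse>)"
    proof (rule swap.graph_glue[OF o R _ _ _ _ _ z])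
      show "(?K \<psi>)\<inverse> \<noteq> {}" "(?K \<psi>)\<inverse> \<subseteq> sec Q (Dom T \<psi>) \<times> sec P (Dom T \<psi>)" if "\<psi> \<in> R" for \<psi>
        using K[OF that] by auto
    qed (use act restr graph_inj D in blast)+
    then obtain y where "y \<in> sec P (Dom T \<phi>)" "\<And>\<psi>. \<psi> \<in> R \<Longrightarrow> (res P \<psi> y, res Q \<psi> z) \<in> ?K \<psi>"
      by auto
    then have "(y, z) \<in> graph E \<phi>" using graph_local[OF \<phi> R _ z] by blast
    then show ?thesis using graph_inj[OF \<phi>] by blast
  qed
qed

end

definition graph_section :: "'o \<Rightarrow> ('a \<Rightarrow> 'v \<Rightarrow> 'w) \<Rightarrow> 'a \<Rightarrow> ('v \<times> 'w) set set" where
  "graph_section t h \<phi> =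
     (if \<phi> \<in> into T t then {orb (Dom T \<phi>) y (h \<phi> y) | y. y \<in> sec P (Dom T \<phi>)} else {})"

text \<open>Conversely isomorphisms are sections of the contracted product.  Equivariance makes the orbits of
  all the pairs \<open>(y, h y)\<close> coincide, so there is at most one orbit over each object; and an orbit of
  \<open>(y, z)\<close> that belongs locally to the family has \<open>z = h y\<close> locally, hence globally.\<close>

lemma graph_section_sheafify:
  assumes t: "t \<in> Ob T"
    and h: "\<And>\<phi> y. \<phi> \<in> into T t \<Longrightarrow> y \<in> sec P (Dom T \<phi>) \<Longrightarrow> h \<phi> y \<in> sec Q (Dom T \<phi>)"
    and h_act: "\<And>\<phi> y g. \<phi> \<in> into T t \<Longrightarrow> y \<in> sec P (Dom T \<phi>) \<Longrightarrow> g \<in> carrier (grp G (Dom T \<phi>)) \<Longrightarrow>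
      h \<phi> (ract P (Dom T \<phi>) y g) = ract Q (Dom T \<phi>) (h \<phi> y) g"
    and h_res: "\<And>\<phi> \<psi> y. \<phi> \<in> into T t \<Longrightarrow> \<psi> \<in> into T (Dom T \<phi>) \<Longrightarrow> y \<in> sec P (Dom T \<phi>) \<Longrightarrow>
      h (Cmp T \<phi> \<psi>) (res P \<psi> y) = res Q \<psi> (h \<phi> y)"
  shows "graph_section t h \<in> sec (sheafify T J F) t"
proof -
  let ?E = "graph_section t h"
  have E: "?E \<phi> = {orb (Dom T \<phi>) y (h \<phi> y) | y. y \<in> sec P (Dom T \<phi>)}" if "\<phi> \<in> into T t" for \<phi>
    using that by (simp add: graph_section_def)
  have sub: "?E \<phi> \<subseteq> sec F (Dom T \<phi>)" if \<phi>: "\<phi> \<in> into T t" for \<phi>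
    using sec_F[OF into_Dom[OF P.cat \<phi>]] h[OF \<phi>] unfolding E[OF \<phi>] by blast
  have restr: "res F \<psi> ` ?E \<phi> \<subseteq> ?E (Cmp T \<phi> \<psi>)"
    if \<phi>: "\<phi> \<in> into T t" and \<psi>: "\<psi> \<in> into T (Dom T \<phi>)" for \<phi> \<psi>
    unfolding E[OF \<phi>] E[OF into_Cmp[OF P.cat \<phi> \<psi>]]
    using res_F[OF \<psi> _ h[OF \<phi>]] h_res[OF \<phi> \<psi>] P.res_closed[OF \<psi>]
    by (force simp: Dom_Cmp[OF P.cat \<phi> \<psi>])
  have single: "e = e'" if \<phi>: "\<phi> \<in> into T t" and e: "e \<in> ?E \<phi>" "e' \<in> ?E \<phi>" for \<phi> e e'
  proof -
    note o = into_Dom[OF P.cat \<phi>]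
    obtain y y' where y: "y \<in> sec P (Dom T \<phi>)" "y' \<in> sec P (Dom T \<phi>)"
      "e = orb (Dom T \<phi>) y (h \<phi> y)" "e' = orb (Dom T \<phi>) y' (h \<phi> y')"
      using e unfolding E[OF \<phi>] by blast
    obtain g where g: "g \<in> carrier (grp G (Dom T \<phi>))" "y' = ract P (Dom T \<phi>) y g"
      by (rule P.transitive[OF o y(1,2)])
    show ?thesis
      using orb_act[OF o y(1) h[OF \<phi> y(1)] g(1)] h_act[OF \<phi> y(1) g(1)] by (simp add: y(3,4) g(2))
  qed
  have nonempty: "\<exists>R\<in>J (Dom T \<phi>). \<forall>\<psi>\<in>R. ?E (Cmp T \<phi> \<psi>) \<noteq> {}" if \<phi>: "\<phi> \<in> into T t" for \<phi>
  proof -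
    obtain R where R: "R \<in> J (Dom T \<phi>)" "\<And>\<psi>. \<psi> \<in> R \<Longrightarrow> sec P (Dom T \<psi>) \<noteq> {}"
      using P.locally_nonempty[OF into_Dom[OF P.cat \<phi>]] by blast
    have "?E (Cmp T \<phi> \<psi>) \<noteq> {}" if r: "\<psi> \<in> R" for \<psi>
      using R(2)[OF r] P.sieve_into[OF R(1) r]
      by (auto simp: E[OF into_Cmp[OF P.cat \<phi>]] Dom_Cmp[OF P.cat \<phi>])
    then show ?thesis using R(1) by blast
  qed
  have local: "e \<in> ?E \<phi>"
    if \<phi>: "\<phi> \<in> into T t" and e: "e \<in> sec F (Dom T \<phi>)" and R: "R \<in> J (Dom T \<phi>)"
      and l: "\<And>\<psi>. \<psi> \<in> R \<Longrightarrow> res F \<psi> e \<in> ?E (Cmp T \<phi> \<psi>)" for \<phi> e R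
  proof -
    note o = into_Dom[OF P.cat \<phi>]
    obtain y z where y: "y \<in> sec P (Dom T \<phi>)" and z: "z \<in> sec Q (Dom T \<phi>)"
      and e': "e = orb (Dom T \<phi>) y z" using e sec_F[OF o] by blast
    have "z = h \<phi> y"
    proof (rule Q.separated[OF o R z h[OF \<phi> y]])
      fix \<psi> assume r: "\<psi> \<in> R"
      then have \<psi>: "\<psi> \<in> into T (Dom T \<phi>)" using P.sieve_into R by blast
      have "orb (Dom T \<psi>) (res P \<psi> y) (res Q \<psi> z) \<in> ?E (Cmp T \<phi> \<psi>)"
        using l[OF r] res_F[OF \<psi> y z] by (simp add: e')
      moreover have "orb (Dom T \<psi>) (res P \<psi> y) (res Q \<psi> (h \<phi> y)) \<in> ?E (Cmp T \<phi> \<psi>)"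
        using restr[OF \<phi> \<psi>] res_F[OF \<psi> y h[OF \<phi> y]] y unfolding E[OF \<phi>] by force
      ultimately have "orb (Dom T \<psi>) (res P \<psi> y) (res Q \<psi> z)
          = orb (Dom T \<psi>) (res P \<psi> y) (res Q \<psi> (h \<phi> y))"
        by (rule single[OF into_Cmp[OF P.cat \<phi> \<psi>]])
      then show "res Q \<psi> z = res Q \<psi> (h \<phi> y)"
        by (rule orb_fst_eq[OF into_Dom[OF P.cat \<psi>] P.res_closed[OF \<psi> y] Q.res_closed[OF \<psi> z]
              Q.res_closed[OF \<psi> h[OF \<phi> y]]])
    qed
    then show ?thesis using y e' unfolding E[OF \<phi>] by blast
  qed
  have lu: "\<exists>R\<in>J (Dom T \<phi>). \<forall>\<psi>\<in>R. res F \<psi> e = res F \<psi> e'"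
    if \<phi>: "\<phi> \<in> into T t" and "e \<in> ?E \<phi>" "e' \<in> ?E \<phi>" for \<phi> e e'
    using single[OF that] nonempty[OF \<phi>] by blast
  have "?E \<in> {E.
        (\<forall>\<phi>. \<phi> \<notin> into T t \<longrightarrow> E \<phi> = {}) \<and>
        (\<forall>\<phi>\<in>into T t.
           E \<phi> \<subseteq> sec F (Dom T \<phi>) \<and>
           (\<forall>\<psi>\<in>into T (Dom T \<phi>). res F \<psi> ` E \<phi> \<subseteq> E (Cmp T \<phi> \<psi>)) \<and>
           (\<forall>e\<in>E \<phi>. \<forall>e'\<in>E \<phi>. \<exists>R\<in>J (Dom T \<phi>). \<forall>\<psi>\<in>R. res F \<psi> e = res F \<psi> e') \<and>
           (\<exists>R\<in>J (Dom T \<phi>). \<forall>\<psi>\<in>R. E (Cmp T \<phi> \<psi>) \<noteq> {}) \<and>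
           (\<forall>e\<in>sec F (Dom T \<phi>).
              (\<exists>R\<in>J (Dom T \<phi>). \<forall>\<psi>\<in>R. res F \<psi> e \<in> E (Cmp T \<phi> \<psi>)) \<longrightarrow> e \<in> E \<phi>))}"
  proof (intro CollectI conjI allI impI ballI sub restr lu nonempty)
    show "?E \<phi> = {}" if "\<phi> \<notin> into T t" for \<phi> using that by (simp add: graph_section_def)
    show "e \<in> ?E \<phi>" if "\<phi> \<in> into T t" "e \<in> sec F (Dom T \<phi>)"
      "\<exists>R\<in>J (Dom T \<phi>). \<forall>\<psi>\<in>R. res F \<psi> e \<in> ?E (Cmp T \<phi> \<psi>)" for \<phi> e
      using local[OF that(1,2)] that(3) by blast
  qed
  then show ?thesis by (simp add: sheafify_def)
qed

end

section \<open>Isomorphisms of torsors\<close>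

text \<open>Isomorphisms are constructed as relations, because gluing produces graphs and because the converse
  of a graph is then available as the inverse.\<close>

lemma torsors_isomorphic_of_graph:
  fixes P :: "('o, 'a, 'v, 'g) rpsh" and Q :: "('o, 'a, 'w, 'g) rpsh"
  assumes sub: "\<And>t. t \<in> Ob T \<Longrightarrow> H t \<subseteq> sec P t \<times> sec Q t"
    and left: "\<And>t y. t \<in> Ob T \<Longrightarrow> y \<in> sec P t \<Longrightarrow> \<exists>!z. (y, z) \<in> H t"
    and right: "\<And>t z. t \<in> Ob T \<Longrightarrow> z \<in> sec Q t \<Longrightarrow> \<exists>!y. (y, z) \<in> H t"
    and T: "is_cat T"
    and res: "\<And>t \<phi> y z. \<phi> \<in> into T t \<Longrightarrow> (y, z) \<in> H t \<Longrightarrow> (res P \<phi> y, res Q \<phi> z) \<in> H (Dom T \<phi>)"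
    and act: "\<And>t y z g. t \<in> Ob T \<Longrightarrow> (y, z) \<in> H t \<Longrightarrow> g \<in> carrier (grp G t) \<Longrightarrow>
      (ract P t y g, ract Q t z g) \<in> H t"
  shows "torsors_isomorphic T G P Q"
proof -
  define h where "h t y = (THE z. (y, z) \<in> H t)" for t y
  have h: "(y, h t y) \<in> H t" if "t \<in> Ob T" "y \<in> sec P t" for t y
    unfolding h_def using left[OF that] by (rule theI')
  have h_eq: "h t y = z" if t: "t \<in> Ob T" and m: "(y, z) \<in> H t" for t y z
  proof -
    have "y \<in> sec P t" using sub[OF t] m by blast
    then show ?thesis unfolding h_def using left[OF t] m by (simp add: the1_equality)
  qed
  have bij: "bij_betw (h t) (sec P t) (sec Q t)" if t: "t \<in> Ob T" for t
    unfolding bij_betw_def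
  proof
    show "inj_on (h t) (sec P t)"
    proof (rule inj_onI)
      fix y y' assume y: "y \<in> sec P t" "y' \<in> sec P t" and e: "h t y = h t y'"
      have m: "(y, h t y) \<in> H t" "(y', h t y) \<in> H t" using h[OF t y(1)] h[OF t y(2)] e by auto
      then have "h t y \<in> sec Q t" using sub[OF t] by blast
      then show "y = y'" using right[OF t] m by blast
    qed
    show "h t ` sec P t = sec Q t"
    proof
      show "h t ` sec P t \<subseteq> sec Q t" using h[OF t] sub[OF t] by blast
      show "sec Q t \<subseteq> h t ` sec P t"
      proof
        fix z assume "z \<in> sec Q t"
        then obtain y where y: "(y, z) \<in> H t" using right[OF t] by blast
        then show "z \<in> h t ` sec P t" using sub[OF t] h_eq[OF t y] by force
      qed
    qed
  qed
  have nat: "h (Dom T \<phi>) (res P \<phi> v) = res Q \<phi> (h (Cod T \<phi>) v)"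
    if "\<phi> \<in> Arr T" "v \<in> sec P (Cod T \<phi>)" for \<phi> v
    by (rule h_eq[OF cat_Dom[OF T that(1)] res[OF into_I[OF that(1)] h[OF cat_Cod[OF T that(1)] that(2)]]])
  have "h t (ract P t v g) = ract Q t (h t v) g"
    if "t \<in> Ob T" "v \<in> sec P t" "g \<in> carrier (grp G t)" for t v g
    by (rule h_eq[OF that(1) act[OF that(1) h[OF that(1,2)] that(3)]])
  with bij nat show ?thesis unfolding torsors_isomorphic_def by blast
qed

lemma torsors_isomorphicE:
  assumes "torsors_isomorphic T G P Q"
  obtains h where "\<And>t. t \<in> Ob T \<Longrightarrow> bij_betw (h t) (sec P t) (sec Q t)"
    "\<And>\<phi> v. \<phi> \<in> Arr T \<Longrightarrow> v \<in> sec P (Cod T \<phi>) \<Longrightarrow>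
      h (Dom T \<phi>) (res P \<phi> v) = res Q \<phi> (h (Cod T \<phi>) v)"
    "\<And>t v g. t \<in> Ob T \<Longrightarrow> v \<in> sec P t \<Longrightarrow> g \<in> carrier (grp G t) \<Longrightarrow>
      h t (ract P t v g) = ract Q t (h t v) g"
proof -
  from assms obtain h where
    1: "\<forall>t\<in>Ob T. bij_betw (h t) (sec P t) (sec Q t)" and
    2: "\<forall>\<phi>\<in>Arr T. \<forall>v\<in>sec P (Cod T \<phi>). h (Dom T \<phi>) (res P \<phi> v) = res Q \<phi> (h (Cod T \<phi>) v)" and
    3: "\<forall>t\<in>Ob T. \<forall>v\<in>sec P t. \<forall>g\<in>carrier (grp G t). h t (ract P t v g) = ract Q t (h t v) g"
    unfolding torsors_isomorphic_def by (elim exE conjE)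
  show thesis by (rule that[of h]) (use 1 2 3 in simp_all)
qed

lemma torsors_isomorphic_trans:
  assumes T: "is_cat T" and PQ: "torsors_isomorphic T G P Q" and QR: "torsors_isomorphic T G Q R"
  shows "torsors_isomorphic T G P R"
proof -
  obtain h where h: "\<And>t. t \<in> Ob T \<Longrightarrow> bij_betw (h t) (sec P t) (sec Q t)"
    "\<And>\<phi> v. \<phi> \<in> Arr T \<Longrightarrow> v \<in> sec P (Cod T \<phi>) \<Longrightarrow>
      h (Dom T \<phi>) (res P \<phi> v) = res Q \<phi> (h (Cod T \<phi>) v)"
    "\<And>t v g. t \<in> Ob T \<Longrightarrow> v \<in> sec P t \<Longrightarrow> g \<in> carrier (grp G t) \<Longrightarrow>
      h t (ract P t v g) = ract Q t (h t v) g" using torsors_isomorphicE[OF PQ] by blast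
  obtain k where k: "\<And>t. t \<in> Ob T \<Longrightarrow> bij_betw (k t) (sec Q t) (sec R t)"
    "\<And>\<phi> v. \<phi> \<in> Arr T \<Longrightarrow> v \<in> sec Q (Cod T \<phi>) \<Longrightarrow>
      k (Dom T \<phi>) (res Q \<phi> v) = res R \<phi> (k (Cod T \<phi>) v)"
    "\<And>t v g. t \<in> Ob T \<Longrightarrow> v \<in> sec Q t \<Longrightarrow> g \<in> carrier (grp G t) \<Longrightarrow>
      k t (ract Q t v g) = ract R t (k t v) g" using torsors_isomorphicE[OF QR] by blast
  have hs: "h t v \<in> sec Q t" if "t \<in> Ob T" "v \<in> sec P t" for t v
    using bij_betwE[OF h(1)[OF that(1)]] that(2) by blast
  show ?thesis
    unfolding torsors_isomorphic_def
  proof (intro exI[of _ "\<lambda>t. k t \<circ> h t"] conjI ballI)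
    show "bij_betw (k t \<circ> h t) (sec P t) (sec R t)" if "t \<in> Ob T" for t
      using bij_betw_trans[OF h(1)[OF that] k(1)[OF that]] .
  qed (use h(2,3) k(2,3) hs cat_Cod[OF T] in auto)
qed

text \<open>The operations of a torsor stay inside it.  This is the part of being a torsor that survives
  pull-back along an arbitrary functor and suffices for inverting isomorphisms.\<close>

definition acted_presheaf ::
    "('o, 'a, 'm) cat_scheme \<Rightarrow> ('o, 'a, 'g) gpsh \<Rightarrow> ('o, 'a, 'v, 'g) rpsh \<Rightarrow> bool" where
  "acted_presheaf T G P \<longleftrightarrow>
     (\<forall>\<phi>\<in>Arr T. res P \<phi> \<in> sec P (Cod T \<phi>) \<rightarrow> sec P (Dom T \<phi>)) \<and>
     (\<forall>t\<in>Ob T. \<forall>v\<in>sec P t. \<forall>g\<in>carrier (grp G t). ract P t v g \<in> sec P t)"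

lemma torsors_isomorphic_sym:
  assumes T: "is_cat T" and P: "acted_presheaf T G P" and PQ: "torsors_isomorphic T G P Q"
  shows "torsors_isomorphic T G Q P"
proof -
  obtain h where h: "\<And>t. t \<in> Ob T \<Longrightarrow> bij_betw (h t) (sec P t) (sec Q t)"
    "\<And>\<phi> v. \<phi> \<in> Arr T \<Longrightarrow> v \<in> sec P (Cod T \<phi>) \<Longrightarrow>
      h (Dom T \<phi>) (res P \<phi> v) = res Q \<phi> (h (Cod T \<phi>) v)"
    "\<And>t v g. t \<in> Ob T \<Longrightarrow> v \<in> sec P t \<Longrightarrow> g \<in> carrier (grp G t) \<Longrightarrow>
      h t (ract P t v g) = ract Q t (h t v) g" using torsors_isomorphicE[OF PQ] by blast
  let ?H = "\<lambda>t. {(w, v). v \<in> sec P t \<and> w = h t v}"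
  show ?thesis
  proof (rule torsors_isomorphic_of_graph[where H = ?H])
    show "?H t \<subseteq> sec Q t \<times> sec P t" if "t \<in> Ob T" for t using bij_betwE[OF h(1)[OF that]] by auto
    show "\<exists>!z. (y, z) \<in> ?H t" if "t \<in> Ob T" "y \<in> sec Q t" for t y
      using bij_betw_imp_surj_on[OF h(1)[OF that(1)]] bij_betw_imp_inj_on[OF h(1)[OF that(1)]] that(2)
      by (auto dest: inj_onD)
    show "\<exists>!y. (y, z) \<in> ?H t" if "t \<in> Ob T" "z \<in> sec P t" for t z using that by auto
    show "(res Q \<phi> y, res P \<phi> z) \<in> ?H (Dom T \<phi>)" if \<phi>: "\<phi> \<in> into T t" and m: "(y, z) \<in> ?H t" for t \<phi> y z
      using P h(2)[OF into_Arr[OF \<phi>]] m into_Arr[OF \<phi>] into_Cod[OF \<phi>]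
      unfolding acted_presheaf_def by auto
    show "(ract Q t y g, ract P t z g) \<in> ?H t"
      if "t \<in> Ob T" "(y, z) \<in> ?H t" "g \<in> carrier (grp G t)" for t y z g
      using P h(3) that unfolding acted_presheaf_def by auto
  qed (rule T)
qed

lemma torsor_class_eq:
  assumes T: "is_cat T" and P: "acted_presheaf T G P" and PQ: "torsors_isomorphic T G P Q"
  shows "torsor_class T J G P = torsor_class T J G Q"
  unfolding torsor_class_def
  using torsors_isomorphic_trans[OF T] PQ torsors_isomorphic_sym[OF T P PQ] by blast

lemma torsors_isomorphic_refl: "torsors_isomorphic T G P P"
  unfolding torsors_isomorphic_def by (rule exI[of _ "\<lambda>_ v. v"]) (simp add: bij_betw_def)

lemma (in torsor) acted_presheaf: "acted_presheaf T G P"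
  using act_closed res_closed[OF into_I] by (simp add: acted_presheaf_def)

lemma acted_presheaf_pull:
  assumes u: "is_fctr T C u" and P: "acted_presheaf C G P"
  shows "acted_presheaf T (pull_gpsh u G) (pull_torsor u P)"
proof -
  have "res P (onA u \<phi>) \<in> sec P (onO u (Cod T \<phi>)) \<rightarrow> sec P (onO u (Dom T \<phi>))" if \<phi>: "\<phi> \<in> Arr T" for \<phi>
  proof -
    have "onA u \<phi> \<in> Arr C" "Dom C (onA u \<phi>) = onO u (Dom T \<phi>)" "Cod C (onA u \<phi>) = onO u (Cod T \<phi>)"
      using u \<phi> by (simp_all add: is_fctr_def)
    then show ?thesis using P unfolding acted_presheaf_def by metis
  qed
  then show ?thesis
    using u P by (simp add: acted_presheaf_def is_fctr_def pull_gpsh_def pull_torsor_def)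
qed

text \<open>The component at \<open>u t\<close> of an isomorphism serves as the component at \<open>t\<close>.\<close>

lemma torsors_isomorphic_pull:
  assumes u: "is_fctr T C u" and PQ: "torsors_isomorphic C G P Q"
  shows "torsors_isomorphic T (pull_gpsh u G) (pull_torsor u P) (pull_torsor u Q)"
proof -
  obtain h where h: "\<And>t. t \<in> Ob C \<Longrightarrow> bij_betw (h t) (sec P t) (sec Q t)"
    "\<And>\<phi> v. \<phi> \<in> Arr C \<Longrightarrow> v \<in> sec P (Cod C \<phi>) \<Longrightarrow>
      h (Dom C \<phi>) (res P \<phi> v) = res Q \<phi> (h (Cod C \<phi>) v)"
    "\<And>t v g. t \<in> Ob C \<Longrightarrow> v \<in> sec P t \<Longrightarrow> g \<in> carrier (grp G t) \<Longrightarrow>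
      h t (ract P t v g) = ract Q t (h t v) g" using torsors_isomorphicE[OF PQ] by blast
  have O: "onO u t \<in> Ob C" if "t \<in> Ob T" for t using u that by (simp add: is_fctr_def)
  have A: "onA u \<phi> \<in> Arr C" "Dom C (onA u \<phi>) = onO u (Dom T \<phi>)" "Cod C (onA u \<phi>) = onO u (Cod T \<phi>)"
    if "\<phi> \<in> Arr T" for \<phi> using u that by (simp_all add: is_fctr_def)
  show ?thesis
    unfolding torsors_isomorphic_def
    by (intro exI[of _ "\<lambda>t. h (onO u t)"] conjI ballI)
      (use h O A h(2)[OF A(1)] in \<open>auto simp: pull_torsor_def pull_gpsh_def\<close>)
qed

section \<open>Torsors and Cech cocycles\<close>

locale pointed_site = site C J
  for C :: "('o, 'a, 'm) cat_scheme" and J +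
  fixes e :: 'o
  assumes e: "e \<in> Ob C" and to_e: "t \<in> Ob C \<Longrightarrow> \<exists>u\<in>into C e. Dom C u = t"
begin

text \<open>Pull the covering sieve of \<open>e\<close> back along an arrow from \<open>t\<close> to \<open>e\<close>.\<close>

lemma cover_everywhere:
  assumes W: "cech_cover C J e W" and t: "t \<in> Ob C"
  shows "{a \<in> into C t. \<exists>b\<in>into_cover C W. Dom C b = Dom C a} \<in> J t"
proof -
  obtain u where u: "u \<in> into C e" "Dom C u = t" using to_e[OF t] by blast
  let ?F = "{f \<in> into C e. Dom C f \<in> W}"
  have "sieve_pull C u (sieve_gen C ?F) \<in> J t"
    using pull[OF _ u(1)] W u(2) unfolding cech_cover_def by blast
  moreover have "sieve_pull C u (sieve_gen C ?F)
      \<subseteq> {a \<in> into C t. \<exists>b\<in>into_cover C W. Dom C b = Dom C a}"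
  proof
    fix a assume "a \<in> sieve_pull C u (sieve_gen C ?F)"
    then have a: "a \<in> into C t" "Cmp C u a \<in> sieve_gen C ?F"
      using u(2) unfolding sieve_pull_def by auto
    then obtain f b where f: "f \<in> into C e" "Dom C f \<in> W" "b \<in> into C (Dom C f)"
      "Cmp C u a = Cmp C f b" unfolding sieve_gen_def by blast
    have "Dom C b = Dom C a"
      using Dom_Cmp[OF cat f(1,3)] Dom_Cmp[OF cat u(1), of a] a(1) u(2) f(4) by simp
    moreover have "b \<in> into_cover C W" using f(2,3) by (simp add: into_cover_def into_def)
    ultimately show "a \<in> {a \<in> into C t. \<exists>b\<in>into_cover C W. Dom C b = Dom C a}" using a(1) by blast
  qed
  moreover have "is_sieve C t {a \<in> into C t. \<exists>b\<in>into_cover C W. Dom C b = Dom C a}"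
    unfolding is_sieve_def
  proof (intro conjI ballI)
    fix a k assume "a \<in> {a \<in> into C t. \<exists>b\<in>into_cover C W. Dom C b = Dom C a}"
      and k: "k \<in> into C (Dom C a)"
    then obtain b where b: "a \<in> into C t" "b \<in> into_cover C W" "Dom C b = Dom C a" by blast
    have bi: "b \<in> into C (Cod C b)" using b(2) by (simp add: into_cover_def into_I)
    have "Cmp C b k \<in> into_cover C W"
      using into_Cmp[OF cat bi, of k] k b(2,3) by (simp add: into_cover_def into_def)
    moreover have "Dom C (Cmp C b k) = Dom C (Cmp C a k)"
      using Dom_Cmp[OF cat bi, of k] Dom_Cmp[OF cat b(1) k] k b(3) by simp
    ultimately show "Cmp C a k \<in> {a \<in> into C t. \<exists>b\<in>into_cover C W. Dom C b = Dom C a}"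
      using into_Cmp[OF cat b(1) k] by blast
  qed blast
  ultimately show ?thesis by (rule super)
qed

end

text \<open>The relation over \<open>t\<close> that matches the given sections \<open>p U\<close> and \<open>q U\<close>, restricted to \<open>t\<close>, for
  every arrow from \<open>t\<close> into the covering, and is closed under the action.\<close>

definition cover_graph ::
    "('o, 'a, 'm) cat_scheme \<Rightarrow> ('o, 'a, 'g) gpsh \<Rightarrow> ('o, 'a, 'v, 'g) rpsh \<Rightarrow> ('o, 'a, 'w, 'g) rpsh
      \<Rightarrow> 'o set \<Rightarrow> ('o \<Rightarrow> 'v) \<Rightarrow> ('o \<Rightarrow> 'w) \<Rightarrow> 'o \<Rightarrow> ('v \<times> 'w) set" where
  "cover_graph C G P Q W p q t =
    {(ract P t (res P b (p (Cod C b))) g, ract Q t (res Q b (q (Cod C b))) g) | b g.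
       b \<in> into_cover C W \<and> Dom C b = t \<and> g \<in> carrier (grp G t)}"

lemma cover_graph_converse: "cover_graph C G Q P W q p t = (cover_graph C G P Q W p q t)\<inverse>"
  unfolding cover_graph_def by auto

definition has_cocycle ::
    "('o, 'a, 'm) cat_scheme \<Rightarrow> ('o, 'a, 'g) gpsh \<Rightarrow> ('o, 'a, 'v, 'g) rpsh
      \<Rightarrow> 'o set \<Rightarrow> ('o \<Rightarrow> 'v) \<Rightarrow> ('a \<Rightarrow> 'a \<Rightarrow> 'g) \<Rightarrow> bool" where
  "has_cocycle C G P W p k \<longleftrightarrow> (\<forall>U\<in>W. p U \<in> sec P U) \<and>
     (\<forall>a\<in>into_cover C W. \<forall>b\<in>into_cover C W. Dom C a = Dom C b \<longrightarrow>
        k a b \<in> carrier (grp G (Dom C a)) \<and>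
        ract P (Dom C a) (res P a (p (Cod C a))) (k a b) = res P b (p (Cod C b)))"

context torsor_pair
begin

context
  fixes W p q k e
  assumes site: "pointed_site T J e" and W: "cech_cover T J e W"
    and p: "has_cocycle T G P W p k" and q: "has_cocycle T G Q W q k"
begin

lemma cover_sections:
  assumes b: "b \<in> into_cover T W"
  shows "b \<in> into T (Cod T b)" "p (Cod T b) \<in> sec P (Cod T b)" "q (Cod T b) \<in> sec Q (Cod T b)"
    "res P b (p (Cod T b)) \<in> sec P (Dom T b)" "res Q b (q (Cod T b)) \<in> sec Q (Dom T b)"
proof -
  show b': "b \<in> into T (Cod T b)" using b by (simp add: into_cover_def into_I)
  show s: "p (Cod T b) \<in> sec P (Cod T b)" "q (Cod T b) \<in> sec Q (Cod T b)"
    using b p q by (auto simp: into_cover_def has_cocycle_def)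
  show "res P b (p (Cod T b)) \<in> sec P (Dom T b)" "res Q b (q (Cod T b)) \<in> sec Q (Dom T b)"
    using P.res_closed[OF b' s(1)] Q.res_closed[OF b' s(2)] .
qed

text \<open>Here the cocycles have to be equal: changing the arrow \<open>b\<close> into the covering changes the section of
  \<open>P\<close> and that of \<open>Q\<close> by the same group element.\<close>

lemma cover_graph_func:
  assumes t: "t \<in> Ob T" and m: "(y, z) \<in> cover_graph T G P Q W p q t"
    "(y, z') \<in> cover_graph T G P Q W p q t"
  shows "z = z'"
proof -
  interpret group "grp G t" by (rule P.group_grp[OF t])
  obtain b g where b: "b \<in> into_cover T W" "Dom T b = t" "g \<in> carrier (grp G t)"
    "y = ract P t (res P b (p (Cod T b))) g" "z = ract Q t (res Q b (q (Cod T b))) g"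
    using m(1) unfolding cover_graph_def by blast
  obtain b' g' where b': "b' \<in> into_cover T W" "Dom T b' = t" "g' \<in> carrier (grp G t)"
    "y = ract P t (res P b' (p (Cod T b'))) g'" "z' = ract Q t (res Q b' (q (Cod T b'))) g'"
    using m(2) unfolding cover_graph_def by blast
  note s = cover_sections(4,5)[OF b(1), unfolded b(2)]
  have kP: "k b b' \<in> carrier (grp G t)"
    "res P b' (p (Cod T b')) = ract P t (res P b (p (Cod T b))) (k b b')"
    using p b(1,2) b'(1,2) unfolding has_cocycle_def by force+
  have kQ: "res Q b' (q (Cod T b')) = ract Q t (res Q b (q (Cod T b))) (k b b')"
    using q b(1,2) b'(1,2) unfolding has_cocycle_def by force
  have "ract P t (res P b (p (Cod T b))) g = ract P t (res P b (p (Cod T b))) (k b b' \<otimes>\<^bsub>grp G t\<^esub> g')"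
    using b(4) b'(4) kP P.act_mult[OF t s(1) kP(1) b'(3)] by simp
  then have "g = k b b' \<otimes>\<^bsub>grp G t\<^esub> g'"
    using P.free[OF t s(1) b(3)] kP(1) b'(3) by simp
  then show ?thesis using b(5) b'(5) kQ Q.act_mult[OF t s(2) kP(1) b'(3)] by simp
qed

lemma cover_graph_act:
  assumes t: "t \<in> Ob T" and m: "(y, z) \<in> cover_graph T G P Q W p q t" and h: "h \<in> carrier (grp G t)"
  shows "(ract P t y h, ract Q t z h) \<in> cover_graph T G P Q W p q t"
proof -
  interpret group "grp G t" by (rule P.group_grp[OF t])
  obtain b g where b: "b \<in> into_cover T W" "Dom T b = t" "g \<in> carrier (grp G t)"
    "y = ract P t (res P b (p (Cod T b))) g" "z = ract Q t (res Q b (q (Cod T b))) g"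
    using m unfolding cover_graph_def by blast
  note s = cover_sections(4,5)[OF b(1), unfolded b(2)]
  have "ract P t y h = ract P t (res P b (p (Cod T b))) (g \<otimes>\<^bsub>grp G t\<^esub> h)"
    "ract Q t z h = ract Q t (res Q b (q (Cod T b))) (g \<otimes>\<^bsub>grp G t\<^esub> h)"
    using P.act_mult[OF t s(1) b(3) h] Q.act_mult[OF t s(2) b(3) h] b(4,5) by auto
  then show ?thesis unfolding cover_graph_def using b(1,2,3) h m_closed by blast
qed

lemma cover_graph_res:
  assumes \<psi>: "\<psi> \<in> into T t" and m: "(y, z) \<in> cover_graph T G P Q W p q t"
  shows "(res P \<psi> y, res Q \<psi> z) \<in> cover_graph T G P Q W p q (Dom T \<psi>)"
proof -
  obtain b g where b: "b \<in> into_cover T W" "Dom T b = t" "g \<in> carrier (grp G t)"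
    "y = ract P t (res P b (p (Cod T b))) g" "z = ract Q t (res Q b (q (Cod T b))) g"
    using m unfolding cover_graph_def by blast
  note s = cover_sections[OF b(1), unfolded b(2)]
  have \<psi>': "\<psi> \<in> into T (Dom T b)" using \<psi> b(2) by simp
  note c = into_Cmp[OF P.cat s(1) \<psi>'] Dom_Cmp[OF P.cat s(1) \<psi>']
  have cb: "Cmp T b \<psi> \<in> into_cover T W" "Cod T (Cmp T b \<psi>) = Cod T b"
    using c(1) b(1) by (auto simp: into_cover_def into_def)
  have "res P \<psi> y = ract P (Dom T \<psi>) (res P (Cmp T b \<psi>) (p (Cod T b))) (gres G \<psi> g)"
    "res Q \<psi> z = ract Q (Dom T \<psi>) (res Q (Cmp T b \<psi>) (q (Cod T b))) (gres G \<psi> g)"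
    using P.res_act[OF \<psi> s(4) b(3)] Q.res_act[OF \<psi> s(5) b(3)] b(4,5)
      P.res_Cmp[OF s(1) \<psi>' s(2)] Q.res_Cmp[OF s(1) \<psi>' s(3)] by auto
  then show ?thesis
    unfolding cover_graph_def using cb c(2) P.gres_closed[OF \<psi> b(3)] by force
qed

lemma cover_graph_ex1:
  assumes t: "t \<in> Ob T" and y: "y \<in> sec P t"
  shows "\<exists>!z. z \<in> sec Q t \<and> (\<forall>a\<in>{a \<in> into T t. \<exists>b\<in>into_cover T W. Dom T b = Dom T a}.
    (res P a y, res Q a z) \<in> cover_graph T G P Q W p q (Dom T a))"
proof (rule graph_glue[OF t pointed_site.cover_everywhere[OF site W t] _ _ _ _ _ y])
  fix a assume "a \<in> {a \<in> into T t. \<exists>b\<in>into_cover T W. Dom T b = Dom T a}"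
  then obtain b where a: "a \<in> into T t" and b: "b \<in> into_cover T W" "Dom T b = Dom T a" by blast
  note o = into_Dom[OF P.cat a]
  interpret group "grp G (Dom T a)" by (rule P.group_grp[OF o])
  show "cover_graph T G P Q W p q (Dom T a) \<noteq> {}"
    unfolding cover_graph_def using b one_closed by blast
  show "cover_graph T G P Q W p q (Dom T a) \<subseteq> sec P (Dom T a) \<times> sec Q (Dom T a)"
  proof
    fix m assume "m \<in> cover_graph T G P Q W p q (Dom T a)"
    then obtain b g where b: "b \<in> into_cover T W" "Dom T b = Dom T a" "g \<in> carrier (grp G (Dom T a))"
      and m: "m = (ract P (Dom T a) (res P b (p (Cod T b))) g, ract Q (Dom T a) (res Q b (q (Cod T b))) g)"
      unfolding cover_graph_def by blast
    show "m \<in> sec P (Dom T a) \<times> sec Q (Dom T a)"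
      using cover_sections(4,5)[OF b(1), unfolded b(2)] P.act_closed[OF o _ b(3)] Q.act_closed[OF o _ b(3)]
      by (simp add: m)
  qed
  show "z = z'" if "(y, z) \<in> cover_graph T G P Q W p q (Dom T a)"
    "(y, z') \<in> cover_graph T G P Q W p q (Dom T a)" for y z z'
    using cover_graph_func[OF o that] .
  show "(ract P (Dom T a) y g, ract Q (Dom T a) z g) \<in> cover_graph T G P Q W p q (Dom T a)"
    if "(y, z) \<in> cover_graph T G P Q W p q (Dom T a)" "g \<in> carrier (grp G (Dom T a))" for y z g
    using cover_graph_act[OF o that] .
  show "(res P \<psi> y, res Q \<psi> z) \<in> cover_graph T G P Q W p q (Dom T (Cmp T a \<psi>))"
    if "\<psi> \<in> into T (Dom T a)" "(y, z) \<in> cover_graph T G P Q W p q (Dom T a)" for \<psi> y z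
    using cover_graph_res[OF that] Dom_Cmp[OF P.cat a that(1)] by simp
qed

end

text \<open>Two torsors with the same cocycle on a common covering are isomorphic: matching the given local
  sections with each other is an isomorphism locally, and equality of the cocycles says that the
  local isomorphisms agree.\<close>

lemma isomorphic_of_cocycle:
  assumes site: "pointed_site T J e" and W: "cech_cover T J e W"
    and p: "has_cocycle T G P W p k" and q: "has_cocycle T G Q W q k"
  shows "torsors_isomorphic T G P Q"
proof -
  interpret swap: torsor_pair T J G Q P ..
  let ?R = "\<lambda>t. {a \<in> into T t. \<exists>b\<in>into_cover T W. Dom T b = Dom T a}"
  let ?L = "cover_graph T G P Q W p q"
  let ?H = "\<lambda>t. {(y, z). y \<in> sec P t \<and> z \<in> sec Q t \<and> (\<forall>a\<in>?R t. (res P a y, res Q a z) \<in> ?L (Dom T a))}"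
  show ?thesis
  proof (rule torsors_isomorphic_of_graph[where H = ?H, OF _ _ _ P.cat])
    show "?H t \<subseteq> sec P t \<times> sec Q t" for t by blast
    show "\<exists>!z. (y, z) \<in> ?H t" if "t \<in> Ob T" "y \<in> sec P t" for t y
      using cover_graph_ex1[OF site W p q that] that(2) by simp
    show "\<exists>!y. (y, z) \<in> ?H t" if "t \<in> Ob T" "z \<in> sec Q t" for t z
      using swap.cover_graph_ex1[OF site W q p that] that(2)
      by (simp add: cover_graph_converse[of T G Q P W q p] conj_ac)
    show "(res P \<phi> y, res Q \<phi> z) \<in> ?H (Dom T \<phi>)" if \<phi>: "\<phi> \<in> into T t" and m: "(y, z) \<in> ?H t" for t \<phi> y z
    proof -
      have "(res P a (res P \<phi> y), res Q a (res Q \<phi> z)) \<in> ?L (Dom T a)" if "a \<in> ?R (Dom T \<phi>)" for a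
      proof -
        have a: "a \<in> into T (Dom T \<phi>)" using that by blast
        have "Cmp T \<phi> a \<in> ?R t"
          using that into_Cmp[OF P.cat \<phi> a] Dom_Cmp[OF P.cat \<phi> a] by auto
        then have "(res P (Cmp T \<phi> a) y, res Q (Cmp T \<phi> a) z) \<in> ?L (Dom T (Cmp T \<phi> a))"
          using m by blast
        then show ?thesis
          using P.res_Cmp[OF \<phi> a] Q.res_Cmp[OF \<phi> a] Dom_Cmp[OF P.cat \<phi> a] m by simp
      qed
      then show ?thesis using m P.res_closed[OF \<phi>] Q.res_closed[OF \<phi>] by simp
    qed
    show "(ract P t y g, ract Q t z g) \<in> ?H t"
      if t: "t \<in> Ob T" and m: "(y, z) \<in> ?H t" and g: "g \<in> carrier (grp G t)" for t y z g
    proof -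
      have "(res P a (ract P t y g), res Q a (ract Q t z g)) \<in> ?L (Dom T a)" if "a \<in> ?R t" for a
      proof -
        have a: "a \<in> into T t" using that by blast
        have "(res P a y, res Q a z) \<in> ?L (Dom T a)" using m that by blast
        then show ?thesis
          using cover_graph_act[OF site W p q into_Dom[OF P.cat a] _ P.gres_closed[OF a g]]
            P.res_act[OF a _ g] Q.res_act[OF a _ g] m by simp
      qed
      then show ?thesis using m P.act_closed[OF t _ g] Q.act_closed[OF t _ g] by simp
    qed
  qed
qed

end

text \<open>Cover \<open>e\<close> by the sources of arrows over which \<open>P\<close> has sections and choose one section on each.  The
  element comparing two of them is unique, which gives the cocycle identities.\<close>

lemma (in torsor) exists_cocycle:
  assumes site: "pointed_site T J e"
  obtains W p k where "cech_cocycle T J e G (W, k)" "has_cocycle T G P W p k"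
proof -
  interpret S: pointed_site T J e by (rule site)
  obtain R where R: "R \<in> J e" and ne: "\<And>\<phi>. \<phi> \<in> R \<Longrightarrow> sec P (Dom T \<phi>) \<noteq> {}"
    using locally_nonempty[OF S.e] by blast
  note into = sieve_into[OF R]
  define W where "W = Dom T ` R"
  have W: "W \<subseteq> Ob T" unfolding W_def using into_Dom[OF cat into] by blast
  have cover: "cech_cover T J e W"
    unfolding cech_cover_def
  proof (rule conjI[OF W S.super[OF R]])
    let ?F = "{f \<in> into T e. Dom T f \<in> W}"
    show "R \<subseteq> sieve_gen T ?F"
    proof
      fix f assume f: "f \<in> R"
      then have "f \<in> ?F" using into unfolding W_def by blast
      moreover have "f = Cmp T f (Idn T (Dom T f))" using Cmp_Idn_right[OF cat into[OF f]] by simp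
      ultimately show "f \<in> sieve_gen T ?F"
        unfolding sieve_gen_def using into_Idn[OF cat into_Dom[OF cat into[OF f]]] by blast
    qed
    show "is_sieve T e (sieve_gen T ?F)" by (rule is_sieve_gen[OF cat]) blast
  qed
  define p where "p U = (SOME v. v \<in> sec P U)" for U
  have p: "p U \<in> sec P U" if "U \<in> W" for U
    unfolding p_def using ne that by (auto simp: W_def some_in_eq)
  define k where "k a b = (THE g. g \<in> carrier (grp G (Dom T a)) \<and>
    ract P (Dom T a) (res P a (p (Cod T a))) g = res P b (p (Cod T b)))" for a b
  have a_into: "a \<in> into T (Cod T a)" if "a \<in> into_cover T W" for a
    using that by (simp add: into_cover_def into_I)
  have pa: "res P a (p (Cod T a)) \<in> sec P (Dom T a)" if "a \<in> into_cover T W" for a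
    using res_closed[OF a_into[OF that]] p that by (simp add: into_cover_def)
  have o: "Dom T a \<in> Ob T" if "a \<in> into_cover T W" for a
    using into_Dom[OF cat a_into[OF that]] .
  have k: "k a b \<in> carrier (grp G (Dom T a))"
    "ract P (Dom T a) (res P a (p (Cod T a))) (k a b) = res P b (p (Cod T b))"
    if "a \<in> into_cover T W" "b \<in> into_cover T W" "Dom T a = Dom T b" for a b
    using theI'[OF difference[OF o[OF that(1)] pa[OF that(1)] pa[OF that(2), folded that(3)]]]
    unfolding k_def by auto
  have has: "has_cocycle T G P W p k"
    unfolding has_cocycle_def using p k by blast
  have "gres G j (k a b) = k (Cmp T a j) (Cmp T b j)"
    if a: "a \<in> into_cover T W" and b: "b \<in> into_cover T W" and D: "Dom T a = Dom T b"
      and j: "j \<in> into T (Dom T a)" for a b j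
  proof -
    have jb: "j \<in> into T (Dom T b)" using j D by simp
    have c: "Cmp T a j \<in> into_cover T W" "Cmp T b j \<in> into_cover T W"
      "Cod T (Cmp T a j) = Cod T a" "Cod T (Cmp T b j) = Cod T b"
      "Dom T (Cmp T a j) = Dom T j" "Dom T (Cmp T b j) = Dom T j"
      using into_Cmp[OF cat a_into[OF a] j] into_Cmp[OF cat a_into[OF b] jb] a b
        Dom_Cmp[OF cat a_into[OF a] j] Dom_Cmp[OF cat a_into[OF b] jb]
      by (auto simp: into_cover_def into_def)
    have r: "res P (Cmp T a j) (p (Cod T a)) = res P j (res P a (p (Cod T a)))"
      "res P (Cmp T b j) (p (Cod T b)) = res P j (res P b (p (Cod T b)))"
      using res_Cmp[OF a_into[OF a] j] res_Cmp[OF a_into[OF b] jb] p a b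
      by (auto simp: into_cover_def)
    have "ract P (Dom T j) (res P (Cmp T a j) (p (Cod T a))) (gres G j (k a b))
        = res P (Cmp T b j) (p (Cod T b))"
      using res_act[OF j pa[OF a] k(1)[OF a b D]] k(2)[OF a b D] by (simp add: r)
    moreover have "ract P (Dom T j) (res P (Cmp T a j) (p (Cod T a))) (k (Cmp T a j) (Cmp T b j))
        = res P (Cmp T b j) (p (Cod T b))"
      using k(2)[OF c(1,2)] c by simp
    ultimately show ?thesis
      using free[OF into_Dom[OF cat j] _ gres_closed[OF j k(1)[OF a b D]]] pa[OF c(1)] k(1)[OF c(1,2)] c
      by metis
  qed
  moreover have "k a b \<otimes>\<^bsub>grp G (Dom T a)\<^esub> k b c = k a c"
    if a: "a \<in> into_cover T W" and b: "b \<in> into_cover T W" and D: "Dom T a = Dom T b"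
      and c: "c \<in> into_cover T W" and D': "Dom T c = Dom T a" for a b c
  proof -
    interpret group "grp G (Dom T a)" by (rule group_grp[OF o[OF a]])
    have kb: "k b c \<in> carrier (grp G (Dom T a))"
      "ract P (Dom T a) (res P b (p (Cod T b))) (k b c) = res P c (p (Cod T c))"
      using k[OF b c] D D' by auto
    show ?thesis
      by (rule free[OF o[OF a] pa[OF a] m_closed[OF k(1)[OF a b D] kb(1)] k(1)[OF a c D'[symmetric]]])
        (use act_mult[OF o[OF a] pa[OF a] k(1)[OF a b D] kb(1)] k(2)[OF a b D] kb(2)
            k(2)[OF a c D'[symmetric]] in simp)
  qed
  ultimately have "cech_cocycle T J e G (W, k)"
    unfolding cech_cocycle_def using cover k by auto
  then show thesis using that has by blast
qed

text \<open>Cocycles with the same class in the colimit become cohomologous on a common refinement, where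
  changing the sections of one torsor by the coboundary makes the cocycles equal.\<close>

lemma (in torsor_pair) isomorphic_of_cech_rel:
  assumes site: "pointed_site T J e"
    and p: "has_cocycle T G P U p k" and q: "has_cocycle T G Q V q h"
    and rel: "((U, k), (V, h)) \<in> cech_rel T J e G"
  shows "torsors_isomorphic T G P Q"
proof -
  have "\<exists>W r s c. cech_cover T J e W \<and> refinement T W U r \<and> refinement T W V s \<and>
        (\<forall>w\<in>W. c w \<in> carrier (grp G w)) \<and>
        (\<forall>a\<in>into_cover T W. \<forall>b\<in>into_cover T W. Dom T a = Dom T b \<longrightarrow>
           gres G a (c (Cod T a)) \<otimes>\<^bsub>grp G (Dom T a)\<^esub>
             h (Cmp T (s (Cod T a)) a) (Cmp T (s (Cod T b)) b) =
           k (Cmp T (r (Cod T a)) a) (Cmp T (r (Cod T b)) b) \<otimes>\<^bsub>grp G (Dom T a)\<^esub>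
             gres G b (c (Cod T b)))"
    using rel unfolding cech_rel_def by simp
  then obtain W r s c where W: "cech_cover T J e W" and r: "refinement T W U r"
    and s: "refinement T W V s" and c: "\<And>w. w \<in> W \<Longrightarrow> c w \<in> carrier (grp G w)"
    and cob: "\<And>a b. a \<in> into_cover T W \<Longrightarrow> b \<in> into_cover T W \<Longrightarrow> Dom T a = Dom T b \<Longrightarrow>
           gres G a (c (Cod T a)) \<otimes>\<^bsub>grp G (Dom T a)\<^esub>
             h (Cmp T (s (Cod T a)) a) (Cmp T (s (Cod T b)) b) =
           k (Cmp T (r (Cod T a)) a) (Cmp T (r (Cod T b)) b) \<otimes>\<^bsub>grp G (Dom T a)\<^esub>
             gres G b (c (Cod T b))" by blast
  have W_Ob: "w \<in> Ob T" if "w \<in> W" for w using W that unfolding cech_cover_def by blast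
  \<comment> \<open>The sections of \<open>P\<close> are restricted along \<open>r\<close>.  Those of \<open>Q\<close> are restricted along \<open>s\<close> and divided
    by the coboundary \<open>c\<close>.  Both families then have the cocycle \<open>k\<close> restricted along \<open>r\<close>.\<close>
  define p' where "p' w = res P (r w) (p (Cod T (r w)))" for w
  define q' where "q' w = ract Q w (res Q (s w) (q (Cod T (s w)))) (inv\<^bsub>grp G w\<^esub> (c w))" for w
  define k' where "k' a b = k (Cmp T (r (Cod T a)) a) (Cmp T (r (Cod T b)) b)" for a b
  have refine: "f w \<in> into T (Cod T (f w))" "Dom T (f w) = w" "Cod T (f w) \<in> V'"
    if "refinement T W V' f" "w \<in> W" for V' f w
    using that by (auto simp: refinement_def into_I)
  have comp: "Cmp T (f (Cod T a)) a \<in> into_cover T V'" "Cod T (Cmp T (f (Cod T a)) a) = Cod T (f (Cod T a))"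
    "Dom T (Cmp T (f (Cod T a)) a) = Dom T a"
    if f: "refinement T W V' f" and a: "a \<in> into_cover T W" for V' f a
  proof -
    have w: "Cod T a \<in> W" and a': "a \<in> into T (Dom T (f (Cod T a)))"
      using a refine(2)[OF f, of "Cod T a"] by (simp_all add: into_cover_def into_I)
    have "Cmp T (f (Cod T a)) a \<in> into T (Cod T (f (Cod T a)))"
      by (rule into_Cmp[OF P.cat refine(1)[OF f w] a'])
    then show "Cmp T (f (Cod T a)) a \<in> into_cover T V'"
      "Cod T (Cmp T (f (Cod T a)) a) = Cod T (f (Cod T a))"
      using refine(3)[OF f w] by (auto simp: into_cover_def into_def)
    show "Dom T (Cmp T (f (Cod T a)) a) = Dom T a" by (rule Dom_Cmp[OF P.cat refine(1)[OF f w] a'])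
  qed
  have pU: "p u \<in> sec P u" if "u \<in> U" for u using p that by (simp add: has_cocycle_def)
  have qV: "q v \<in> sec Q v" if "v \<in> V" for v using q that by (simp add: has_cocycle_def)
  have q0: "res Q (s w) (q (Cod T (s w))) \<in> sec Q w" if "w \<in> W" for w
    using Q.res_closed[OF refine(1)[OF s that] qV[OF refine(3)[OF s that]]] refine(2)[OF s that] by simp
  have ci: "inv\<^bsub>grp G w\<^esub> (c w) \<in> carrier (grp G w)" if "w \<in> W" for w
    using group.inv_closed[OF P.group_grp[OF W_Ob[OF that]] c[OF that]] .
  have pr: "res P a (p' (Cod T a)) = res P (Cmp T (r (Cod T a)) a) (p (Cod T (r (Cod T a))))"
    if a: "a \<in> into_cover T W" for a
  proof -
    have w: "Cod T a \<in> W" and a': "a \<in> into T (Dom T (r (Cod T a)))"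
      using a refine(2)[OF r, of "Cod T a"] by (simp_all add: into_cover_def into_I)
    show ?thesis
      unfolding p'_def using P.res_Cmp[OF refine(1)[OF r w] a' pU[OF refine(3)[OF r w]]] by simp
  qed
  have qr: "res Q a (q' (Cod T a)) = ract Q (Dom T a)
      (res Q (Cmp T (s (Cod T a)) a) (q (Cod T (s (Cod T a))))) (inv\<^bsub>grp G (Dom T a)\<^esub> (gres G a (c (Cod T a))))"
    if a: "a \<in> into_cover T W" for a
  proof -
    have w: "Cod T a \<in> W" and a': "a \<in> into T (Dom T (s (Cod T a)))" and a'': "a \<in> into T (Cod T a)"
      using a refine(2)[OF s, of "Cod T a"] by (simp_all add: into_cover_def into_I)
    interpret h: group_hom "grp G (Cod T a)" "grp G (Dom T a)" "gres G a"
      by (intro group_hom.intro group_hom_axioms.intro P.group_grp into_Dom[OF P.cat a'']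
          W_Ob[OF w] P.gres_hom into_Arr[OF a''])
    show ?thesis
      unfolding q'_def
      using Q.res_act[OF a'' q0[OF w] ci[OF w]] h.hom_inv[OF c[OF w]]
        Q.res_Cmp[OF refine(1)[OF s w] a' qV[OF refine(3)[OF s w]]] by simp
  qed
  have "has_cocycle T G P W p' k'"
    unfolding has_cocycle_def
  proof (intro conjI ballI impI)
    show "p' w \<in> sec P w" if "w \<in> W" for w
      unfolding p'_def
      using P.res_closed[OF refine(1)[OF r that] pU[OF refine(3)[OF r that]]] refine(2)[OF r that] by simp
    fix a b assume a: "a \<in> into_cover T W" and b: "b \<in> into_cover T W" and D: "Dom T a = Dom T b"
    have *: "k' a b \<in> carrier (grp G (Dom T a)) \<and>
      ract P (Dom T a) (res P (Cmp T (r (Cod T a)) a) (p (Cod T (r (Cod T a))))) (k' a b)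
        = res P (Cmp T (r (Cod T b)) b) (p (Cod T (r (Cod T b))))"
      using p comp[OF r a] comp[OF r b] D unfolding has_cocycle_def k'_def by metis
    then show "k' a b \<in> carrier (grp G (Dom T a))" by blast
    show "ract P (Dom T a) (res P a (p' (Cod T a))) (k' a b) = res P b (p' (Cod T b))"
      using * by (simp add: pr[OF a] pr[OF b])
  qed
  moreover have "has_cocycle T G Q W q' k'"
    unfolding has_cocycle_def
  proof (intro conjI ballI impI)
    show "q' w \<in> sec Q w" if "w \<in> W" for w
      unfolding q'_def by (rule Q.act_closed[OF W_Ob[OF that] q0[OF that] ci[OF that]])
    fix a b assume a: "a \<in> into_cover T W" and b: "b \<in> into_cover T W" and D: "Dom T a = Dom T b"
    have into: "a \<in> into T (Cod T a)" "b \<in> into T (Cod T b)" and w: "Cod T a \<in> W" "Cod T b \<in> W"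
      using a b by (simp_all add: into_cover_def into_I)
    note o = into_Dom[OF P.cat into(1)]
    interpret group "grp G (Dom T a)" by (rule P.group_grp[OF o])
    let ?h = "h (Cmp T (s (Cod T a)) a) (Cmp T (s (Cod T b)) b)"
    let ?qa = "res Q (Cmp T (s (Cod T a)) a) (q (Cod T (s (Cod T a))))"
    let ?qb = "res Q (Cmp T (s (Cod T b)) b) (q (Cod T (s (Cod T b))))"
    let ?ca = "gres G a (c (Cod T a))" and ?cb = "gres G b (c (Cod T b))"
    have cs: "?ca \<in> carrier (grp G (Dom T a))" "?cb \<in> carrier (grp G (Dom T a))"
      using P.gres_closed[OF into(1) c[OF w(1)]] P.gres_closed[OF into(2) c[OF w(2)]] D by auto
    have h: "?h \<in> carrier (grp G (Dom T a))" "ract Q (Dom T a) ?qa ?h = ?qb"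
      using q comp[OF s a] comp[OF s b] D unfolding has_cocycle_def by metis+
    show k: "k' a b \<in> carrier (grp G (Dom T a))"
      using p comp[OF r a] comp[OF r b] D unfolding has_cocycle_def k'_def by metis
    have "Cod T (s (Cod T a)) \<in> V" by (rule refine(3)[OF s w(1)])
    then have qa: "?qa \<in> sec Q (Dom T a)"
      using Q.res_closed[OF into_I[of "Cmp T (s (Cod T a)) a" T]] comp[OF s a] qV
      by (simp add: into_cover_def)
    have "inv\<^bsub>grp G (Dom T a)\<^esub> ?ca \<otimes>\<^bsub>grp G (Dom T a)\<^esub> k' a b
        = ?h \<otimes>\<^bsub>grp G (Dom T a)\<^esub> inv\<^bsub>grp G (Dom T a)\<^esub> ?cb"
    proof -
      have e: "?ca \<otimes>\<^bsub>grp G (Dom T a)\<^esub> ?h = k' a b \<otimes>\<^bsub>grp G (Dom T a)\<^esub> ?cb"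
        using cob[OF a b D] unfolding k'_def .
      then have "k' a b = ?ca \<otimes>\<^bsub>grp G (Dom T a)\<^esub> ?h \<otimes>\<^bsub>grp G (Dom T a)\<^esub> inv\<^bsub>grp G (Dom T a)\<^esub> ?cb"
        using cs h(1) k by (simp add: m_assoc)
      then show ?thesis using cs h(1) by (simp add: m_assoc[symmetric])
    qed
    then show "ract Q (Dom T a) (res Q a (q' (Cod T a))) (k' a b) = res Q b (q' (Cod T b))"
      using Q.act_mult[OF o qa inv_closed[OF cs(1)] k] Q.act_mult[OF o qa h(1) inv_closed[OF cs(2)]] h(2) D
      by (simp add: qr[OF a] qr[OF b])
  qed
  ultimately show ?thesis by (rule isomorphic_of_cocycle[OF site W])
qed

text \<open>Take for \<open>\<sigma>\<close> the class of a cocycle of \<open>P\<close>.  A cocycle of \<open>Z \<sigma>\<close> that belongs to \<open>\<sigma>\<close> is then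
  cohomologous to it on a refinement.\<close>

lemma (in torsor) isomorphic_to_representative:
  assumes site: "pointed_site T J e"
    and Z: "\<And>\<sigma>. \<sigma> \<in> cech_H1 T J e G \<Longrightarrow> represents T J e G (Z \<sigma>) \<sigma>"
  obtains \<sigma> where "\<sigma> \<in> cech_H1 T J e G" "torsors_isomorphic T G P (Z \<sigma>)"
proof -
  obtain U p k where k: "cech_cocycle T J e G (U, k)" "has_cocycle T G P U p k"
    by (rule exists_cocycle[OF site])
  let ?\<sigma> = "cech_rel T J e G `` {(U, k)}"
  have \<sigma>: "?\<sigma> \<in> cech_H1 T J e G"
    unfolding cech_H1_def using k(1) by (intro quotientI) simp
  then have rep: "represents T J e G (Z ?\<sigma>) ?\<sigma>" by (rule Z)
  then obtain V h z where V: "((U, k), (V, h)) \<in> cech_rel T J e G"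
    and z: "\<forall>v\<in>V. z v \<in> sec (Z ?\<sigma>) v"
      "\<forall>a\<in>into_cover T V. \<forall>b\<in>into_cover T V. Dom T a = Dom T b \<longrightarrow>
        ract (Z ?\<sigma>) (Dom T a) (res (Z ?\<sigma>) a (z (Cod T a))) (h a b) = res (Z ?\<sigma>) b (z (Cod T b))"
    unfolding represents_def by blast
  interpret torsor_pair T J G P "Z ?\<sigma>"
    using rep cat sieve group_grp gres_hom
    by (intro torsor_pair.intro torsor_axioms torsor.intro) (auto simp: represents_def)
  have "cech_cocycle T J e G (V, h)" using V by (simp add: cech_rel_def)
  then have "has_cocycle T G (Z ?\<sigma>) V z h"
    using z unfolding has_cocycle_def cech_cocycle_def by auto
  then have "torsors_isomorphic T G P (Z ?\<sigma>)"
    using isomorphic_of_cech_rel[OF site k(2)] V by blast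
  with \<sigma> show thesis by (rule that)
qed

section \<open>From sections of the twist to isomorphisms of torsors\<close>

lemma homs_D:
  assumes "x \<in> homs A X"
  shows "is_fctr A X x" "onO x \<in> extensional (Ob A)" "onA x \<in> extensional (Arr A)"
    "t \<in> Ob A \<Longrightarrow> prO X (onO x t) = prO A t" "a \<in> Arr A \<Longrightarrow> prA X (onA x a) = prA A a"
  using assms by (simp_all add: homs_def)

lemma fctr_Ob: "is_fctr A X x \<Longrightarrow> t \<in> Ob A \<Longrightarrow> onO x t \<in> Ob X"
  and fctr_Idn: "is_fctr A X x \<Longrightarrow> t \<in> Ob A \<Longrightarrow> onA x (Idn A t) = Idn X (onO x t)"
  and fctr_into: "is_fctr A X x \<Longrightarrow> a \<in> into A t \<Longrightarrow> onA x a \<in> into X (onO x t)"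
  and fctr_Dom: "is_fctr A X x \<Longrightarrow> a \<in> into A t \<Longrightarrow> Dom X (onA x a) = onO x (Dom A a)"
  and fctr_Cmp: "is_fctr A X x \<Longrightarrow> a \<in> into A t \<Longrightarrow> b \<in> into A (Dom A a) \<Longrightarrow>
    onA x (Cmp A a b) = Cmp X (onA x a) (onA x b)"
  by (auto simp: is_fctr_def into_def)

lemma group_sheaf_res_Idn:
  assumes "is_group_sheaf C J G" "t \<in> Ob C" "g \<in> carrier (grp G t)"
  shows "gres G (Idn C t) g = g"
proof -
  have "is_presheaf C \<lparr>sec = (\<lambda>t. carrier (grp G t)), res = gres G\<rparr>"
    using assms(1) by (simp add: is_group_sheaf_def is_sheaf_def)
  then show ?thesis using assms(2,3) by (simp add: is_presheaf_def)
qed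

locale twisting = site C J + X: fibred_category C X
  for C :: "('bo, 'ba) cat" and J and X :: "('o, 'a, 'bo, 'ba) fib" +
  fixes G :: "('bo, 'ba, 'g) gpsh" and Y :: "('o, 'a, 'v, 'g) rpsh" and Z :: "('bo, 'ba, 'w, 'g) rpsh"
  assumes G: "is_group_sheaf C J G" and Y: "torsor_over J G X Y" and Z: "is_torsor C J G Z"
begin

abbreviation GX where "GX \<equiv> pull_gpsh (str X) G"
abbreviation ZX where "ZX \<equiv> pull_torsor (str X) Z"
abbreviation tw where "tw \<equiv> twist C J G X Y Z"

lemma sel:
  "grp GX t = grp G (prO X t)" "gres GX \<phi> = gres G (prA X \<phi>)"
  "sec ZX t = sec Z (prO X t)" "res ZX \<phi> = res Z (prA X \<phi>)" "ract ZX t = ract Z (prO X t)"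
  by (simp_all add: pull_gpsh_def pull_torsor_def str_def)

text \<open>The twist is a contracted product of two torsors on \<open>X\<close> under the same group: \<open>Y\<close> and the
  pull-back of \<open>Z\<close>.\<close>

sublocale contracted X "inherit J X" GX Y ZX "pull_bipsh (str X) (inverse_torsor C G Z)"
proof -
  interpret ZX: torsor X "inherit J X" GX ZX by (rule X.torsor_pull[OF sieve G Z])
  show "contracted X (inherit J X) GX Y ZX (pull_bipsh (str X) (inverse_torsor C G Z))"
  proof (intro contracted.intro torsor_pair.intro ZX.torsor_axioms contracted_axioms.intro)
    show "torsor X (inherit J X) GX Y"
      using Y ZX.cat ZX.sieve ZX.group_grp ZX.gres_hom
      by (intro torsor.intro) (auto simp: torsor_over_def)
    show "sec (pull_bipsh (str X) (inverse_torsor C G Z)) = sec ZX"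
      "res (pull_bipsh (str X) (inverse_torsor C G Z)) = res ZX"
      by (simp_all add: pull_bipsh_def inverse_torsor_def pull_torsor_def)
    show "lact (pull_bipsh (str X) (inverse_torsor C G Z)) t (inv\<^bsub>grp GX t\<^esub> g) z = ract ZX t z g"
      if "t \<in> Ob X" "g \<in> carrier (grp GX t)" for t g z
      using group.inv_inv[OF ZX.group_grp[OF that(1)] that(2)]
      by (simp add: pull_bipsh_def inverse_torsor_def pull_torsor_def pull_gpsh_def)
  qed
qed

lemma sec_tw: "sec tw = sec (sheafify X (inherit J X) F)"
  and res_tw: "res tw \<chi> E \<phi> = (if \<phi> \<in> into X (Dom X \<chi>) then E (Cmp X \<chi> \<phi>) else {})"
  by (simp_all add: twist_def contracted_product_def sheafify_def)

text \<open>A section of the twist over \<open>x\<close> is a \<open>G\<close>-isomorphism between the restrictions of the two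
  torsors to the objects over \<open>x\<close>; sections over the objects \<open>x t\<close> that are compatible with
  restriction therefore assemble to an isomorphism on \<open>A\<close>.\<close>

lemma isomorphic_of_sections:
  fixes A :: "('oa, 'aa, 'bo, 'ba) fib"
  assumes A: "is_cat A" and x: "is_fctr A X x" and xO: "\<And>t. t \<in> Ob A \<Longrightarrow> prO X (onO x t) = prO A t"
    and xA: "\<And>a. a \<in> Arr A \<Longrightarrow> prA X (onA x a) = prA A a"
    and E: "\<And>t. t \<in> Ob A \<Longrightarrow> E t \<in> sec tw (onO x t)"
    and E_res: "\<And>t a. a \<in> into A t \<Longrightarrow> res tw (onA x a) (E t) = E (Dom A a)"
  shows "torsors_isomorphic A (pull_gpsh (str A) G) (pull_torsor x Y) (pull_torsor (str A) Z)"
proof (rule torsors_isomorphic_of_graph[where H = "\<lambda>t. graph (E t) (Idn X (onO x t))", OF _ _ _ A])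
  let ?H = "\<lambda>t. graph (E t) (Idn X (onO x t))"
  have sel': "sec (pull_torsor x Y) t = sec Y (onO x t)" "res (pull_torsor x Y) a = res Y (onA x a)"
    "ract (pull_torsor x Y) t = ract Y (onO x t)" "sec (pull_torsor (str A) Z) t = sec Z (prO A t)"
    "res (pull_torsor (str A) Z) a = res Z (prA A a)"
    "ract (pull_torsor (str A) Z) t = ract Z (prO A t)"
    "grp (pull_gpsh (str A) G) t = grp G (prO A t)" for t a
    by (simp_all add: pull_torsor_def pull_gpsh_def str_def)
  {
    fix t assume t: "t \<in> Ob A"
    note o = fctr_Ob[OF x t]
    note E' = E[OF t, unfolded sec_tw]
    note i = into_Idn[OF X.cat o] Dom_Idn[OF X.cat o]
    show "?H t \<subseteq> sec (pull_torsor x Y) t \<times> sec (pull_torsor (str A) Z) t"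
      using i(2) xO[OF t] by (auto simp: graph_def sel sel')
    show "\<exists>!z. (y, z) \<in> ?H t" if "y \<in> sec (pull_torsor x Y) t" for y
      using graph_bij(1)[OF o E' i(1)] that i(2) by (simp add: sel')
    show "\<exists>!y. (y, z) \<in> ?H t" if "z \<in> sec (pull_torsor (str A) Z) t" for z
      using graph_bij(2)[OF o E' i(1)] that i(2) xO[OF t] by (simp add: sel sel')
    show "(ract (pull_torsor x Y) t y g, ract (pull_torsor (str A) Z) t z g) \<in> ?H t"
      if "(y, z) \<in> ?H t" "g \<in> carrier (grp (pull_gpsh (str A) G) t)" for y z g
      using graph_act[OF o E' i(1) that(1), of g] that(2) i(2) xO[OF t] by (simp add: sel sel')
  }
  fix t a y z assume a: "a \<in> into A t" and m: "(y, z) \<in> ?H t"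
  have t: "t \<in> Ob A" by (rule into_Ob[OF A a])
  note o = fctr_Ob[OF x t]
  note xa = fctr_into[OF x a]
  have o': "onO x (Dom A a) \<in> Ob X" by (rule fctr_Ob[OF x into_Dom[OF A a]])
  have D: "Dom X (onA x a) = onO x (Dom A a)" by (rule fctr_Dom[OF x a])
  have "(res Y (onA x a) y, res ZX (onA x a) z) \<in> graph (E t) (Cmp X (Idn X (onO x t)) (onA x a))"
    by (rule graph_res[OF o E[OF t, unfolded sec_tw] into_Idn[OF X.cat o] _ m])
      (simp add: Dom_Idn[OF X.cat o] xa)
  then have "(res Y (onA x a) y, res ZX (onA x a) z) \<in> graph (E t) (onA x a)"
    by (simp add: Cmp_Idn_left[OF X.cat xa])
  moreover have "E (Dom A a) (Idn X (onO x (Dom A a))) = E t (onA x a)"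
    using E_res[OF a, symmetric] into_Idn[OF X.cat o'] Cmp_Idn_right[OF X.cat xa]
    by (simp add: res_tw D)
  ultimately show "(res (pull_torsor x Y) a y, res (pull_torsor (str A) Z) a z) \<in> ?H (Dom A a)"
    using xA[OF into_Arr[OF a]] Dom_Idn[OF X.cat o'] by (simp add: graph_def sel sel' D)
qed

text \<open>Isomorphic points have isomorphic pull-backs: restrict along the components of the
  2-isomorphism, which lie over identities and so do not change the acting group.\<close>

lemma isomorphic_of_homs_isomorphic:
  fixes A :: "('oa, 'aa, 'bo, 'ba) fib"
  assumes A: "is_cat A" and x: "is_fctr A X x" and xO: "\<And>t. t \<in> Ob A \<Longrightarrow> prO X (onO x t) = prO A t"
    and iso: "homs_isomorphic C A X x' x" and x': "is_fctr A X x'"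
  shows "torsors_isomorphic A (pull_gpsh (str A) G) (pull_torsor x Y) (pull_torsor x' Y)"
proof -
  obtain \<eta> \<theta> where \<eta>: "is_2mor C A X x' x \<eta>" and \<theta>: "is_2mor C A X x x' \<theta>"
    and inv: "\<And>t. t \<in> Ob A \<Longrightarrow> Cmp X (\<theta> t) (\<eta> t) = Idn X (onO x' t)"
      "\<And>t. t \<in> Ob A \<Longrightarrow> Cmp X (\<eta> t) (\<theta> t) = Idn X (onO x t)"
    using iso unfolding homs_isomorphic_def by blast
  have c: "\<eta> t \<in> into X (onO x t)" "Dom X (\<eta> t) = onO x' t" "\<theta> t \<in> into X (onO x' t)"
    "Dom X (\<theta> t) = onO x t" "prA X (\<eta> t) = Idn C (prO X (onO x' t))" if "t \<in> Ob A" for t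
    using \<eta> \<theta> that by (auto simp: is_2mor_def vertical_def into_def)
  show ?thesis
    unfolding torsors_isomorphic_def
  proof (intro exI[of _ "\<lambda>t. res Y (\<eta> t)"] conjI ballI)
    fix t assume t: "t \<in> Ob A"
    note o = fctr_Ob[OF x t] and o' = fctr_Ob[OF x' t]
    have "bij_betw (res Y (\<eta> t)) (sec Y (onO x t)) (sec Y (onO x' t))"
    proof (rule bij_betw_byWitness[where f' = "res Y (\<theta> t)"])
      show "\<forall>v\<in>sec Y (onO x t). res Y (\<theta> t) (res Y (\<eta> t) v) = v"
        using P.res_Cmp[OF c(1)[OF t], of "\<theta> t"] c[OF t] inv(2)[OF t] P.res_Idn[OF o] by simp
      show "\<forall>v\<in>sec Y (onO x' t). res Y (\<eta> t) (res Y (\<theta> t) v) = v"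
        using P.res_Cmp[OF c(3)[OF t], of "\<eta> t"] c[OF t] inv(1)[OF t] P.res_Idn[OF o'] by simp
      show "res Y (\<eta> t) ` sec Y (onO x t) \<subseteq> sec Y (onO x' t)"
        using P.res_closed[OF c(1)[OF t]] c(2)[OF t] by auto
      show "res Y (\<theta> t) ` sec Y (onO x' t) \<subseteq> sec Y (onO x t)"
        using P.res_closed[OF c(3)[OF t]] c(4)[OF t] by auto
    qed
    then show "bij_betw (res Y (\<eta> t)) (sec (pull_torsor x Y) t) (sec (pull_torsor x' Y) t)"
      by (simp add: pull_torsor_def)
    fix v g assume v: "v \<in> sec (pull_torsor x Y) t" and g: "g \<in> carrier (grp (pull_gpsh (str A) G) t)"
    have po: "prO X (onO x' t) = prO A t"
      using X.pr_Cod[OF into_Arr[OF c(1)[OF t]]] into_Cod[OF c(1)[OF t]] c(5)[OF t]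
        xO[OF t] into_Cod[OF into_Idn[OF X.base X.pr_Ob[OF o']]] by simp
    have g': "g \<in> carrier (grp G (prO A t))" using g by (simp add: pull_gpsh_def str_def)
    have "res Y (\<eta> t) (ract Y (onO x t) v g) = ract Y (onO x' t) (res Y (\<eta> t) v) (gres GX (\<eta> t) g)"
      using P.res_act[OF c(1)[OF t], of v g] v g' c(2)[OF t] xO[OF t] by (simp add: sel pull_torsor_def)
    also have "gres GX (\<eta> t) g = g"
      using group_sheaf_res_Idn[OF G X.pr_Ob[OF o'], of g] g' po c(5)[OF t] by (simp add: sel)
    finally show "res Y (\<eta> t) (ract (pull_torsor x Y) t v g)
        = ract (pull_torsor x' Y) t (res Y (\<eta> t) v) g" by (simp add: pull_torsor_def)
  next
    fix a v assume a: "a \<in> Arr A" and v: "v \<in> sec (pull_torsor x Y) (Cod A a)"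
    have nat: "Cmp X (\<eta> (Cod A a)) (onA x' a) = Cmp X (onA x a) (\<eta> (Dom A a))"
      using \<eta> a by (simp add: is_2mor_def)
    note o = cat_Dom[OF A a] cat_Cod[OF A a]
    note xa = fctr_into[OF x into_I[OF a]] fctr_Dom[OF x into_I[OF a]]
    note xa' = fctr_into[OF x' into_I[OF a]] fctr_Dom[OF x' into_I[OF a]]
    have v': "v \<in> sec Y (onO x (Cod A a))" using v by (simp add: pull_torsor_def)
    have "res Y (\<eta> (Dom A a)) (res Y (onA x a) v) = res Y (Cmp X (onA x a) (\<eta> (Dom A a))) v"
      using P.res_Cmp[OF xa(1) _ v', of "\<eta> (Dom A a)"] c(1)[OF o(1)] xa(2) by simp
    also have "\<dots> = res Y (onA x' a) (res Y (\<eta> (Cod A a)) v)"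
      unfolding nat[symmetric]
      using P.res_Cmp[OF c(1)[OF o(2)] _ v', of "onA x' a"] c(2)[OF o(2)] xa'(1) by simp
    finally show "res Y (\<eta> (Dom A a)) (res (pull_torsor x Y) a v)
        = res (pull_torsor x' Y) a (res Y (\<eta> (Cod A a)) v)" by (simp add: pull_torsor_def)
  qed
qed

end

section \<open>From isomorphisms of torsors to sections of the twist\<close>

text \<open>Two lifts differ by a vertical arrow, and vertical arrows are identities.\<close>

lemma fibred_in_sets_unique_lift:
  assumes C: "is_cat C" and A: "fibred_in_sets C A" and t: "t \<in> Ob A" and f: "f \<in> into C (prO A t)"
  shows "\<exists>!a. a \<in> into A t \<and> prA A a = f"
proof -
  interpret A: fibred_category C A
    using C A by (intro fibred_category.intro) (simp_all add: fibred_in_sets_def)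
  obtain a where a: "a \<in> into A t" "prA A a = f" by (rule A.lift[OF t f])
  have "b = a" if b: "b \<in> into A t" "prA A b = f" for b
  proof -
    obtain \<chi> where \<chi>: "\<chi> \<in> into A (Dom A a)" "Dom A \<chi> = Dom A b" "Cmp A a \<chi> = b"
      "prA A \<chi> = Idn C (prO A (Dom A a))"
      by (rule A.vertical_factor[OF a(1) b(1)]) (use a b in auto)
    have D: "prO A (Dom A \<chi>) = prO A (Dom A a)"
      using A.pr_Dom_into[OF a(1)] A.pr_Dom_into[OF b(1)] a(2) b(2) \<chi>(2) by simp
    have "vertical C A \<chi>" using \<chi> D into_Arr[OF \<chi>(1)] by (simp add: vertical_def)
    then have e: "\<chi> = Idn A (Dom A \<chi>)" using A unfolding fibred_in_sets_def by blast
    have "Cod A \<chi> = Dom A \<chi>"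
      using e into_Cod[OF into_Idn[OF A.cat into_Dom[OF A.cat \<chi>(1)]]] by simp
    then have "Dom A \<chi> = Dom A a" using into_Cod[OF \<chi>(1)] by simp
    then show ?thesis using \<chi>(3) e Cmp_Idn_right[OF A.cat a(1)] by simp
  qed
  with a show ?thesis by blast
qed

context twisting
begin

context
  fixes A :: "('oa, 'aa, 'bo, 'ba) fib" and x
  assumes A: "fibred_in_sets C A" and x: "x \<in> homs A X"
begin

lemma fibA: "fibred_category C A"
  using X.base A by (intro fibred_category.intro) (simp_all add: fibred_in_sets_def)

text \<open>An arrow \<open>\<phi>\<close> into \<open>x t\<close> is, up to a vertical isomorphism, the image of a unique arrow of \<open>A\<close>
  into \<open>t\<close>.\<close>

definition arrow_of :: "'oa \<Rightarrow> 'a \<Rightarrow> 'aa" where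
  "arrow_of t \<phi> = (THE a. a \<in> into A t \<and> prA A a = prA X \<phi>)"

definition comparison :: "'oa \<Rightarrow> 'a \<Rightarrow> 'a" where
  "comparison t \<phi> = (SOME \<chi>. \<chi> \<in> into X (Dom X \<phi>) \<and> Dom X \<chi> = onO x (Dom A (arrow_of t \<phi>)) \<and>
     Cmp X \<phi> \<chi> = onA x (arrow_of t \<phi>) \<and> prA X \<chi> = Idn C (prO X (Dom X \<phi>)))"

lemma arrow_of:
  assumes t: "t \<in> Ob A" and \<phi>: "\<phi> \<in> into X (onO x t)"
  shows "arrow_of t \<phi> \<in> into A t" "prA A (arrow_of t \<phi>) = prA X \<phi>"
    "\<And>a. a \<in> into A t \<Longrightarrow> prA A a = prA X \<phi> \<Longrightarrow> arrow_of t \<phi> = a"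
proof -
  have u: "\<exists>!a. a \<in> into A t \<and> prA A a = prA X \<phi>"
    by (rule fibred_in_sets_unique_lift[OF X.base A t])
      (use X.pr_into[OF \<phi>] homs_D(4)[OF x t] in simp)
  show "arrow_of t \<phi> \<in> into A t" "prA A (arrow_of t \<phi>) = prA X \<phi>"
    using theI'[OF u] unfolding arrow_of_def by auto
  show "arrow_of t \<phi> = a" if "a \<in> into A t" "prA A a = prA X \<phi>" for a
    unfolding arrow_of_def using u that by (simp add: the1_equality)
qed

lemma comparison:
  assumes t: "t \<in> Ob A" and \<phi>: "\<phi> \<in> into X (onO x t)"
  shows "comparison t \<phi> \<in> into X (Dom X \<phi>)"
    "Dom X (comparison t \<phi>) = onO x (Dom A (arrow_of t \<phi>))"
    "Cmp X \<phi> (comparison t \<phi>) = onA x (arrow_of t \<phi>)"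
    "prA X (comparison t \<phi>) = Idn C (prO X (Dom X \<phi>))"
proof -
  note a = arrow_of(1,2)[OF t \<phi>] and F = homs_D(1)[OF x]
  have "\<exists>\<chi>. \<chi> \<in> into X (Dom X \<phi>) \<and> Dom X \<chi> = onO x (Dom A (arrow_of t \<phi>)) \<and>
     Cmp X \<phi> \<chi> = onA x (arrow_of t \<phi>) \<and> prA X \<chi> = Idn C (prO X (Dom X \<phi>))"
    by (rule X.vertical_factor[OF \<phi> fctr_into[OF F a(1)]])
      (use a(2) homs_D(5)[OF x into_Arr[OF a(1)]] fctr_Dom[OF F a(1)] in auto)
  from someI_ex[OF this, folded comparison_def]
  show "comparison t \<phi> \<in> into X (Dom X \<phi>)"
    "Dom X (comparison t \<phi>) = onO x (Dom A (arrow_of t \<phi>))"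
    "Cmp X \<phi> (comparison t \<phi>) = onA x (arrow_of t \<phi>)"
    "prA X (comparison t \<phi>) = Idn C (prO X (Dom X \<phi>))" by blast+
qed

lemma prO_arrow_of:
  assumes t: "t \<in> Ob A" and \<phi>: "\<phi> \<in> into X (onO x t)"
  shows "prO A (Dom A (arrow_of t \<phi>)) = prO X (Dom X \<phi>)"
proof -
  interpret A: fibred_category C A by (rule fibA)
  show ?thesis
    using A.pr_Dom_into[OF arrow_of(1)[OF t \<phi>]] X.pr_Dom_into[OF \<phi>] arrow_of(2)[OF t \<phi>] by simp
qed

text \<open>The last equation is checked after composition with \<open>\<phi>\<close>, since its two sides lie over the same
  arrow of the base.\<close>

lemma comparison_Cmp:
  assumes t: "t \<in> Ob A" and \<phi>: "\<phi> \<in> into X (onO x t)" and \<psi>: "\<psi> \<in> into X (Dom X \<phi>)"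
  obtains b where "b \<in> into A (Dom A (arrow_of t \<phi>))" "prA A b = prA X \<psi>"
    "arrow_of t (Cmp X \<phi> \<psi>) = Cmp A (arrow_of t \<phi>) b"
    "Dom A (arrow_of t (Cmp X \<phi> \<psi>)) = Dom A b"
    "Cmp X \<psi> (comparison t (Cmp X \<phi> \<psi>)) = Cmp X (comparison t \<phi>) (onA x b)"
proof -
  interpret A: fibred_category C A by (rule fibA)
  note F = homs_D(1)[OF x]
  note a = arrow_of(1,2)[OF t \<phi>] and c = comparison[OF t \<phi>]
  note \<phi>\<psi> = into_Cmp[OF X.cat \<phi> \<psi>] and D\<phi>\<psi> = Dom_Cmp[OF X.cat \<phi> \<psi>]
  note c' = comparison[OF t \<phi>\<psi>]
  obtain b where b: "b \<in> into A (Dom A (arrow_of t \<phi>))" "prA A b = prA X \<psi>"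
    by (rule A.lift[OF into_Dom[OF A.cat a(1)], of "prA X \<psi>"])
      (use X.pr_into[OF \<psi>] prO_arrow_of[OF t \<phi>] in auto)
  have ab: "arrow_of t (Cmp X \<phi> \<psi>) = Cmp A (arrow_of t \<phi>) b"
    by (rule arrow_of(3)[OF t \<phi>\<psi> into_Cmp[OF A.cat a(1) b(1)]])
      (simp add: A.pr_Cmp[OF a(1) b(1)] X.pr_Cmp[OF \<phi> \<psi>] a(2) b(2))
  have Dab: "Dom A (arrow_of t (Cmp X \<phi> \<psi>)) = Dom A b"
    unfolding ab by (rule Dom_Cmp[OF A.cat a(1) b(1)])
  have xb: "onA x b \<in> into X (Dom X (comparison t \<phi>))" "Dom X (onA x b) = onO x (Dom A b)"
    using fctr_into[OF F b(1)] fctr_Dom[OF F b(1)] c(2) by auto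
  have c'': "comparison t (Cmp X \<phi> \<psi>) \<in> into X (Dom X \<psi>)" using c'(1) D\<phi>\<psi> by simp
  have "Cmp X \<psi> (comparison t (Cmp X \<phi> \<psi>)) = Cmp X (comparison t \<phi>) (onA x b)"
  proof (rule X.cancel[OF \<phi>])
    show "Cmp X \<psi> (comparison t (Cmp X \<phi> \<psi>)) \<in> into X (Dom X \<phi>)" by (rule into_Cmp[OF X.cat \<psi> c''])
    show "Cmp X (comparison t \<phi>) (onA x b) \<in> into X (Dom X \<phi>)" by (rule into_Cmp[OF X.cat c(1) xb(1)])
    show "Dom X (Cmp X \<psi> (comparison t (Cmp X \<phi> \<psi>))) = Dom X (Cmp X (comparison t \<phi>) (onA x b))"
      using Dom_Cmp[OF X.cat \<psi> c''] Dom_Cmp[OF X.cat c(1) xb(1)] c'(2) xb(2) Dab by simp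
    have "prA X (Cmp X \<psi> (comparison t (Cmp X \<phi> \<psi>))) = prA X \<psi>"
      using X.pr_Cmp[OF \<psi> c''] c'(4) D\<phi>\<psi> Cmp_Idn_right[OF X.base X.pr_into[OF \<psi>]] X.pr_Dom_into[OF \<psi>]
      by simp
    moreover have "prA X (Cmp X (comparison t \<phi>) (onA x b)) = prA X \<psi>"
      using X.pr_Cmp[OF c(1) xb(1)] c(4) homs_D(5)[OF x into_Arr[OF b(1)]] b(2)
        Cmp_Idn_left[OF X.base X.pr_into[OF \<psi>]] by simp
    ultimately show "prA X (Cmp X \<psi> (comparison t (Cmp X \<phi> \<psi>)))
        = prA X (Cmp X (comparison t \<phi>) (onA x b))" by simp
    show "Cmp X \<phi> (Cmp X \<psi> (comparison t (Cmp X \<phi> \<psi>))) = Cmp X \<phi> (Cmp X (comparison t \<phi>) (onA x b))"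
      using Cmp_assoc[OF X.cat \<phi> \<psi> c''] Cmp_assoc[OF X.cat \<phi> c(1) xb(1)] c'(3) c(3)
        fctr_Cmp[OF F a(1) b(1)] ab by simp
  qed
  with b ab Dab show thesis by (rule that)
qed

text \<open>The comparison arrows at \<open>Dom A a\<close> are those at \<open>t\<close>.  This makes the sections constructed from them
  compatible with restriction along the image of \<open>a\<close>.\<close>

lemma comparison_pull:
  assumes a: "a \<in> into A t" and \<phi>: "\<phi> \<in> into X (onO x (Dom A a))"
  shows "Dom A (arrow_of t (Cmp X (onA x a) \<phi>)) = Dom A (arrow_of (Dom A a) \<phi>)"
    "comparison t (Cmp X (onA x a) \<phi>) = comparison (Dom A a) \<phi>"
proof -
  interpret A: fibred_category C A by (rule fibA)
  note F = homs_D(1)[OF x]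
  have t: "t \<in> Ob A" "Dom A a \<in> Ob A" using into_Ob[OF A.cat a] into_Dom[OF A.cat a] .
  note xa = fctr_into[OF F a]
  have \<phi>': "\<phi> \<in> into X (Dom X (onA x a))" using \<phi> fctr_Dom[OF F a] by simp
  note m = into_Cmp[OF X.cat xa \<phi>'] and D = Dom_Cmp[OF X.cat xa \<phi>']
  note b = arrow_of(1,2)[OF t(2) \<phi>] and c = comparison[OF t(2) \<phi>] and c' = comparison[OF t(1) m]
  have ab: "arrow_of t (Cmp X (onA x a) \<phi>) = Cmp A a (arrow_of (Dom A a) \<phi>)"
    by (rule arrow_of(3)[OF t(1) m into_Cmp[OF A.cat a b(1)]])
      (simp add: A.pr_Cmp[OF a b(1)] X.pr_Cmp[OF xa \<phi>'] b(2) homs_D(5)[OF x into_Arr[OF a]])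
  show Dab: "Dom A (arrow_of t (Cmp X (onA x a) \<phi>)) = Dom A (arrow_of (Dom A a) \<phi>)"
    unfolding ab by (rule Dom_Cmp[OF A.cat a b(1)])
  show "comparison t (Cmp X (onA x a) \<phi>) = comparison (Dom A a) \<phi>"
  proof (rule X.cancel[OF m])
    show "comparison (Dom A a) \<phi> \<in> into X (Dom X (Cmp X (onA x a) \<phi>))" using c(1) D by simp
    show "Dom X (comparison t (Cmp X (onA x a) \<phi>)) = Dom X (comparison (Dom A a) \<phi>)"
      using c'(2) c(2) Dab by simp
    show "prA X (comparison t (Cmp X (onA x a) \<phi>)) = prA X (comparison (Dom A a) \<phi>)"
      using c'(4) c(4) D by simp
    show "Cmp X (Cmp X (onA x a) \<phi>) (comparison t (Cmp X (onA x a) \<phi>))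
        = Cmp X (Cmp X (onA x a) \<phi>) (comparison (Dom A a) \<phi>)"
      using c'(3) c(3) Cmp_assoc[OF X.cat xa \<phi>' c(1)] fctr_Cmp[OF F a b(1)] ab by simp
  qed (rule c'(1))
qed

text \<open>Given isomorphisms \<open>h t\<close> from \<open>Y\<close> over \<open>x t\<close> to \<open>Z\<close> over the image of \<open>t\<close>, the isomorphism at an arrow
  \<open>\<phi>\<close> into \<open>x t\<close> restricts along the comparison arrow, which leads to an object in the image of \<open>x\<close>,
  and applies \<open>h\<close> there.  The comparison arrow is vertical, so it leaves \<open>Z\<close> unchanged.\<close>

lemma sections_of_isomorphic:
  assumes iso: "torsors_isomorphic A (pull_gpsh (str A) G) (pull_torsor x Y) (pull_torsor (str A) Z)"
  obtains E where "\<And>t. t \<in> Ob A \<Longrightarrow> E t \<in> sec tw (onO x t)"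
    "\<And>t a. a \<in> into A t \<Longrightarrow> res tw (onA x a) (E t) = E (Dom A a)"
proof -
  interpret A: fibred_category C A by (rule fibA)
  note F = homs_D(1)[OF x]
  have "\<exists>h. (\<forall>t\<in>Ob A. bij_betw (h t) (sec Y (onO x t)) (sec Z (prO A t))) \<and>
     (\<forall>a\<in>Arr A. \<forall>v\<in>sec Y (onO x (Cod A a)).
        h (Dom A a) (res Y (onA x a) v) = res Z (prA A a) (h (Cod A a) v)) \<and>
     (\<forall>t\<in>Ob A. \<forall>v\<in>sec Y (onO x t). \<forall>g\<in>carrier (grp G (prO A t)).
        h t (ract Y (onO x t) v g) = ract Z (prO A t) (h t v) g)"
    using iso by (simp add: torsors_isomorphic_def pull_torsor_def pull_gpsh_def str_def)
  then obtain h where h0: "\<And>t. t \<in> Ob A \<Longrightarrow> bij_betw (h t) (sec Y (onO x t)) (sec Z (prO A t))"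
    "\<And>a v. a \<in> Arr A \<Longrightarrow> v \<in> sec Y (onO x (Cod A a)) \<Longrightarrow>
      h (Dom A a) (res Y (onA x a) v) = res Z (prA A a) (h (Cod A a) v)"
    "\<And>t v g. t \<in> Ob A \<Longrightarrow> v \<in> sec Y (onO x t) \<Longrightarrow> g \<in> carrier (grp G (prO A t)) \<Longrightarrow>
      h t (ract Y (onO x t) v g) = ract Z (prO A t) (h t v) g"
    by blast
  define k where "k t \<phi> y = h (Dom A (arrow_of t \<phi>)) (res Y (comparison t \<phi>) y)" for t \<phi> y
  define E where "E t = graph_section (onO x t) (k t)" for t
  have Yc: "res Y (comparison t \<phi>) y \<in> sec Y (onO x (Dom A (arrow_of t \<phi>)))"
    if "t \<in> Ob A" "\<phi> \<in> into X (onO x t)" "y \<in> sec Y (Dom X \<phi>)" for t \<phi> y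
    using P.res_closed[OF comparison(1)[OF that(1,2)] that(3)] comparison(2)[OF that(1,2)] by simp
  have "E t \<in> sec tw (onO x t)" if t: "t \<in> Ob A" for t
    unfolding sec_tw E_def
  proof (rule graph_section_sheafify[OF fctr_Ob[OF F t]])
    fix \<phi> y assume \<phi>: "\<phi> \<in> into X (onO x t)" and y: "y \<in> sec Y (Dom X \<phi>)"
    note o = into_Dom[OF A.cat arrow_of(1)[OF t \<phi>]]
    show "k t \<phi> y \<in> sec ZX (Dom X \<phi>)"
      unfolding k_def sel using bij_betwE[OF h0(1)[OF o]] Yc[OF t \<phi> y] prO_arrow_of[OF t \<phi>] by simp
    {
      fix g assume g: "g \<in> carrier (grp GX (Dom X \<phi>))"
      then have g': "g \<in> carrier (grp G (prO X (Dom X \<phi>)))" by (simp add: sel)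
      have "gres GX (comparison t \<phi>) g = g"
        using group_sheaf_res_Idn[OF G X.pr_Ob[OF into_Dom[OF X.cat \<phi>]] g'] comparison(4)[OF t \<phi>]
        by (simp add: sel)
      then have "res Y (comparison t \<phi>) (ract Y (Dom X \<phi>) y g)
          = ract Y (onO x (Dom A (arrow_of t \<phi>))) (res Y (comparison t \<phi>) y) g"
        using P.res_act[OF comparison(1)[OF t \<phi>] y g] comparison(2)[OF t \<phi>] by simp
      then show "k t \<phi> (ract Y (Dom X \<phi>) y g) = ract ZX (Dom X \<phi>) (k t \<phi> y) g"
        unfolding k_def sel using h0(3)[OF o Yc[OF t \<phi> y], of g] g' prO_arrow_of[OF t \<phi>] by simp
    }
    fix \<psi> assume \<psi>: "\<psi> \<in> into X (Dom X \<phi>)"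
    obtain b where b: "b \<in> into A (Dom A (arrow_of t \<phi>))" "prA A b = prA X \<psi>"
      "Dom A (arrow_of t (Cmp X \<phi> \<psi>)) = Dom A b"
      "Cmp X \<psi> (comparison t (Cmp X \<phi> \<psi>)) = Cmp X (comparison t \<phi>) (onA x b)"
      by (rule comparison_Cmp[OF t \<phi> \<psi>])
    have c': "comparison t (Cmp X \<phi> \<psi>) \<in> into X (Dom X \<psi>)"
      using comparison(1)[OF t into_Cmp[OF X.cat \<phi> \<psi>]] Dom_Cmp[OF X.cat \<phi> \<psi>] by simp
    have xb: "onA x b \<in> into X (Dom X (comparison t \<phi>))"
      using fctr_into[OF F b(1)] comparison(2)[OF t \<phi>] by simp
    have "res Y (comparison t (Cmp X \<phi> \<psi>)) (res Y \<psi> y) = res Y (onA x b) (res Y (comparison t \<phi>) y)"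
      using P.res_Cmp[OF \<psi> c' y] P.res_Cmp[OF comparison(1)[OF t \<phi>] xb y] b(4) by simp
    then show "k t (Cmp X \<phi> \<psi>) (res Y \<psi> y) = res ZX \<psi> (k t \<phi> y)"
      unfolding k_def sel b(3)
      using h0(2)[OF into_Arr[OF b(1)]] Yc[OF t \<phi> y] into_Cod[OF b(1)] b(2) by simp
  qed
  moreover have "res tw (onA x a) (E t) = E (Dom A a)" if a: "a \<in> into A t" for t a
  proof
    fix \<phi>
    have D: "Dom X (onA x a) = onO x (Dom A a)" by (rule fctr_Dom[OF F a])
    show "res tw (onA x a) (E t) \<phi> = E (Dom A a) \<phi>"
    proof (cases "\<phi> \<in> into X (onO x (Dom A a))")
      case True
      then have \<phi>: "\<phi> \<in> into X (Dom X (onA x a))" by (simp add: D)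
      have "k t (Cmp X (onA x a) \<phi>) y = k (Dom A a) \<phi> y" for y
        unfolding k_def comparison_pull[OF a True] ..
      then show ?thesis
        using True \<phi> into_Cmp[OF X.cat fctr_into[OF F a] \<phi>] Dom_Cmp[OF X.cat fctr_into[OF F a] \<phi>]
        by (simp add: res_tw E_def graph_section_def)
    qed (simp add: res_tw E_def graph_section_def D)
  qed
  ultimately show thesis by (rule that)
qed

end

end

section \<open>Points of the twists\<close>

context twisting
begin

text \<open>A point of the twist is a point \<open>x\<close> of \<open>X\<close> with compatible sections of the twist over its
  values, and the projection forgets the sections.  A point of \<open>X\<close> that is only isomorphic to such a
  projection has an isomorphic pull-back of \<open>Y\<close>.\<close>

lemma ess_image_twist:
  assumes A: "fibred_in_sets C A"
  shows "ess_image C A (assoc_fib X tw) X (assoc_proj X tw) =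
    {x \<in> homs A X. torsors_isomorphic A (pull_gpsh (str A) G) (pull_torsor x Y) (pull_torsor (str A) Z)}"
    (is "?L = ?R")
proof
  interpret A: fibred_category C A
    using X.base A by (intro fibred_category.intro) (simp_all add: fibred_in_sets_def)
  let ?W = "assoc_fib X tw" and ?f = "assoc_proj X tw"
  show "?L \<subseteq> ?R"
  proof
    fix x assume "x \<in> ?L"
    then obtain y where x: "x \<in> homs A X" and y: "y \<in> homs A ?W"
      and iso: "homs_isomorphic C A X (comp_fctr A ?f y) x" unfolding ess_image_def by blast
    let ?x' = "comp_fctr A ?f y"
    define E where "E t = snd (onO y t)" for t
    note F = homs_D(1)[OF y]
    have O: "fst (onO y t) \<in> Ob X" "E t \<in> sec tw (fst (onO y t))" if "t \<in> Ob A" for t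
      using fctr_Ob[OF F that] unfolding E_def by (auto simp: assoc_fib_def)
    have M: "fst (onA y a) \<in> Arr X" "Cod X (fst (onA y a)) = fst (onO y (Cod A a))"
      "Dom X (fst (onA y a)) = fst (onO y (Dom A a))"
      "res tw (fst (onA y a)) (E (Cod A a)) = E (Dom A a)" if "a \<in> Arr A" for a
    proof -
      have "onA y a \<in> Arr ?W" "Dom ?W (onA y a) = onO y (Dom A a)" "Cod ?W (onA y a) = onO y (Cod A a)"
        using F that by (simp_all add: is_fctr_def)
      moreover obtain \<phi> s where "onA y a = (\<phi>, s)" by (cases "onA y a")
      ultimately have "\<phi> \<in> Arr X" "(Dom X \<phi>, res tw \<phi> s) = onO y (Dom A a)"
        "(Cod X \<phi>, s) = onO y (Cod A a)" "fst (onA y a) = \<phi>"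
        by (auto simp: assoc_fib_def)
      then show "fst (onA y a) \<in> Arr X" "Cod X (fst (onA y a)) = fst (onO y (Cod A a))"
        "Dom X (fst (onA y a)) = fst (onO y (Dom A a))"
        "res tw (fst (onA y a)) (E (Cod A a)) = E (Dom A a)"
        unfolding E_def by (metis fst_conv snd_conv)+
    qed
    have x'O: "onO ?x' t = fst (onO y t)" if "t \<in> Ob A" for t
      using fctr_Ob[OF F that] that by (simp add: comp_fctr_def assoc_proj_def)
    have x'A: "onA ?x' a = fst (onA y a)" if "a \<in> Arr A" for a
      using F that by (simp add: comp_fctr_def assoc_proj_def is_fctr_def)
    have x': "is_fctr A X ?x'"
      unfolding is_fctr_def
    proof (intro conjI ballI impI)
      fix t assume t: "t \<in> Ob A"
      show "onO ?x' t \<in> Ob X" using O(1)[OF t] x'O[OF t] by simp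
      show "onA ?x' (Idn A t) = Idn X (onO ?x' t)"
        using fctr_Idn[OF F t] x'A[OF into_Arr[OF into_Idn[OF A.cat t]]] x'O[OF t]
        by (simp add: assoc_fib_def split_beta)
    next
      fix a assume a: "a \<in> Arr A"
      show "onA ?x' a \<in> Arr X" "Dom X (onA ?x' a) = onO ?x' (Dom A a)"
        "Cod X (onA ?x' a) = onO ?x' (Cod A a)"
        using M[OF a] x'A[OF a] x'O[OF cat_Dom[OF A.cat a]] x'O[OF cat_Cod[OF A.cat a]] by simp_all
      fix b assume b: "b \<in> Arr A" and ab: "Cod A a = Dom A b"
      then have "Cmp A b a \<in> Arr A"
        using into_Arr[OF into_Cmp[OF A.cat into_I[OF b]], of a] a by (simp add: into_def)
      moreover have "onA y (Cmp A b a) = Cmp ?W (onA y b) (onA y a)"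
        using F a b ab by (simp add: is_fctr_def)
      ultimately show "onA ?x' (Cmp A b a) = Cmp X (onA ?x' b) (onA ?x' a)"
        using x'A a b by (simp add: assoc_fib_def split_beta)
    qed
    have pr: "prO X (onO ?x' t) = prO A t" if "t \<in> Ob A" for t
      using homs_D(4)[OF y that] x'O[OF that] by (simp add: assoc_fib_def split_beta)
    have "torsors_isomorphic A (pull_gpsh (str A) G) (pull_torsor ?x' Y) (pull_torsor (str A) Z)"
    proof (rule isomorphic_of_sections[OF A.cat x' pr, of E])
      show "prA X (onA ?x' a) = prA A a" if "a \<in> Arr A" for a
        using homs_D(5)[OF y that] x'A[OF that] by (simp add: assoc_fib_def split_beta)
      show "E t \<in> sec tw (onO ?x' t)" if "t \<in> Ob A" for t using O(2)[OF that] x'O[OF that] by simp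
      show "res tw (onA ?x' a) (E t) = E (Dom A a)" if a: "a \<in> into A t" for t a
        using M(4)[OF into_Arr[OF a]] x'A[OF into_Arr[OF a]] into_Cod[OF a] by simp
    qed
    moreover have "torsors_isomorphic A (pull_gpsh (str A) G) (pull_torsor x Y) (pull_torsor ?x' Y)"
      by (rule isomorphic_of_homs_isomorphic[OF A.cat homs_D(1,4)[OF x] iso x'])
    ultimately show "x \<in> ?R" using x torsors_isomorphic_trans[OF A.cat] by blast
  qed
  show "?R \<subseteq> ?L"
  proof
    fix x assume "x \<in> ?R"
    then have x: "x \<in> homs A X" and iso: "torsors_isomorphic A (pull_gpsh (str A) G)
      (pull_torsor x Y) (pull_torsor (str A) Z)" by auto
    note F = homs_D(1)[OF x]
    obtain E where E: "\<And>t. t \<in> Ob A \<Longrightarrow> E t \<in> sec tw (onO x t)"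
      "\<And>t a. a \<in> into A t \<Longrightarrow> res tw (onA x a) (E t) = E (Dom A a)"
      using sections_of_isomorphic[OF A x iso] by blast
    define y where "y = \<lparr> onO = (\<lambda>t\<in>Ob A. (onO x t, E t)), onA = (\<lambda>a\<in>Arr A. (onA x a, E (Cod A a))) \<rparr>"
    have yO: "onO y t = (onO x t, E t)" if "t \<in> Ob A" for t using that by (simp add: y_def)
    have yA: "onA y a = (onA x a, E (Cod A a))" if "a \<in> Arr A" for a using that by (simp add: y_def)
    have xA: "onA x a \<in> Arr X" "Dom X (onA x a) = onO x (Dom A a)" "Cod X (onA x a) = onO x (Cod A a)"
      if "a \<in> Arr A" for a using F that by (simp_all add: is_fctr_def)
    have "is_fctr A ?W y"
      unfolding is_fctr_def
    proof (intro conjI ballI impI)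
      fix t assume t: "t \<in> Ob A"
      show "onO y t \<in> Ob ?W" using fctr_Ob[OF F t] E(1)[OF t] by (simp add: yO[OF t] assoc_fib_def)
      have "Idn A t \<in> Arr A" "Cod A (Idn A t) = t"
        using into_Idn[OF A.cat t] by (simp_all add: into_def)
      then show "onA y (Idn A t) = Idn ?W (onO y t)"
        by (simp add: yA yO[OF t] assoc_fib_def fctr_Idn[OF F t])
    next
      fix a assume a: "a \<in> Arr A"
      note o = cat_Dom[OF A.cat a] cat_Cod[OF A.cat a]
      show "onA y a \<in> Arr ?W" "Dom ?W (onA y a) = onO y (Dom A a)" "Cod ?W (onA y a) = onO y (Cod A a)"
        using xA[OF a] E(1)[OF o(2)] E(2)[OF into_I[OF a]]
        by (simp_all add: yA[OF a] yO[OF o(1)] yO[OF o(2)] assoc_fib_def)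
      fix b assume b: "b \<in> Arr A" and ab: "Cod A a = Dom A b"
      have m: "a \<in> into A (Dom A b)" using a ab by (simp add: into_def)
      have "Cmp A b a \<in> Arr A" "Cod A (Cmp A b a) = Cod A b"
        using into_Cmp[OF A.cat into_I[OF b] m] by (simp_all add: into_def)
      then show "onA y (Cmp A b a) = Cmp ?W (onA y b) (onA y a)"
        by (simp add: yA a b assoc_fib_def fctr_Cmp[OF F into_I[OF b] m])
    qed
    then have y: "y \<in> homs A ?W"
      unfolding homs_def using homs_D(4,5)[OF x] yO yA
      by (simp add: assoc_fib_def) (simp add: y_def)
    have "comp_fctr A ?f y = x"
    proof (rule fctr.equality)
      have "onO y t \<in> Ob ?W" if "t \<in> Ob A" for t using \<open>is_fctr A ?W y\<close> that by (simp add: is_fctr_def)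
      then show "onO (comp_fctr A ?f y) = onO x"
        using homs_D(2)[OF x] yO
        by (auto simp: comp_fctr_def assoc_proj_def extensional_def restrict_def)
      have "onA y a \<in> Arr ?W" if "a \<in> Arr A" for a using \<open>is_fctr A ?W y\<close> that by (simp add: is_fctr_def)
      then show "onA (comp_fctr A ?f y) = onA x"
        using homs_D(3)[OF x] yA
        by (auto simp: comp_fctr_def assoc_proj_def extensional_def restrict_def)
    qed simp
    moreover have "homs_isomorphic C A X x x"
    proof -
      have i: "Idn X (onO x t) \<in> into X (onO x t)" "Dom X (Idn X (onO x t)) = onO x t"
        "prA X (Idn X (onO x t)) = Idn C (prO X (onO x t))" if "t \<in> Ob A" for t
        using into_Idn[OF X.cat fctr_Ob[OF F that]] Dom_Idn[OF X.cat fctr_Ob[OF F that]]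
          X.pr_Idn[OF fctr_Ob[OF F that]] .
      have "is_2mor C A X x x (\<lambda>t. Idn X (onO x t))"
        unfolding is_2mor_def vertical_def
        using i into_Arr[OF i(1)] into_Cod[OF i(1)] Cmp_Idn_left[OF X.cat fctr_into[OF F into_I]]
          Cmp_Idn_right[OF X.cat fctr_into[OF F into_I]] xA(2) cat_Cod[OF A.cat]
        by fastforce
      moreover have "Cmp X (Idn X (onO x t)) (Idn X (onO x t)) = Idn X (onO x t)" if "t \<in> Ob A" for t
        using Cmp_Idn_left[OF X.cat i(1)[OF that]] .
      ultimately show ?thesis unfolding homs_isomorphic_def by blast
    qed
    ultimately show "x \<in> ?L" unfolding ess_image_def using x y by force
  qed
qed

end

text \<open>Membership of the class of \<open>x\<^sup>* Y\<close> in the image of \<open>q\<^sup>*\<close> means that \<open>x\<^sup>* Y\<close> is isomorphic to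
  the pull-back of a torsor \<open>P\<close> on the base: \<open>q\<^sup>* P\<close> is a torsor, so it belongs to its own class, and
  the members of the class of \<open>x\<^sup>* Y\<close> are isomorphic to \<open>x\<^sup>* Y\<close>.\<close>

lemma homs_f_iff:
  fixes A :: "('oa, 'aa, 'bo, 'ba) fib" and X :: "('o, 'a, 'bo, 'ba) fib"
    and Y :: "('o, 'a, 'v, 'g) rpsh"
  assumes site: "site C J" and A: "fibred_category C A" and X: "fibred_category C X"
    and G: "is_group_sheaf C J G" and Y: "torsor_over J G X Y"
  shows "x \<in> homs_f C J G A X Y \<longleftrightarrow> x \<in> homs A X \<and>
    (\<exists>P :: ('bo, 'ba, 'v, 'g) rpsh. is_torsor C J G P \<and>
      torsors_isomorphic A (pull_gpsh (str A) G) (pull_torsor x Y) (pull_torsor (str A) P))"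
proof -
  interpret site C J by (rule site)
  interpret A: fibred_category C A by (rule A)
  interpret X: fibred_category C X by (rule X)
  have base_torsor: "torsor_over J G (base_fib C) P \<longleftrightarrow> is_torsor C J G P"
    for P :: "('bo, 'ba, 'v, 'g) rpsh"
  proof -
    have "(\<lambda>t. {R \<in> J t. is_sieve C t R}) = J" using sieve by auto
    then show ?thesis by (simp add: torsor_over_base_fib)
  qed
  have base_iso: "torsors_isomorphic (base_fib C) (pull_gpsh (str (base_fib C)) G) P Q
      \<longleftrightarrow> torsors_isomorphic C G P Q" for P Q :: "('bo, 'ba, 'v, 'g) rpsh"
    by (simp add: torsors_isomorphic_def pull_gpsh_def str_def base_fib_def)
  have class_q: "H1_pull J G A (str A) (torsor_class_over J G (base_fib C) P)
      = torsor_class_over J G A (pull_torsor (str A) P)"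
    if P: "is_torsor C J G P" for P :: "('bo, 'ba, 'v, 'g) rpsh"
  proof -
    interpret P: torsor C J G P
      using cat sieve G P by (intro torsor.intro) (auto simp: is_group_sheaf_def)
    have "torsor_class_over J G A (pull_torsor (str A) Q)
        = torsor_class_over J G A (pull_torsor (str A) P)" if "torsors_isomorphic C G P Q" for Q
      unfolding torsor_class_over_def
      by (rule torsor_class_eq[OF A.cat acted_presheaf_pull[OF A.str_fctr P.acted_presheaf]
            torsors_isomorphic_pull[OF A.str_fctr that], symmetric])
    moreover have "P \<in> torsor_class_over J G (base_fib C) P"
      using P base_torsor torsors_isomorphic_refl
      unfolding torsor_class_over_def torsor_class_def torsor_over_def by blast
    moreover have "torsors_isomorphic C G P Q" if "Q \<in> torsor_class_over J G (base_fib C) P" for Q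
      using that base_iso unfolding torsor_class_over_def torsor_class_def by blast
    ultimately show ?thesis unfolding H1_pull_def by blast
  qed
  have class_x: "torsor_class_over J G A (pull_torsor x Y) = torsor_class_over J G A (pull_torsor (str A) P)
      \<longleftrightarrow> torsors_isomorphic A (pull_gpsh (str A) G) (pull_torsor x Y) (pull_torsor (str A) P)"
    if x: "x \<in> homs A X" and P: "is_torsor C J G P" for P :: "('bo, 'ba, 'v, 'g) rpsh"
  proof
    have "is_torsor A (inherit J A) (pull_gpsh (str A) G) (pull_torsor (str A) P)"
      using A.torsor_pull[OF sieve G P] by (rule torsor.is_torsor)
    then have "pull_torsor (str A) P \<in> torsor_class_over J G A (pull_torsor (str A) P)"
      unfolding torsor_class_over_def torsor_class_def using torsors_isomorphic_refl by blast
    then show "torsors_isomorphic A (pull_gpsh (str A) G) (pull_torsor x Y) (pull_torsor (str A) P)"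
      if "torsor_class_over J G A (pull_torsor x Y) = torsor_class_over J G A (pull_torsor (str A) P)"
      unfolding that[symmetric] by (simp add: torsor_class_over_def torsor_class_def)
    have "acted_presheaf A (pull_gpsh x (pull_gpsh (str X) G)) (pull_torsor x Y)"
    proof (rule acted_presheaf_pull[OF homs_D(1)[OF x]])
      show "acted_presheaf X (pull_gpsh (str X) G) Y"
        using Y unfolding torsor_over_def is_torsor_def is_sheaf_def is_presheaf_def acted_presheaf_def
        by (elim conjE) simp
    qed
    then have "acted_presheaf A (pull_gpsh (str A) G) (pull_torsor x Y)"
      using homs_D(4)[OF x] by (simp add: acted_presheaf_def pull_gpsh_def str_def)
    then show "torsor_class_over J G A (pull_torsor x Y) = torsor_class_over J G A (pull_torsor (str A) P)"
      if "torsors_isomorphic A (pull_gpsh (str A) G) (pull_torsor x Y) (pull_torsor (str A) P)"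
      unfolding torsor_class_over_def using torsor_class_eq[OF A.cat _ that] by blast
  qed
  have "H1 J G (base_fib C)
      = {torsor_class_over J G (base_fib C) P | P :: ('bo, 'ba, 'v, 'g) rpsh. is_torsor C J G P}"
    by (simp add: H1_def base_torsor)
  then have "H1_pull J G A (str A) ` H1 J G (base_fib C)
      = (\<lambda>P :: ('bo, 'ba, 'v, 'g) rpsh. H1_pull J G A (str A) (torsor_class_over J G (base_fib C) P))
          ` {P. is_torsor C J G P}" by (simp add: image_image setcompr_eq_image)
  also have "\<dots> = (\<lambda>P. torsor_class_over J G A (pull_torsor (str A) P)) ` {P. is_torsor C J G P}"
    by (intro image_cong refl) (simp add: class_q)
  finally have image: "H1_pull J G A (str A) ` H1 J G (base_fib C)
      = (\<lambda>P :: ('bo, 'ba, 'v, 'g) rpsh. torsor_class_over J G A (pull_torsor (str A) P))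
          ` {P. is_torsor C J G P}" .
  show ?thesis
  proof (cases "x \<in> homs A X")
    case True
    then show ?thesis unfolding homs_f_def image image_iff Bex_def mem_Collect_eq
      using class_x[OF True] by meson
  qed (simp add: homs_f_def)
qed

theorem homs_f_eq_twists:
  fixes A :: "('oa, 'aa, 'bo, 'ba) fib" and X :: "('o, 'a, 'bo, 'ba) fib"
    and Y :: "('o, 'a, 'v, 'g) rpsh"
    and Z :: "('bo set \<times> ('ba \<Rightarrow> 'ba \<Rightarrow> 'g)) set \<Rightarrow> ('bo, 'ba, 'v, 'g) rpsh"
  assumes site: "pointed_site C J e" and A: "fibred_in_sets C A" and X: "fibred_in_groupoids C X"
    and G: "is_group_sheaf C J G" and Y: "torsor_over J G X Y"
    and Z: "\<And>\<sigma>. \<sigma> \<in> cech_H1 C J e G \<Longrightarrow> represents C J e G (Z \<sigma>) \<sigma>"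
  shows "homs_f C J G A X Y = (\<Union>\<sigma>\<in>cech_H1 C J e G.
    ess_image C A (assoc_fib X (twist C J G X Y (Z \<sigma>))) X (assoc_proj X (twist C J G X Y (Z \<sigma>))))"
proof -
  interpret pointed_site C J e by (rule site)
  have fX: "fibred_category C X" using cat X by (intro fibred_category.intro)
  have fA: "fibred_category C A"
    using cat A by (intro fibred_category.intro) (auto simp: fibred_in_sets_def)
  interpret A: fibred_category C A by (rule fA)
  note iff = homs_f_iff[OF site_axioms fA fX G Y]
  have Zt: "is_torsor C J G (Z \<sigma>)" if "\<sigma> \<in> cech_H1 C J e G" for \<sigma>
    using Z[OF that] by (simp add: represents_def)
  have tw: "twisting C J X G Y (Z \<sigma>)" if "\<sigma> \<in> cech_H1 C J e G" for \<sigma>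
    by (intro twisting.intro site_axioms fX twisting_axioms.intro G Y Zt[OF that])
  note im = twisting.ess_image_twist[OF tw A]
  have "(\<exists>P :: ('bo, 'ba, 'v, 'g) rpsh. is_torsor C J G P \<and>
        torsors_isomorphic A (pull_gpsh (str A) G) (pull_torsor x Y) (pull_torsor (str A) P))
    \<longleftrightarrow> (\<exists>\<sigma>\<in>cech_H1 C J e G.
        torsors_isomorphic A (pull_gpsh (str A) G) (pull_torsor x Y) (pull_torsor (str A) (Z \<sigma>)))"
    (is "?l \<longleftrightarrow> ?r") for x
  proof
    assume ?l
    then obtain P :: "('bo, 'ba, 'v, 'g) rpsh" where P: "is_torsor C J G P"
      and iso: "torsors_isomorphic A (pull_gpsh (str A) G) (pull_torsor x Y) (pull_torsor (str A) P)"
      by blast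
    interpret P: torsor C J G P
      using cat sieve G P by (intro torsor.intro) (auto simp: is_group_sheaf_def)
    obtain \<sigma> where "\<sigma> \<in> cech_H1 C J e G" "torsors_isomorphic C G P (Z \<sigma>)"
      by (rule P.isomorphic_to_representative[OF site Z])
    then show ?r
      using torsors_isomorphic_trans[OF A.cat iso] torsors_isomorphic_pull[OF A.str_fctr] by blast
  qed (use Zt in blast)
  then show ?thesis using im by (auto simp: iff)
qed

lemma Sch_pointed_site:
  assumes S: "is_scheme S" "S \<in> \<UU>"
  shows "pointed_site (Sch \<UU> S) (Sch_top \<tau> \<UU> S) (Sch_final S)"
  by (intro pointed_site.intro Sch_site pointed_site_axioms.intro Sch_final_Ob[OF S])
    (use Sch_final_arrow[OF S] in blast)

theorem proposition3p20:
  fixes \<tau> :: tau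
    and \<UU> :: "('p, 'r) ringed_space set"
    and S :: "('p, 'r) ringed_space"
    and A :: "('oa, 'aa, ('p, 'r) over_ob, ('p, 'r) over_arr) fib"
    and X :: "('ox, 'ax, ('p, 'r) over_ob, ('p, 'r) over_arr) fib"
    and G :: "(('p, 'r) over_ob, ('p, 'r) over_arr, 'g) gpsh"
    and Y :: "('ox, 'ax, 'v, 'g) rpsh"
    and Z :: "(('p, 'r) over_ob set \<times> (('p, 'r) over_arr \<Rightarrow> ('p, 'r) over_arr \<Rightarrow> 'g)) set
               \<Rightarrow> (('p, 'r) over_ob, ('p, 'r) over_arr, 'v, 'g) rpsh"
  defines "C \<equiv> Sch \<UU> S"
    and "J \<equiv> Sch_top \<tau> \<UU> S"
  assumes "is_scheme S" and "S \<in> \<UU>"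
    and "fibred_in_sets C A"
    and "fibred_in_setoids C X"
    and "is_group_sheaf C J G"
    and "torsor_over J G X Y"
    and "\<And>\<sigma>. \<sigma> \<in> cech_H1 C J (Sch_final S) G \<Longrightarrow> represents C J (Sch_final S) G (Z \<sigma>) \<sigma>"
  shows "homs_f C J G A X Y =
    (\<Union>\<sigma> \<in> cech_H1 C J (Sch_final S) G.
       ess_image C A (assoc_fib X (twist C J G X Y (Z \<sigma>))) X
         (assoc_proj X (twist C J G X Y (Z \<sigma>))))"
proof (rule homs_f_eq_twists)
  show "pointed_site C J (Sch_final S)"
    unfolding C_def J_def using assms(3,4) by (rule Sch_pointed_site)
  show "fibred_in_groupoids C X" using assms(6) by (simp add: fibred_in_setoids_def)
qed (use assms(5,7,8,9) in auto)

end
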